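(* Let $G$ be a finite planar graph with maximum degree $\Delta(G)\le 5$. Then $G$ has a subdivision $G'$ which is a planar geometric graph (for a suitable parameter $r>0$) and whose cop number satisfies $C(G')\in\{C(G),\,C(G)+1\}$.
   Context: The game of cops and robbers on a finite simple undirected graph $G$: first each of a finite set of cops is placed on a vertex, then the robber is placed on a vertex; in each subsequent step each cop, and then the robber, either moves to an adjacent vertex or stays. The cops win if at some step a cop occupies the robber's vertex. The cop number $C(G)$ is the minimum number of cops that can guarantee capturing the robber in finitely many steps (for a disconnected graph, it is the sum over components). A geometric graph with parameter $r>0$ is a drawing of a graph whose vertex set is a finite set $V$ of points in the plane and whose edges are exactly the straight line segments between all pairs of distinct points of $V$ at Euclidean distance at most $r$. A graph is said to have a subdivision into a geometric graph if some subdivision of it is isomorphic to (can be drawn as) a geometric graph.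
   Formalization: The bound C(G') in {C(G), C(G)+1} is claimed for connected G; for disconnected G, where it can fail (e.g. two disjoint copies of K_{1,1,3}), it is claimed separately for each component of G and the component of G' subdividing it. *)

theory Defs
  imports "HOL-Analysis.Analysis" "Graph_Theory.Graph_Theory"
begin

text \<open>
  A finite simple undirected graph is a \<^locale>\<open>pair_graph\<close>: a finite, loop-free digraph without
  parallel arcs whose arc relation is symmetric, so an edge between \<open>u\<close> and \<open>v\<close> is the pair of arcs
  \<open>(u, v)\<close>, \<open>(v, u)\<close> and the degree of a vertex is its out-degree. The plane is \<^typ>\<open>complex\<close>.

  The relation \<^term>\<open>subdivision_pair\<close> keeps the vertices of the subdivided graph and adds vertices of
  the same type. Hence a subdivision of an abstract graph \<open>G\<close> that is drawn in the plane is a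
  subdivision of a copy of \<open>G\<close> whose vertices are points.
\<close>

text \<open>On \<^typ>\<open>nat\<close> the supremum of the empty set is \<open>0\<close>.\<close>

definition max_degree :: "'a pair_pre_digraph \<Rightarrow> nat" where
  "max_degree G = (SUP v\<in>pverts G. out_degree (with_proj G) v)"

definition plane_drawing ::
  "'a pair_pre_digraph \<Rightarrow> ('a \<Rightarrow> complex) \<Rightarrow> ('a \<times> 'a \<Rightarrow> real \<Rightarrow> complex) \<Rightarrow> bool"
where
  "plane_drawing G p \<gamma> \<longleftrightarrow>
     inj_on p (pverts G) \<and>
     (\<forall>(u, v)\<in>parcs G. Path_Connected.arc (\<gamma> (u, v)) \<and>
        pathstart (\<gamma> (u, v)) = p u \<and> pathfinish (\<gamma> (u, v)) = p v \<and>
        path_image (\<gamma> (v, u)) = path_image (\<gamma> (u, v))) \<and>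
     (\<forall>(u, v)\<in>parcs G. \<forall>x\<in>pverts G. p x \<in> path_image (\<gamma> (u, v)) \<longrightarrow> x \<in> {u, v}) \<and>
     (\<forall>(u, v)\<in>parcs G. \<forall>(x, y)\<in>parcs G. {u, v} \<noteq> {x, y} \<longrightarrow>
        path_image (\<gamma> (u, v)) \<inter> path_image (\<gamma> (x, y)) \<subseteq> p ` ({u, v} \<inter> {x, y}))"

definition planar :: "'a pair_pre_digraph \<Rightarrow> bool" where
  "planar G \<longleftrightarrow> (\<exists>p \<gamma>. plane_drawing G p \<gamma>)"

definition geometric_graph :: "real \<Rightarrow> complex pair_pre_digraph \<Rightarrow> bool" where
  "geometric_graph r G \<longleftrightarrow> finite (pverts G) \<and>
     parcs G = {(u, v). u \<in> pverts G \<and> v \<in> pverts G \<and> u \<noteq> v \<and> dist u v \<le> r}"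

text \<open>Planarity here concerns the given drawing: no two of the straight segments cross.\<close>

definition planar_geometric_graph :: "real \<Rightarrow> complex pair_pre_digraph \<Rightarrow> bool" where
  "planar_geometric_graph r G \<longleftrightarrow>
     geometric_graph r G \<and> plane_drawing G (\<lambda>x. x) (\<lambda>(u, v). linepath u v)"

definition game_step :: "('a, 'b) pre_digraph \<Rightarrow> 'a \<Rightarrow> 'a \<Rightarrow> bool" where
  "game_step G u v \<longleftrightarrow> v \<in> verts G \<and> (u = v \<or> u \<rightarrow>\<^bsub>G\<^esub> v)"

definition robber_play :: "('a, 'b) pre_digraph \<Rightarrow> (nat \<Rightarrow> 'a) \<Rightarrow> bool" where
  "robber_play G \<rho> \<longleftrightarrow> \<rho> 0 \<in> verts G \<and> (\<forall>n. game_step G (\<rho> n) (\<rho> (Suc n)))"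

text \<open>
  A strategy for \<open>k\<close> cops maps the list of all robber positions seen so far to the next position of
  each cop \<open>i < k\<close>; in particular \<open>\<sigma> []\<close> is the initial placement. If the robber plays
  \<open>\<rho> 0, \<rho> 1, \<dots>\<close>, the cops stand on \<open>\<sigma> [\<rho> 0, \<dots>, \<rho> (n - 1)]\<close> when the robber arrives at \<open>\<rho> n\<close>, and
  then move to \<open>\<sigma> [\<rho> 0, \<dots>, \<rho> n]\<close>; the robber may be captured at either moment. Play
  after the first capture is irrelevant.
\<close>

definition cop_strategy :: "('a, 'b) pre_digraph \<Rightarrow> nat \<Rightarrow> ('a list \<Rightarrow> nat \<Rightarrow> 'a) \<Rightarrow> bool" where
  "cop_strategy G k \<sigma> \<longleftrightarrow>
     (\<forall>i<k. \<sigma> [] i \<in> verts G) \<and>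
     (\<forall>\<rho>. robber_play G \<rho> \<longrightarrow>
        (\<forall>n. \<forall>i<k. game_step G (\<sigma> (map \<rho> [0..<n]) i) (\<sigma> (map \<rho> [0..<Suc n]) i)))"

definition cops_win :: "('a, 'b) pre_digraph \<Rightarrow> nat \<Rightarrow> bool" where
  "cops_win G k \<longleftrightarrow> (\<exists>\<sigma>. cop_strategy G k \<sigma> \<and>
     (\<forall>\<rho>. robber_play G \<rho> \<longrightarrow>
        (\<exists>n. \<exists>i<k. \<sigma> (map \<rho> [0..<n]) i = \<rho> n \<or> \<sigma> (map \<rho> [0..<Suc n]) i = \<rho> n)))"

text \<open>
  The strong components of a symmetric digraph are the components of the graph. Since the components
  are summed over, a bound of the form \<open>C(G') \<le> C(G) + 1\<close> for subdivisions can only be expected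
  component by component: if every suitable subdivision of a connected graph has a larger cop number
  than the graph itself, then two disjoint copies of it need two additional cops.
\<close>

definition cop_number :: "('a, 'b) pre_digraph \<Rightarrow> nat" where
  "cop_number G = (\<Sum>H\<in>pre_digraph.sccs G. LEAST k. cops_win H k)"

lemma cops_win_card_verts:
  assumes "finite (verts G)"
  shows "cops_win G (card (verts G))"
proof -
  obtain f where f: "bij_betw f {..<card (verts G)} (verts G)"
    using ex_bij_betw_nat_finite[OF assms] by (auto simp: lessThan_atLeast0)
  have "cop_strategy G (card (verts G)) (\<lambda>_. f)"
    using f by (auto simp: cop_strategy_def game_step_def bij_betw_def)
  moreover have "\<exists>n. \<exists>i<card (verts G). f i = \<rho> n" if "robber_play G \<rho>" for \<rho>
  proof -
    have "\<rho> 0 \<in> f ` {..<card (verts G)}"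
      using that f by (simp add: robber_play_def bij_betw_def)
    then obtain i where "i < card (verts G)" "f i = \<rho> 0" by auto
    then show ?thesis by blast
  qed
  ultimately show ?thesis
    unfolding cops_win_def by (intro exI[of _ "\<lambda>_. f"]) auto
qed

lemma cop_number_connected:
  assumes "wf_digraph G" "strongly_connected G"
  shows "cop_number G = (LEAST k. cops_win G k)"
proof -
  interpret wf_digraph G by fact
  have G: "G \<in> sccs"
    using assms(2) induced_subgraph_refl by (auto simp: sccs_def induced_subgraph_def)
  have "H = G" if "H \<in> sccs" for H
    using in_sccs_subset_imp_eq[OF that G] that by (auto simp: sccs_def)
  with G have "sccs = {G}" by auto
  then show ?thesis by (simp add: cop_number_def)
qed

end

theory Submission
  imports Defs
begin

text \<open>
  Let \<open>G'\<close> arise from \<open>G\<close> by replacing every edge with a path of the same length \<open>L\<close>. Cops on \<open>G\<close> can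
  play against the images in \<open>G\<close> of the cops of a winning strategy on \<open>G'\<close>, one move on \<open>G\<close> standing
  for \<open>L\<close> moves on \<open>G'\<close>, so \<open>C(G) \<le> C(G')\<close>. Conversely, one additional cop who follows the trail of the
  robber forces him to run along each subdivided edge without resting or turning back; then the
  others can simulate a strategy on \<open>G\<close>, so \<open>C(G') \<le> C(G) + 1\<close>.

  It remains to draw \<open>G'\<close> as a geometric graph. As a geometric graph without triangles has no
  crossings, it suffices that points at distance at most \<open>r\<close> are consecutive on one of the paths. In a
  plane drawing of \<open>G\<close>, the part of each edge outside small discs around the vertices is connected by
  spirals to rays in five prescribed directions; scaling and rounding turn the edges into disjoint
  paths in the square grid. The grid is refined, five paths leave each vertex in a fixed pattern, and
  the lengths of the paths are made equal by letting them meander in squares around grid edges.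
\<close>

section \<open>Positional analysis of the game\<close>

text \<open>The common length \<open>L\<close> lets all simulated cops and the robber reach branch
  vertices at the same time. Vertices of \<open>G\<close> at distance two or more have images at
  distance at least \<open>2 * L\<close>, while a cop on \<open>G'\<close> stays within
  \<open>3 * L / 2\<close> of the image of his shadow on \<open>G\<close>. This gap is why a capture
  on \<open>G'\<close> implies that a shadow can capture on \<open>G\<close>. The degree bound
  enters as follows: two neighbours seen from a point under an angle of at most 60 degrees are
  themselves adjacent. Without triangles a point has at most five neighbours, and five leave little
  freedom; the square grid, with degree four, must be abandoned near the vertices. Equal lengths are
  a matter of area against length: a grid edge refined into \<open>m\<close> steps has room for
  detours of order \<open>m^2\<close>, while the lengths to be matched are linear in
  \<open>m\<close>. Detours are even, so parity is the other obstacle. Integer points with threshold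
  10 turn distance checks into integer arithmetic, and short vectors such as (8, 6) and (3, 9) give
  the five neighbours enough room.\<close>

primrec cop_rank :: "('a, 'b) pre_digraph \<Rightarrow> nat \<Rightarrow> nat \<Rightarrow> (nat \<Rightarrow> 'a) \<Rightarrow> 'a \<Rightarrow> bool" where
  "cop_rank G k 0 c r \<longleftrightarrow> (\<exists>i<k. game_step G (c i) r)"
| "cop_rank G k (Suc n) c r \<longleftrightarrow> cop_rank G k n c r \<or>
     (\<exists>c'. (\<forall>i<k. game_step G (c i) (c' i)) \<and> (\<forall>r'. game_step G r r' \<longrightarrow> cop_rank G k n c' r'))"

text \<open>The cops are to move in these positions, and rank 0 means that one of them can capture
  at once. Induction on ranks replaces reasoning about infinite plays and strategies with
  memory.\<close>

definition cop_wins_from :: "('a, 'b) pre_digraph \<Rightarrow> nat \<Rightarrow> (nat \<Rightarrow> 'a) \<Rightarrow> 'a \<Rightarrow> bool" where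
  "cop_wins_from G k c r \<longleftrightarrow> (\<exists>n. cop_rank G k n c r)"

lemma cop_rank_mono: "cop_rank G k n c r \<Longrightarrow> n \<le> m \<Longrightarrow> cop_rank G k m c r"
  by (induction m) (auto simp: le_Suc_eq)

lemma cop_wins_from_capture: "i < k \<Longrightarrow> game_step G (c i) r \<Longrightarrow> cop_wins_from G k c r"
  unfolding cop_wins_from_def by (intro exI[of _ 0]) auto

text \<open>Finiteness of the graph yields one bound for the ranks of all replies of the
  robber.\<close>

lemma cop_wins_from_move:
  assumes fin: "finite (verts G)"
    and move: "\<And>i. i < k \<Longrightarrow> game_step G (c i) (c' i)"
    and win: "\<And>r'. game_step G r r' \<Longrightarrow> cop_wins_from G k c' r'"
  shows "cop_wins_from G k c r"
proof -
  define R where "R = {r'. game_step G r r'}"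
  have "R \<subseteq> verts G"
    by (auto simp: R_def game_step_def)
  then have R: "finite R"
    using fin finite_subset by blast
  have "\<forall>r'\<in>R. \<exists>n. cop_rank G k n c' r'"
    using win by (auto simp: R_def cop_wins_from_def)
  then obtain N where N: "\<And>r'. r' \<in> R \<Longrightarrow> cop_rank G k (N r') c' r'"
    by metis
  \<comment> \<open>The inserted 0 keeps \<open>Max\<close> meaningful when \<open>R\<close> is
    empty.\<close>
  have "cop_rank G k (Max (insert 0 (N ` R))) c' r'" if "r' \<in> R" for r'
    using N[OF that] R that by (intro cop_rank_mono[OF N[OF that]]) auto
  then have "cop_rank G k (Suc (Max (insert 0 (N ` R)))) c r"
    using move by (auto simp: R_def)
  then show ?thesis
    unfolding cop_wins_from_def by blast
qed

lemma cop_wins_from_cong: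
  assumes "\<And>i. i < k \<Longrightarrow> c i = c' i"
  shows "cop_wins_from G k c r = cop_wins_from G k c' r"
proof -
  have "cop_rank G k n c r = cop_rank G k n c' r" for n
    using assms by (induction n) auto
  then show ?thesis
    by (simp add: cop_wins_from_def)
qed

text \<open>The definition of a strategy speaks about infinite plays only. A finite legal history is
  a prefix of one: the robber rests at its last vertex forever.\<close>

lemma finite_walk_legal:
  assumes \<sigma>: "cop_strategy G k \<sigma>" and "i < k"
    and h: "h \<noteq> []" "hd h \<in> verts G" "\<And>n. Suc n < length h \<Longrightarrow> game_step G (h ! n) (h ! Suc n)"
  shows "game_step G (\<sigma> (butlast h) i) (\<sigma> h i)"
proof -
  define \<rho> where "\<rho> n = (if n < length h then h ! n else last h)" for n
  have last: "last h = h ! (length h - 1)" using h(1) by (simp add: last_conv_nth)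
  have verts: "h ! n \<in> verts G" if "n < length h" for n
    using that
  proof (cases n)
    case 0 then show ?thesis using h by (simp add: hd_conv_nth)
  next
    case (Suc m) then show ?thesis using h(3)[of m] that by (simp add: game_step_def)
  qed
  have "robber_play G \<rho>"
    unfolding robber_play_def
  proof (intro conjI allI)
    show "\<rho> 0 \<in> verts G" using verts[of 0] h(1) by (simp add: \<rho>_def)
    fix n
    consider "Suc n < length h" | "Suc n = length h" | "Suc n > length h" by linarith
    then show "game_step G (\<rho> n) (\<rho> (Suc n))"
    proof cases
      case 1 then show ?thesis using h(3) by (simp add: \<rho>_def)
    next
      case 2
      then have "last h = h ! n" using last by (metis diff_Suc_1)
      then show ?thesis using 2 verts[of n] by (simp add: \<rho>_def game_step_def)
    next
      case 3 then show ?thesis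
        using verts[of "length h - 1"] h(1) last by (auto simp: \<rho>_def game_step_def)
    qed
  qed
  then have *: "game_step G (\<sigma> (map \<rho> [0..<n]) i) (\<sigma> (map \<rho> [0..<Suc n]) i)" for n
    using \<sigma> \<open>i < k\<close> by (auto simp: cop_strategy_def)
  have full: "map \<rho> [0..<length h] = h"
    by (rule nth_equalityI) (auto simp: \<rho>_def)
  have "map \<rho> [0..<length h - 1] = butlast h"
    by (rule nth_equalityI) (auto simp: \<rho>_def nth_butlast)
  moreover have "Suc (length h - 1) = length h" using h(1) by (cases h) auto
  ultimately show ?thesis using *[of "length h - 1"] full by simp
qed

text \<open>From a position that is not won the robber can answer every move of the cops by staying
  in such a position, and so he evades any strategy forever. From a won position the cops can lower
  the rank in every round.\<close>

lemma cops_win_iff: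
  assumes fin: "finite (verts G)"
  shows "cops_win G k \<longleftrightarrow> (\<exists>c. (\<forall>i<k. c i \<in> verts G) \<and> (\<forall>r\<in>verts G. cop_wins_from G k c r))"
proof
  assume "cops_win G k"
  then obtain \<sigma> where \<sigma>: "cop_strategy G k \<sigma>"
    and win: "\<And>\<rho>. robber_play G \<rho> \<Longrightarrow>
        \<exists>n. \<exists>i<k. \<sigma> (map \<rho> [0..<n]) i = \<rho> n \<or> \<sigma> (map \<rho> [0..<Suc n]) i = \<rho> n"
    unfolding cops_win_def by blast
  have "cop_wins_from G k (\<sigma> []) r" if r: "r \<in> verts G" for r
  proof (rule ccontr)
    assume not: "\<not> cop_wins_from G k (\<sigma> []) r"
    \<comment> \<open>By \<open>cop_wins_from_move\<close> a position that is not won has a reply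
      that keeps it so; these replies make up the evading play.\<close>
    define nxt where "nxt h = (SOME r'. game_step G (last h) r' \<and> \<not> cop_wins_from G k (\<sigma> h) r')" for h
    define hist where "hist = rec_nat [r] (\<lambda>_ h. h @ [nxt h])"
    have hist0: "hist 0 = [r]" and histS: "\<And>n. hist (Suc n) = hist n @ [nxt (hist n)]"
      by (simp_all add: hist_def)
    have len: "length (hist n) = Suc n" for n by (induction n) (simp_all add: hist0 histS)
    define \<rho> where "\<rho> n = last (hist n)" for n
    have hist_nth: "hist n ! m = \<rho> m" if "m \<le> n" for m n
      using that
    proof (induction n)
      case 0 then show ?case by (simp add: hist0 \<rho>_def)
    next
      case (Suc n)
      show ?case
      proof (cases "m = Suc n")
        case True
        then show ?thesis using len[of n] by (simp add: histS \<rho>_def nth_append)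
      next
        case False
        then show ?thesis using Suc len[of n] by (simp add: histS nth_append)
      qed
    qed
    have hist: "hist n = map \<rho> [0..<Suc n]" for n
      by (rule nth_equalityI) (simp_all add: len hist_nth del: upt_Suc)
    \<comment> \<open>Legality and survival need a joint induction: the moves of the cops are known
      to be legal only after a legal history.\<close>
    have main: "(\<forall>m<n. game_step G (\<rho> m) (\<rho> (Suc m))) \<and> \<not> cop_wins_from G k (\<sigma> (map \<rho> [0..<n])) (\<rho> n)" for n
    proof (induction n)
      case 0 then show ?case using not by (simp add: \<rho>_def hist0)
    next
      case (Suc n)
      have leg: "game_step G (\<sigma> (map \<rho> [0..<n]) i) (\<sigma> (map \<rho> [0..<Suc n]) i)" if "i < k" for i
      proof -
        have "game_step G (\<sigma> (butlast (hist n)) i) (\<sigma> (hist n) i)"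
        proof (rule finite_walk_legal[OF \<sigma> that])
          show "hist n \<noteq> []" using len[of n] by auto
          then show "hd (hist n) \<in> verts G"
            using hist_nth[of 0 n] r hist_nth[of 0 0] by (simp add: hd_conv_nth hist0)
          fix m assume "Suc m < length (hist n)"
          then have "m < n" by (simp add: len)
          then show "game_step G (hist n ! m) (hist n ! Suc m)"
            using Suc hist_nth[of m n] hist_nth[of "Suc m" n] by simp
        qed
        moreover have "butlast (hist n) = map \<rho> [0..<n]" by (simp add: hist)
        ultimately show ?thesis by (simp add: hist)
      qed
      have "\<exists>r'. game_step G (\<rho> n) r' \<and> \<not> cop_wins_from G k (\<sigma> (hist n)) r'"
        using Suc cop_wins_from_move[OF fin, of k "\<sigma> (map \<rho> [0..<n])" "\<sigma> (hist n)" "\<rho> n"] leg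
        unfolding hist by blast
      then have "game_step G (\<rho> n) (nxt (hist n)) \<and> \<not> cop_wins_from G k (\<sigma> (hist n)) (nxt (hist n))"
        unfolding nxt_def \<rho>_def by (rule someI_ex)
      moreover have "nxt (hist n) = \<rho> (Suc n)" by (simp add: \<rho>_def histS)
      ultimately show ?case using Suc by (auto simp: hist less_Suc_eq)
    qed
    have "robber_play G \<rho>"
      using main r by (auto simp: robber_play_def \<rho>_def hist0)
    then obtain n i where i: "i < k" and
      "\<sigma> (map \<rho> [0..<n]) i = \<rho> n \<or> \<sigma> (map \<rho> [0..<Suc n]) i = \<rho> n"
      using win by blast
    moreover have "game_step G (\<sigma> (map \<rho> [0..<n]) i) (\<sigma> (map \<rho> [0..<Suc n]) i)"
      using \<sigma> \<open>robber_play G \<rho>\<close> i unfolding cop_strategy_def by blast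
    moreover have "\<rho> n \<in> verts G"
      using main[of "Suc n"] r by (cases n) (auto simp: game_step_def \<rho>_def hist0)
    ultimately have "game_step G (\<sigma> (map \<rho> [0..<n]) i) (\<rho> n)"
      by (auto simp: game_step_def)
    then show False
      using main[of n] cop_wins_from_capture[OF i, of G "\<sigma> (map \<rho> [0..<n])"] by blast
  qed
  then show "\<exists>c. (\<forall>i<k. c i \<in> verts G) \<and> (\<forall>r\<in>verts G. cop_wins_from G k c r)"
    using \<sigma> unfolding cop_strategy_def by blast
next
  assume "\<exists>c. (\<forall>i<k. c i \<in> verts G) \<and> (\<forall>r\<in>verts G. cop_wins_from G k c r)"
  then obtain c0 where c0: "\<And>i. i < k \<Longrightarrow> c0 i \<in> verts G"
    and win: "\<And>r. r \<in> verts G \<Longrightarrow> cop_wins_from G k c0 r" by blast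
  \<comment> \<open>A good move serves every rank of the position at once, so it can be chosen
    without knowing a rank. What serves the least rank serves all of them.\<close>
  define good where "good c r c' \<longleftrightarrow> (\<forall>i<k. game_step G (c i) (c' i)) \<and>
    (\<forall>n. cop_rank G k n c r \<longrightarrow> (\<exists>i<k. c' i = r) \<or>
      (\<exists>m<n. \<forall>r'. game_step G r r' \<longrightarrow> cop_rank G k m c' r'))" for c r c'
  have ex: "\<exists>c'. good c r c'" if "\<forall>i<k. c i \<in> verts G" for c r
  proof (cases "\<exists>n. cop_rank G k n c r")
    case False
    then show ?thesis using that by (intro exI[of _ c]) (auto simp: good_def game_step_def)
  next
    case True
    define n where "n = (LEAST n. cop_rank G k n c r)"
    have n: "cop_rank G k n c r" and min: "\<And>m. cop_rank G k m c r \<Longrightarrow> n \<le> m"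
      using True LeastI_ex[OF True] by (auto simp: n_def intro: Least_le)
    show ?thesis
    proof (cases n)
      case 0
      then obtain i where "i < k" "game_step G (c i) r" using n by auto
      then show ?thesis using that
        by (intro exI[of _ "c(i := r)"]) (auto simp: good_def game_step_def)
    next
      case (Suc m)
      then have "\<not> cop_rank G k m c r" using min[of m] by auto
      then obtain c' where "\<forall>i<k. game_step G (c i) (c' i)" "\<forall>r'. game_step G r r' \<longrightarrow> cop_rank G k m c' r'"
        using n Suc by auto
      moreover have "m < l" if "cop_rank G k l c r" for l using min[OF that] Suc by simp
      ultimately have "good c r c'" unfolding good_def by blast
      then show ?thesis by blast
    qed
  qed
  define nxt where "nxt c r = (SOME c'. good c r c')" for c r
  have nxt: "good c r (nxt c r)" if "\<forall>i<k. c i \<in> verts G" for c r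
    unfolding nxt_def using ex[OF that] by (rule someI_ex)
  \<comment> \<open>The positions of the cops are recomputed from the history by iterating the
    positional rule.\<close>
  define \<sigma> where "\<sigma> h = foldl nxt c0 h" for h
  define X where "X \<rho> n = \<sigma> (map \<rho> [0..<n])" for \<rho> n
  have X0: "X \<rho> 0 = c0" and XS: "X \<rho> (Suc n) = nxt (X \<rho> n) (\<rho> n)" for \<rho> n
    by (simp_all add: X_def \<sigma>_def)
  have Xv: "\<forall>i<k. X \<rho> n i \<in> verts G" for \<rho> n
  proof (induction n)
    case 0 then show ?case using c0 by (simp add: X0)
  next
    case (Suc n) then show ?case using nxt[OF Suc, of "\<rho> n"] by (auto simp: XS good_def game_step_def)
  qed
  have Xg: "good (X \<rho> n) (\<rho> n) (X \<rho> (Suc n))" for \<rho> n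
    using nxt[OF Xv] by (simp add: XS)
  have "cop_strategy G k \<sigma>"
    unfolding cop_strategy_def X_def[symmetric]
    using Xg c0 by (auto simp: good_def \<sigma>_def)
  moreover have "\<exists>n. \<exists>i<k. X \<rho> n i = \<rho> n \<or> X \<rho> (Suc n) i = \<rho> n" if play: "robber_play G \<rho>" for \<rho>
  proof -
    have "\<exists>n. \<exists>i<k. X \<rho> (Suc n) i = \<rho> n" if "cop_rank G k m (X \<rho> n) (\<rho> n)" for m n
      using that
    proof (induction m arbitrary: n rule: less_induct)
      case (less m)
      show ?case
      proof (cases "\<exists>i<k. X \<rho> (Suc n) i = \<rho> n")
        case False
        then obtain l where "l < m" "\<And>r'. game_step G (\<rho> n) r' \<Longrightarrow> cop_rank G k l (X \<rho> (Suc n)) r'"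
          using Xg[of \<rho> n] less.prems unfolding good_def by blast
        moreover have "game_step G (\<rho> n) (\<rho> (Suc n))" using play by (simp add: robber_play_def)
        ultimately show ?thesis using less.IH by blast
      qed auto
    qed
    moreover have "\<exists>m. cop_rank G k m (X \<rho> 0) (\<rho> 0)"
      using win[of "\<rho> 0"] play by (simp add: X0 robber_play_def cop_wins_from_def)
    ultimately show ?thesis by blast
  qed
  ultimately show "cops_win G k"
    unfolding cops_win_def X_def by blast
qed

text \<open>Ranks are cumulative. Going down to the stage at which the rank was first attained gives
  a genuine move, and the strict decrease serves as an induction measure.\<close>

lemma cop_rank_move:
  assumes "cop_rank G k n c r" "\<not> cop_rank G k 0 c r"
  obtains n' c' where "n' < n" "\<And>i. i < k \<Longrightarrow> game_step G (c i) (c' i)"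
    "\<And>r'. game_step G r r' \<Longrightarrow> cop_rank G k n' c' r'"
proof -
  have "\<exists>n'<n. \<exists>c'. (\<forall>i<k. game_step G (c i) (c' i)) \<and> (\<forall>r'. game_step G r r' \<longrightarrow> cop_rank G k n' c' r')"
    using assms
  proof (induction n)
    case (Suc n)
    show ?case
    proof (cases "cop_rank G k n c r")
      case True
      then show ?thesis using Suc less_SucI by blast
    next
      case False
      then show ?thesis using Suc.prems(1) by auto
    qed
  qed simp
  then show ?thesis using that by blast
qed

section \<open>Uniform subdivisions\<close>

text \<open>\<open>Q u v\<close> runs along the path of length \<open>L\<close> that replaces the edge \<open>uv\<close>; for
  \<open>u = v\<close> it rests at \<open>f u\<close>.\<close>

locale uniform_subdivision =
  fixes H :: "('a, 'b) pre_digraph" and H' :: "('c, 'd) pre_digraph"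
    and f :: "'a \<Rightarrow> 'c" and Q :: "'a \<Rightarrow> 'a \<Rightarrow> nat \<Rightarrow> 'c" and L :: nat
  assumes fin: "finite (verts H)" and fin': "finite (verts H')"
    and wf: "u \<rightarrow>\<^bsub>H\<^esub> v \<Longrightarrow> u \<in> verts H"
    and sym: "u \<rightarrow>\<^bsub>H\<^esub> v \<Longrightarrow> v \<rightarrow>\<^bsub>H\<^esub> u"
    and irrefl: "\<not> u \<rightarrow>\<^bsub>H\<^esub> u"
    and L: "L \<ge> 2"
    and verts_H': "verts H' = f ` verts H \<union> {Q u v i | u v i. u \<rightarrow>\<^bsub>H\<^esub> v \<and> i \<le> L}"
    and Q_0: "u \<rightarrow>\<^bsub>H\<^esub> v \<Longrightarrow> Q u v 0 = f u"
    and Q_refl: "Q u u i = f u"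
    and Q_rev: "u \<rightarrow>\<^bsub>H\<^esub> v \<Longrightarrow> i \<le> L \<Longrightarrow> Q v u i = Q u v (L - i)"
    and adj_H': "x \<rightarrow>\<^bsub>H'\<^esub> y \<longleftrightarrow> (\<exists>u v i. u \<rightarrow>\<^bsub>H\<^esub> v \<and> i < L \<and> x = Q u v i \<and> y = Q u v (Suc i))"
    and inj_f: "inj_on f (verts H)"
    and Q_inner: "u \<rightarrow>\<^bsub>H\<^esub> v \<Longrightarrow> 0 < i \<Longrightarrow> i < L \<Longrightarrow> Q u v i \<notin> f ` verts H"
    and Q_inj: "u \<rightarrow>\<^bsub>H\<^esub> v \<Longrightarrow> u' \<rightarrow>\<^bsub>H\<^esub> v' \<Longrightarrow> 0 < i \<Longrightarrow> i < L \<Longrightarrow> j < L \<Longrightarrow>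
      Q u v i = Q u' v' j \<Longrightarrow> u = u' \<and> v = v' \<and> i = j \<or> u = v' \<and> v = u' \<and> i = L - j"
begin

lemma wf2: "u \<rightarrow>\<^bsub>H\<^esub> v \<Longrightarrow> v \<in> verts H"
  using wf sym by blast

lemma Q_L: "u \<rightarrow>\<^bsub>H\<^esub> v \<Longrightarrow> Q u v L = f v"
  using Q_rev[OF sym, of u v L] Q_0[OF sym] by simp

lemma step_H: "game_step H u v \<longleftrightarrow> v \<in> verts H \<and> (u = v \<or> u \<rightarrow>\<^bsub>H\<^esub> v)"
  by (simp add: game_step_def)

lemma Q_0': "game_step H u v \<Longrightarrow> Q u v 0 = f u"
  and Q_L': "game_step H u v \<Longrightarrow> Q u v L = f v"
  using Q_0 Q_L Q_refl by (auto simp: step_H)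

lemma Q_verts: "game_step H u v \<Longrightarrow> i \<le> L \<Longrightarrow> Q u v i \<in> verts H'"
  unfolding verts_H' step_H using Q_refl by auto

lemma Q_adj: "u \<rightarrow>\<^bsub>H\<^esub> v \<Longrightarrow> i < L \<Longrightarrow> Q u v i \<rightarrow>\<^bsub>H'\<^esub> Q u v (Suc i)"
  using adj_H' by blast

lemma Q_step: "game_step H u v \<Longrightarrow> i < L \<Longrightarrow> game_step H' (Q u v i) (Q u v (Suc i))"
  using Q_verts[of u v "Suc i"] Q_adj[of u v i] Q_refl
  by (auto simp: game_step_def)

lemma sym': "x \<rightarrow>\<^bsub>H'\<^esub> y \<Longrightarrow> y \<rightarrow>\<^bsub>H'\<^esub> x"
proof -
  assume "x \<rightarrow>\<^bsub>H'\<^esub> y"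
  then obtain u v i where *: "u \<rightarrow>\<^bsub>H\<^esub> v" "i < L" "x = Q u v i" "y = Q u v (Suc i)"
    using adj_H' by blast
  then have "x = Q v u (Suc (L - Suc i))" "y = Q v u (L - Suc i)"
    using Q_rev[OF sym[OF *(1)], of i] Q_rev[OF sym[OF *(1)], of "Suc i"] by (auto simp: Suc_diff_Suc)
  then show ?thesis
    using adj_H' sym[OF *(1)] *(2) by (metis diff_less zero_less_Suc L not_less_zero zero_less_iff_neq_zero)
qed

lemma wf': "x \<rightarrow>\<^bsub>H'\<^esub> y \<Longrightarrow> x \<in> verts H'" "x \<rightarrow>\<^bsub>H'\<^esub> y \<Longrightarrow> y \<in> verts H'"
  unfolding adj_H' verts_H' by fastforce+

lemma adj_f: "u \<in> verts H \<Longrightarrow> f u \<rightarrow>\<^bsub>H'\<^esub> y \<longleftrightarrow> (\<exists>v. u \<rightarrow>\<^bsub>H\<^esub> v \<and> y = Q u v 1)"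
proof safe
  assume u: "u \<in> verts H" and "f u \<rightarrow>\<^bsub>H'\<^esub> y"
  then obtain u' v i where *: "u' \<rightarrow>\<^bsub>H\<^esub> v" "i < L" "f u = Q u' v i" "y = Q u' v (Suc i)"
    using adj_H' by blast
  have "i = 0" using Q_inner[OF *(1) _ *(2)] *(3) u by (metis imageI neq0_conv)
  moreover then have "u' = u" using * Q_0[OF *(1)] inj_f u wf[OF *(1)] by (auto dest: inj_onD)
  ultimately show "\<exists>v. u \<rightarrow>\<^bsub>H\<^esub> v \<and> y = Q u v 1" using * by auto
next
  fix v assume "u \<rightarrow>\<^bsub>H\<^esub> v" then show "f u \<rightarrow>\<^bsub>H'\<^esub> Q u v 1"
    using Q_adj[of u v 0] L Q_0 by simp
qed

lemma adj_inner:
  assumes "u \<rightarrow>\<^bsub>H\<^esub> v" "0 < i" "i < L"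
  shows "Q u v i \<rightarrow>\<^bsub>H'\<^esub> y \<longleftrightarrow> y = Q u v (Suc i) \<or> y = Q u v (i - 1)"
proof
  assume "Q u v i \<rightarrow>\<^bsub>H'\<^esub> y"
  then obtain u' v' j where *: "u' \<rightarrow>\<^bsub>H\<^esub> v'" "j < L" "Q u v i = Q u' v' j" "y = Q u' v' (Suc j)"
    using adj_H' by blast
  from Q_inj[OF assms(1) *(1) assms(2,3) *(2,3)]
  show "y = Q u v (Suc i) \<or> y = Q u v (i - 1)"
  proof
    assume "u = v' \<and> v = u' \<and> i = L - j"
    then have "y = Q u v (L - Suc j)" "L - Suc j = i - 1"
      using * Q_rev[OF assms(1), of "Suc j"] by auto
    then show ?thesis by simp
  qed (use * in auto)
next
  have "Q u v (i - 1) \<rightarrow>\<^bsub>H'\<^esub> Q u v i" using Q_adj[OF assms(1), of "i - 1"] assms by simp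
  then show "y = Q u v (Suc i) \<or> y = Q u v (i - 1) \<Longrightarrow> Q u v i \<rightarrow>\<^bsub>H'\<^esub> y"
    using Q_adj[OF assms(1,3)] sym' by blast
qed

subsection \<open>Fewer cops do not suffice on the subdivision\<close>

text \<open>The distance in \<open>H\<close>, cut off at 2: radii below \<open>2 * L\<close> on the
  subdivision cannot see any further.\<close>

definition trunc_dist :: "'a \<Rightarrow> 'a \<Rightarrow> nat" where
  "trunc_dist a u = (if a = u then 0 else if a \<rightarrow>\<^bsub>H\<^esub> u then 1 else 2)"

text \<open>For \<open>n < 2 * L\<close> this says that \<open>x\<close> has distance at most \<open>n\<close> from \<open>f a\<close>.\<close>

definition near :: "'a \<Rightarrow> 'c \<Rightarrow> nat \<Rightarrow> bool" where
  "near a x n \<longleftrightarrow> (\<exists>u v i. game_step H u v \<and> u \<in> verts H \<and> i \<le> L \<and> x = Q u v i \<and>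
     L * trunc_dist a u + i \<le> n)"

lemma trunc_dist_step: "u \<rightarrow>\<^bsub>H\<^esub> v \<Longrightarrow> trunc_dist a v \<le> Suc (trunc_dist a u)"
  by (auto simp: trunc_dist_def)

lemma near_mono: "near a x n \<Longrightarrow> n \<le> m \<Longrightarrow> near a x m"
  unfolding near_def using order_trans[of _ n m] by blast

text \<open>A branch vertex is represented as \<open>Q w v i\<close> for various edges, with
  \<open>i = 0\<close> or \<open>i = L\<close>; by the triangle inequality
  \<open>trunc_dist_step\<close> every representation implies the same bound.\<close>

lemma near_f: "near a (f u) n \<Longrightarrow> u \<in> verts H \<Longrightarrow> L * trunc_dist a u \<le> n"
proof -
  assume "near a (f u) n" and u: "u \<in> verts H"
  then obtain w v i where *: "game_step H w v" "w \<in> verts H" "i \<le> L" "f u = Q w v i"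
      "L * trunc_dist a w + i \<le> n"
    unfolding near_def by blast
  show ?thesis
  proof (cases "w = v")
    case True
    then show ?thesis using * Q_refl inj_f u by (auto dest: inj_onD)
  next
    case False
    then have wv: "w \<rightarrow>\<^bsub>H\<^esub> v" using * by (auto simp: step_H)
    have "i = 0 \<or> i = L" using Q_inner[OF wv, of i] * u by force
    then show ?thesis
    proof
      assume "i = 0"
      then show ?thesis using * Q_0[OF wv] inj_f u by (auto dest: inj_onD)
    next
      assume i: "i = L"
      then have "v = u" using * Q_L[OF wv] inj_f u wf2[OF wv] by (auto dest: inj_onD)
      have "L * trunc_dist a v \<le> L * Suc (trunc_dist a w)"
        using trunc_dist_step[OF wv] by (intro mult_le_mono2) auto
      then show ?thesis using * i \<open>v = u\<close> by simp
    qed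
  qed
qed

text \<open>An inner vertex has exactly two representations, one from each end of its edge.\<close>

lemma near_inner:
  assumes "near a (Q u v i) n" "u \<rightarrow>\<^bsub>H\<^esub> v" "0 < i" "i < L"
  shows "L * trunc_dist a u + i \<le> n \<or> L * trunc_dist a v + (L - i) \<le> n"
proof -
  obtain u' v' j where *: "game_step H u' v'" "u' \<in> verts H" "j \<le> L" "Q u v i = Q u' v' j"
      "L * trunc_dist a u' + j \<le> n"
    using assms(1) unfolding near_def by blast
  have inner: "Q u v i \<notin> f ` verts H" using Q_inner assms by blast
  then have "u' \<noteq> v'" using * Q_refl by auto
  then have uv': "u' \<rightarrow>\<^bsub>H\<^esub> v'" using * by (auto simp: step_H)
  have "j \<noteq> L" using inner * Q_L[OF uv'] wf2[OF uv'] by auto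
  then have "j < L" using * by simp
  from Q_inj[OF assms(2) uv' assms(3,4) this *(4)] show ?thesis
    using * assms by auto
qed

lemma vertex_cases:
  assumes "x \<in> verts H'"
  obtains u where "u \<in> verts H" "x = f u"
  | u v i where "u \<rightarrow>\<^bsub>H\<^esub> v" "0 < i" "i < L" "x = Q u v i"
proof -
  consider u where "u \<in> verts H" "x = f u" | u v i where "u \<rightarrow>\<^bsub>H\<^esub> v" "i \<le> L" "x = Q u v i"
    using assms unfolding verts_H' by blast
  then show ?thesis
  proof cases
    case (2 u v i)
    consider "i = 0" | "i = L" | "0 < i" "i < L" using 2 by linarith
    then show ?thesis
    proof cases
      case 1 then show ?thesis using 2 Q_0 wf that(1) by metis
    next
      case l: 2 then show ?thesis using 2 Q_L wf2 that(1) by metis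
    next
      case 3 then show ?thesis using 2 that(2) by metis
    qed
  qed (use that in blast)
qed

lemma near_verts: "near a x n \<Longrightarrow> x \<in> verts H'"
  unfolding near_def using Q_verts by blast

lemma nearI: "game_step H u v \<Longrightarrow> u \<in> verts H \<Longrightarrow> i \<le> L \<Longrightarrow> L * trunc_dist a u + i \<le> n \<Longrightarrow> near a (Q u v i) n"
  unfolding near_def by blast

lemma near_step:
  assumes w: "near a x n" and s: "game_step H' x y"
  shows "near a y (Suc n)"
proof (cases "x = y")
  case True then show ?thesis using near_mono[OF w] by simp
next
  case False
  then have xy: "x \<rightarrow>\<^bsub>H'\<^esub> y" using s by (auto simp: game_step_def)
  from near_verts[OF w] show ?thesis
  proof (cases rule: vertex_cases)
    case (1 u)
    then obtain v where v: "u \<rightarrow>\<^bsub>H\<^esub> v" "y = Q u v 1" using xy adj_f by blast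
    then show ?thesis using near_f[of a u n] w 1 L
      by (auto intro!: nearI simp: step_H dest: wf2)
  next
    case (2 u v i)
    have vu: "Q u v j = Q v u (L - j)" if "j \<le> L" for j using Q_rev[OF 2(1), of "L - j"] that by simp
    have gs: "game_step H u v" "game_step H v u" "u \<in> verts H" "v \<in> verts H"
      using 2 wf wf2 sym by (auto simp: step_H)
    have I: "near a (Q u v j) (Suc n)" if "j \<le> L" "L * trunc_dist a u + j \<le> Suc n \<or> L * trunc_dist a v + (L - j) \<le> Suc n" for j
      using that nearI[OF gs(1,3) that(1), of a "Suc n"] nearI[OF gs(2,4), of "L - j" a "Suc n"] vu[OF that(1)]
      by auto
    have y: "y = Q u v (Suc i) \<or> y = Q u v (i - 1)" using xy adj_inner[OF 2(1-3)] 2(4) by simp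
    have "L * trunc_dist a u + i \<le> n \<or> L * trunc_dist a v + (L - i) \<le> n"
      using near_inner[OF _ 2(1-3)] w 2(4) by simp
    then have "L * trunc_dist a u + Suc i \<le> Suc n \<or> L * trunc_dist a v + (L - Suc i) \<le> Suc n"
      "L * trunc_dist a u + (i - 1) \<le> Suc n \<or> L * trunc_dist a v + (L - (i - 1)) \<le> Suc n"
      using 2(2,3) by linarith+
    then show ?thesis using y I[of "Suc i"] I[of "i - 1"] 2(2,3) by auto
  qed
qed

text \<open>If the two estimates for an inner vertex use opposite ends of its edge, they add up to
  the whole edge; this is the additional \<open>L\<close> in \<open>cross\<close>. Otherwise the
  distances of \<open>a\<close> and \<open>b\<close> from a single vertex of \<open>H\<close>
  already sum to at least 2.\<close>

lemma near_far:
  assumes far: "trunc_dist a b = 2" and a: "near a x n" and b: "near b x m"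
  shows "2 * L \<le> n + m"
proof -
  have ab: "trunc_dist a u + trunc_dist b u \<ge> 2" for u
    using far sym by (auto simp: trunc_dist_def split: if_splits)
  have *: "2 * L \<le> L * trunc_dist a u + L * trunc_dist b u" for u
    using mult_le_mono2[OF ab[of u], of L] by (simp add: algebra_simps)
  have cross: "2 * L \<le> L * trunc_dist a u + L * trunc_dist b v + L" if "u \<rightarrow>\<^bsub>H\<^esub> v" for u v
  proof -
    have "trunc_dist a u + trunc_dist b v + 1 \<ge> 2"
      using ab[of u] trunc_dist_step[OF sym[OF that], of b] by linarith
    from mult_le_mono2[OF this, of L] show ?thesis by (simp add: algebra_simps)
  qed
  from near_verts[OF a] show ?thesis
  proof (cases rule: vertex_cases)
    case (1 u)
    then show ?thesis using near_f[of a u n] near_f[of b u m] a b *[of u] by simp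
  next
    case (2 u v i)
    have "L * trunc_dist a u + i \<le> n \<or> L * trunc_dist a v + (L - i) \<le> n"
      "L * trunc_dist b u + i \<le> m \<or> L * trunc_dist b v + (L - i) \<le> m"
      using near_inner[OF _ 2(1-3)] a b 2(4) by simp_all
    then show ?thesis
      using *[of u] *[of v] cross[OF 2(1)] cross[OF sym[OF 2(1)]] 2(3) by linarith
  qed
qed

text \<open>Rounding to the nearest branch vertex: a radius of \<open>3 * L / 2\<close> around
  \<open>f a\<close> covers only the halves of edges next to \<open>a\<close> and next to its
  neighbours.\<close>

lemma near_shadow:
  assumes a: "near a x n" and n: "2 * n \<le> 3 * L" and "a \<in> verts H"
  shows "\<exists>b. game_step H a b \<and> near b x (L div 2)"
proof -
  have lt: "n < 2 * L" using n L by linarith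
  have td: "trunc_dist a u \<noteq> 2" if "L * trunc_dist a u \<le> n" for u
    using that lt by auto
  have key: "\<exists>b. game_step H a b \<and> near b x (L div 2)"
    if uv: "u \<rightarrow>\<^bsub>H\<^esub> v" and i: "i \<le> L" "x = Q u v i" and le: "L * trunc_dist a u + i \<le> n" for u v i
  proof -
    have gs: "game_step H u v" "game_step H v u" "u \<in> verts H" "v \<in> verts H"
      using uv wf wf2 sym by (auto simp: step_H)
    have au: "game_step H a u"
      using td[of u] le gs by (auto simp: trunc_dist_def step_H split: if_splits)
    show ?thesis
    proof (cases "i \<le> L div 2")
      case True
      then show ?thesis using au nearI[OF gs(1,3) i(1), of u "L div 2"] i
        by (auto simp: trunc_dist_def)
    next
      case False
      \<comment> \<open>Beyond the middle of an edge that starts at a neighbour of \<open>a\<close>,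
        the radius \<open>3 * L / 2\<close> is exceeded.\<close>
      then have "trunc_dist a u \<noteq> 1" using le n by auto
      then have "a = u" using td[of u] le by (auto simp: trunc_dist_def split: if_splits)
      moreover have "x = Q v u (L - i)" using i Q_rev[OF uv, of "L - i"] by simp
      moreover have "L - i \<le> L div 2" using False by linarith
      ultimately show ?thesis using gs nearI[OF gs(2,4), of "L - i" v "L div 2"]
        by (auto simp: trunc_dist_def)
    qed
  qed
  from near_verts[OF a] show ?thesis
  proof (cases rule: vertex_cases)
    case (1 u)
    then have "L * trunc_dist a u \<le> n" using near_f a by simp
    then have "game_step H a u" using td[of u] 1
      by (auto simp: trunc_dist_def step_H split: if_splits)
    moreover have "near u x (L div 2)"
      using nearI[of u u 0 u "L div 2"] Q_refl 1 by (auto simp: step_H trunc_dist_def)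
    ultimately show ?thesis by blast
  next
    case (2 u v i)
    have xr: "x = Q v u (L - i)" using 2 Q_rev[OF 2(1), of "L - i"] by simp
    have "L * trunc_dist a u + i \<le> n \<or> L * trunc_dist a v + (L - i) \<le> n"
      using near_inner[OF _ 2(1-3)] a 2(4) by simp
    then show ?thesis
    proof
      assume "L * trunc_dist a u + i \<le> n"
      then show ?thesis by (rule key[OF 2(1) less_imp_le[OF 2(3)] 2(4)])
    next
      assume "L * trunc_dist a v + (L - i) \<le> n"
      then show ?thesis by (rule key[OF sym[OF 2(1)] diff_le_self xr])
    qed
  qed
qed

text \<open>One round on \<open>H\<close> uses \<open>L\<close> moves on \<open>H'\<close>. After
  the first of them the cops are within \<open>3 * L / 2\<close> of their shadows, which can
  therefore step to within \<open>L div 2\<close>. Then the robber on \<open>H\<close> chooses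
  \<open>r'\<close>, and his counterpart walks the whole path to \<open>f r'\<close> while the cops
  make \<open>L - 1\<close> more moves. This restores the radius of the invariant.\<close>

lemma shadow_wins:
  assumes "cop_rank H' k n c (f r)" "r \<in> verts H" "\<And>i. i < k \<Longrightarrow> S i \<in> verts H"
    and "\<And>i. i < k \<Longrightarrow> near (S i) (c i) (L div 2 + (L - 1))"
  shows "cop_wins_from H k S r"
  using assms
proof (induction n arbitrary: c r S rule: less_induct)
  case (less n)
  define m where "m = L div 2 + (L - 1)"
  have m: "2 * m + 2 \<le> 3 * L" using L unfolding m_def by presburger
  have near: "near (S i) (c i) m" if "i < k" for i using less.prems(4)[OF that] by (simp only: m_def)
  show ?case
  proof (cases "\<exists>i<k. game_step H (S i) r")
    case True
    then obtain i where "i < k" "game_step H (S i) r" by blast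
    then show ?thesis by (rule cop_wins_from_capture)
  next
    case False
    \<comment> \<open>A capture would place \<open>f r\<close> at less than \<open>2 * L\<close>
      from the image of the shadow, which could then capture \<open>r\<close> itself.\<close>
    have not_capt: "\<not> game_step H' (c i) y" if "i < k" "near r y l" "m + 1 + l < 2 * L" for i y l
    proof
      assume "game_step H' (c i) y"
      from near_step[OF near[OF that(1)] this] have "near (S i) y (Suc m)" .
      moreover have "trunc_dist (S i) r = 2"
        using False that(1) less.prems by (auto simp: trunc_dist_def step_H)
      ultimately show False using near_far[of "S i" r y "Suc m" l] that by simp
    qed
    have fr: "near r (f r) 0"
      using nearI[of r r 0 r 0] less.prems Q_refl by (auto simp: step_H trunc_dist_def)
    have "\<not> cop_rank H' k 0 c (f r)" using not_capt[OF _ fr] m L by auto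
    then obtain n' c1 where n': "n' < n" and c1: "\<And>i. i < k \<Longrightarrow> game_step H' (c i) (c1 i)"
      and next1: "\<And>y. game_step H' (f r) y \<Longrightarrow> cop_rank H' k n' c1 y"
      using cop_rank_move[OF less.prems(1)] by blast
    have "\<exists>b. game_step H (S i) b \<and> near b (c1 i) (L div 2)" if "i < k" for i
      using near_shadow[OF near_step[OF near c1]] less.prems(3) that m by auto
    then obtain S1 where S1: "\<And>i. i < k \<Longrightarrow> game_step H (S i) (S1 i)"
        "\<And>i. i < k \<Longrightarrow> near (S1 i) (c1 i) (L div 2)" by metis
    have "cop_wins_from H k S1 r'" if r': "game_step H r r'" for r'
    proof (cases "\<exists>i<k. game_step H (S1 i) r'")
      case True
      then obtain i where "i < k" "game_step H (S1 i) r'" by blast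
      then show ?thesis by (rule cop_wins_from_capture)
    next
      case F: False
      have walk: "near r' (Q r r' j) (L - j)" if "j \<le> L" for j
      proof (cases "r = r'")
        case True
        then show ?thesis using nearI[of r r 0 r "L - j"] less.prems Q_refl by (auto simp: step_H trunc_dist_def)
      next
        case rr: False
        then have "r \<rightarrow>\<^bsub>H\<^esub> r'" using r' by (auto simp: step_H)
        then have "Q r r' j = Q r' r (L - j)" using that Q_rev[of r r' "L - j"] by simp
        moreover have "game_step H r' r" using \<open>r \<rightarrow>\<^bsub>H\<^esub> r'\<close> sym less.prems by (auto simp: step_H)
        ultimately show ?thesis using nearI[of r' r "L - j" r' "L - j"] r' by (auto simp: step_H trunc_dist_def)
      qed
      \<comment> \<open>The radius around the shadows grows by one per move, and the distance that
        remains to \<open>f r'\<close> shrinks by one. With the capturing move their sum is always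
        \<open>L div 2 + L\<close>, which is less than \<open>2 * L\<close>; so no cop captures
        before a shadow can.\<close>
      have chase: "\<exists>l c2. l < n \<and> cop_rank H' k l c2 (Q r r' (Suc j)) \<and> (\<forall>i<k. near (S1 i) (c2 i) (L div 2 + j))"
        if "Suc j \<le> L" for j
        using that
      proof (induction j)
        case 0
        have "game_step H' (f r) (Q r r' 1)"
          using Q_step[OF r', of 0] Q_0'[OF r'] 0 by simp
        then show ?case using next1 n' S1 by (intro exI[of _ n'] exI[of _ c1]) auto
      next
        case (Suc j)
        then obtain l c2 where l: "l < n" "cop_rank H' k l c2 (Q r r' (Suc j))"
            and c2: "\<And>i. i < k \<Longrightarrow> near (S1 i) (c2 i) (L div 2 + j)" by auto
        have "\<not> game_step H' (c2 i) (Q r r' (Suc j))" if i: "i < k" for i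
        proof
          assume "game_step H' (c2 i) (Q r r' (Suc j))"
          from near_step[OF c2[OF i] this] have "near (S1 i) (Q r r' (Suc j)) (Suc (L div 2 + j))" .
          moreover have "trunc_dist (S1 i) r' = 2"
            using F i r' by (auto simp: trunc_dist_def step_H)
          moreover have "near r' (Q r r' (Suc j)) (L - Suc j)" using walk[of "Suc j"] Suc.prems by simp
          ultimately have "2 * L \<le> Suc (L div 2 + j) + (L - Suc j)"
            by (intro near_far[of "S1 i" r'])
          then show False using Suc.prems L by linarith
        qed
        then have "\<not> cop_rank H' k 0 c2 (Q r r' (Suc j))" by auto
        then obtain l' c3 where l': "l' < l" and c3: "\<And>i. i < k \<Longrightarrow> game_step H' (c2 i) (c3 i)"
          and "\<And>y. game_step H' (Q r r' (Suc j)) y \<Longrightarrow> cop_rank H' k l' c3 y"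
          using cop_rank_move[OF l(2)] by blast
        moreover have "game_step H' (Q r r' (Suc j)) (Q r r' (Suc (Suc j)))"
          using Q_step[OF r'] Suc.prems by simp
        moreover have "near (S1 i) (c3 i) (L div 2 + Suc j)" if "i < k" for i
          using near_step[OF c2 c3] that by simp
        ultimately show ?case using l' l by (intro exI[of _ l'] exI[of _ c3]) auto
      qed
      obtain l c2 where l: "l < n" "cop_rank H' k l c2 (Q r r' (Suc (L - 1)))"
        and c2: "\<And>i. i < k \<Longrightarrow> near (S1 i) (c2 i) (L div 2 + (L - 1))"
        using chase[of "L - 1"] L by auto
      then show ?thesis
        using less.IH[OF l(1), of c2 r' S1] Q_L'[OF r'] r' S1 L by (auto simp: step_H)
    qed
    then show ?thesis using cop_wins_from_move[OF fin, of k S S1 r] S1 by blast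
  qed
qed

end

context uniform_subdivision begin

theorem cops_win_original:
  assumes "cops_win H' k"
  shows "cops_win H k"
proof -
  obtain c where c: "\<And>i. i < k \<Longrightarrow> c i \<in> verts H'" and win: "\<And>r. r \<in> verts H' \<Longrightarrow> cop_wins_from H' k c r"
    using assms cops_win_iff[OF fin'] by blast
  have near_ex: "\<exists>u\<in>verts H. near u x (L div 2 + (L - 1))" if "x \<in> verts H'" for x
    using that
  proof (cases rule: vertex_cases)
    case (1 u)
    then show ?thesis using nearI[of u u 0 u] Q_refl by (auto simp: step_H trunc_dist_def)
  next
    case (2 u v i)
    then have "near u x (L div 2 + (L - 1))"
      using nearI[of u v i u "L div 2 + (L - 1)"] wf[of u v] wf2[of u v] by (simp add: step_H trunc_dist_def)
    then show ?thesis using wf[OF 2(1)] by blast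
  qed
  obtain S where S: "\<And>i. i < k \<Longrightarrow> S i \<in> verts H \<and> near (S i) (c i) (L div 2 + (L - 1))"
    using near_ex[OF c] by metis
  have "cop_wins_from H k S r" if r: "r \<in> verts H" for r
  proof -
    have "f r \<in> verts H'" using r by (simp add: verts_H')
    then obtain n where "cop_rank H' k n c (f r)" using win by (auto simp: cop_wins_from_def)
    then show ?thesis using shadow_wins[of k n c r S] r S by blast
  qed
  then show ?thesis using cops_win_iff[OF fin] S by blast
qed

subsection \<open>One additional cop suffices on the subdivision\<close>

text \<open>The additional cop, number \<open>k\<close>, walks along the trail of the robber. The length \<open>d\<close> of this
  trail never grows, and it shrinks whenever the robber rests or turns back. So it can be assumed
  that he never does; then the other cops know the next branch vertex \<open>L - 1\<close> moves in advance.\<close>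

fun trail :: "nat \<Rightarrow> 'c \<Rightarrow> 'c \<Rightarrow> bool" where
  "trail 0 x y \<longleftrightarrow> x = y"
| "trail (Suc n) x y \<longleftrightarrow> (\<exists>z. x \<rightarrow>\<^bsub>H'\<^esub> z \<and> trail n z y)"

lemma trail_snoc: "trail (Suc n) x y \<longleftrightarrow> (\<exists>z. trail n x z \<and> z \<rightarrow>\<^bsub>H'\<^esub> y)"
proof (induction n arbitrary: x)
  case (Suc n)
  have "trail (Suc (Suc n)) x y \<longleftrightarrow> (\<exists>w. x \<rightarrow>\<^bsub>H'\<^esub> w \<and> trail (Suc n) w y)" by simp
  also have "\<dots> \<longleftrightarrow> (\<exists>w. x \<rightarrow>\<^bsub>H'\<^esub> w \<and> (\<exists>z. trail n w z \<and> z \<rightarrow>\<^bsub>H'\<^esub> y))" using Suc by simp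
  also have "\<dots> \<longleftrightarrow> (\<exists>z. trail (Suc n) x z \<and> z \<rightarrow>\<^bsub>H'\<^esub> y)" by auto
  finally show ?case .
qed auto

text \<open>The robber has just run from \<open>z\<close> to \<open>x\<close> and the cops are to
  move. All placements of the follower with \<open>d - 1\<close> steps to \<open>z\<close> are
  covered at once, so that the moves of the other cops can be discussed without him.\<close>

definition chased :: "nat \<Rightarrow> nat \<Rightarrow> (nat \<Rightarrow> 'c) \<Rightarrow> 'c \<Rightarrow> 'c \<Rightarrow> bool" where
  "chased k d c z x \<longleftrightarrow> z \<rightarrow>\<^bsub>H'\<^esub> x \<and>
     (\<forall>y. trail (d - 1) y z \<longrightarrow> cop_wins_from H' (Suc k) (c(k := y)) x)"

text \<open>The hypothesis of an induction on the length of the trail. The other cops may stand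
  anywhere, since they regroup whenever the trail gets shorter.\<close>

definition wins_below :: "nat \<Rightarrow> nat \<Rightarrow> bool" where
  "wins_below k d \<longleftrightarrow> (\<forall>e c y x. e < d \<longrightarrow> trail e y x \<longrightarrow> x \<in> verts H' \<longrightarrow>
     (\<forall>i<k. c i \<in> verts H') \<longrightarrow> cop_wins_from H' (Suc k) (c(k := y)) x)"

lemma wins_belowD:
  "wins_below k d \<Longrightarrow> e < d \<Longrightarrow> trail e y x \<Longrightarrow> x \<in> verts H' \<Longrightarrow> (\<And>i. i < k \<Longrightarrow> c i \<in> verts H') \<Longrightarrow>
    cop_wins_from H' (Suc k) (c(k := y)) x"
  unfolding wins_below_def by blast

text \<open>The follower takes one step of the trail. If the robber rests, its length becomes
  \<open>d - 1\<close>; if he returns to \<open>z\<close>, it becomes \<open>d - 2\<close>; both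
  fall under \<open>wins_below\<close>. Only running ahead keeps the length
  \<open>d\<close>.\<close>

lemma chased_move:
  assumes shorter: "wins_below k d"
    and zx: "z \<rightarrow>\<^bsub>H'\<^esub> x"
    and move: "\<And>i. i < k \<Longrightarrow> game_step H' (c i) (c' i)"
    and ahead: "\<And>x'. x \<rightarrow>\<^bsub>H'\<^esub> x' \<Longrightarrow> x' \<noteq> z \<Longrightarrow> chased k d c' x x'"
  shows "chased k d c z x"
  unfolding chased_def
proof (intro conjI allI impI zx)
  fix y assume t: "trail (d - 1) y z"
  have zx': "z \<in> verts H'" "x \<in> verts H'" using wf' zx by auto
  have c': "c' i \<in> verts H'" if "i < k" for i using move[OF that] by (simp add: game_step_def)
  show "cop_wins_from H' (Suc k) (c(k := y)) x"
  proof (cases "d - 1")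
    \<comment> \<open>The follower stands on \<open>z\<close> and captures the robber at
      \<open>x\<close>.\<close>
    case 0
    then have "game_step H' y x" using t zx zx' by (auto simp: game_step_def)
    then show ?thesis using cop_wins_from_capture[of k "Suc k" H' "c(k := y)" x] by simp
  next
    case (Suc e)
    then obtain y' where y': "y \<rightarrow>\<^bsub>H'\<^esub> y'" "trail e y' z" using t by auto
    have d: "d = Suc (Suc e)" using Suc by simp
    show ?thesis
    proof (rule cop_wins_from_move[OF fin', where c' = "c'(k := y')"])
      show "game_step H' ((c(k := y)) i) ((c'(k := y')) i)" if "i < Suc k" for i
        using that move[of i] y' wf' by (auto simp: game_step_def)
      fix r assume r: "game_step H' x r"
      consider "r = x" | "r = z" | "x \<rightarrow>\<^bsub>H'\<^esub> r" "r \<noteq> z" using r by (auto simp: game_step_def)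
      then show "cop_wins_from H' (Suc k) (c'(k := y')) r"
      proof cases
        case 1
        have "trail (Suc e) y' x" using trail_snoc y' zx by blast
        then show ?thesis using wins_belowD[OF shorter, of "Suc e" y' x c'] d 1 zx' c' by simp
      next
        case 2
        then show ?thesis using wins_belowD[OF shorter, of e y' z c'] d y' zx' c' by simp
      next
        case 3
        have "trail (Suc e) y' x" using trail_snoc y' zx by blast
        then show ?thesis using ahead[OF 3] d by (simp add: chased_def)
      qed
    qed
  qed
qed

lemma chased_cong: "(\<And>i. i < k \<Longrightarrow> c i = c' i) \<Longrightarrow> chased k d c z x \<longleftrightarrow> chased k d c' z x"
proof -
  assume *: "\<And>i. i < k \<Longrightarrow> c i = c' i"
  have "cop_wins_from H' (Suc k) (c(k := y)) x = cop_wins_from H' (Suc k) (c'(k := y)) x" for y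
    by (rule cop_wins_from_cong) (use * in auto)
  then show ?thesis by (simp add: chased_def)
qed

lemma chased_capture:
  assumes "z \<rightarrow>\<^bsub>H'\<^esub> x" "i < k" "game_step H' (c i) x"
  shows "chased k d c z x"
  unfolding chased_def
proof (intro conjI allI impI assms(1))
  show "cop_wins_from H' (Suc k) (c(k := y)) x" for y
    using assms cop_wins_from_capture[of i "Suc k" H' "c(k := y)" x] by simp
qed

text \<open>Inside a subdivided edge there is just one way ahead, so the position on arrival
  decides; the induction goes backwards from there. The other cops move in step with the robber
  along the paths that belong to their moves on \<open>H\<close>.\<close>

lemma chased_edge:
  assumes shorter: "wins_below k d"
    and vw: "v \<rightarrow>\<^bsub>H\<^esub> w"
    and move: "\<And>i. i < k \<Longrightarrow> game_step H (S i) (T i)"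
    and arrive: "chased k d (\<lambda>i. Q (S i) (T i) (L - 1)) (Q v w (L - 1)) (Q v w L)"
    and j: "Suc j \<le> L"
  shows "chased k d (\<lambda>i. Q (S i) (T i) j) (Q v w j) (Q v w (Suc j))"
proof -
  have "j \<le> L - 1" using j by simp
  then show ?thesis
  proof (induction rule: inc_induct)
    case base
    then show ?case using arrive L by (simp add: Suc_diff_Suc numeral_2_eq_2)
  next
    case (step n)
    show ?case
    proof (rule chased_move[OF shorter, where c' = "\<lambda>i. Q (S i) (T i) (Suc n)"])
      show "Q v w n \<rightarrow>\<^bsub>H'\<^esub> Q v w (Suc n)" using Q_adj[OF vw] step by simp
      show "game_step H' (Q (S i) (T i) n) (Q (S i) (T i) (Suc n))" if "i < k" for i
        using Q_step[OF move[OF that]] step by simp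
      show "chased k d (\<lambda>i. Q (S i) (T i) (Suc n)) (Q v w (Suc n)) x'"
        if "Q v w (Suc n) \<rightarrow>\<^bsub>H'\<^esub> x'" "x' \<noteq> Q v w n" for x'
        using that adj_inner[OF vw, of "Suc n"] step by auto
    qed
  qed
qed

text \<open>Once he has left \<open>f v\<close>, the robber is bound for \<open>w\<close>. So the
  cops can answer the move to \<open>w\<close> while he is still on his way, and they complete the
  answer \<open>T\<close> before he leaves \<open>f w\<close>.\<close>

lemma chased_simulate:
  assumes shorter: "wins_below k d"
    and "cop_rank H k n S w" "v \<rightarrow>\<^bsub>H\<^esub> w" "\<And>i. i < k \<Longrightarrow> S i \<in> verts H"
  shows "chased k d (\<lambda>i. f (S i)) (f v) (Q v w 1)"
  using assms(2-4)
proof (induction n arbitrary: S v w)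
  case 0
  then obtain i where i: "i < k" "game_step H (S i) w" by auto
  define T where "T = S(i := w)"
  have move: "game_step H (S j) (T j)" if "j < k" for j
    using i that 0 by (auto simp: T_def step_H)
  have *: "Q v w (L - 1) \<rightarrow>\<^bsub>H'\<^esub> Q v w L" using Q_adj[OF 0(2), of "L - 1"] L by simp
  have "game_step H' (Q (S i) w (L - 1)) (Q (S i) w L)" using Q_step[OF i(2), of "L - 1"] L by simp
  then have "game_step H' (Q (S i) (T i) (L - 1)) (Q v w L)"
    using Q_L'[OF i(2)] Q_L[OF 0(2)] by (simp add: T_def)
  from chased_capture[OF * i(1), of "\<lambda>i. Q (S i) (T i) (L - 1)", OF this]
  have "chased k d (\<lambda>i. Q (S i) (T i) 0) (Q v w 0) (Q v w (Suc 0))"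
    using chased_edge[OF shorter 0(2), of S T 0] move L by simp
  then show ?case
    using chased_cong[of k "\<lambda>i. Q (S i) (T i) 0" "\<lambda>i. f (S i)"] Q_0'[OF move] Q_0[OF 0(2)] by simp
next
  case (Suc n)
  show ?case
  proof (cases "cop_rank H k n S w")
    case True
    then show ?thesis using Suc by blast
  next
    case False
    then obtain T where move: "\<And>i. i < k \<Longrightarrow> game_step H (S i) (T i)"
      and T: "\<And>r. game_step H w r \<Longrightarrow> cop_rank H k n T r" using Suc.prems(1) by auto
    have "chased k d (\<lambda>i. Q (S i) (T i) (L - 1)) (Q v w (L - 1)) (Q v w L)"
    proof (rule chased_move[OF shorter, where c' = "\<lambda>i. f (T i)"])
      show "Q v w (L - 1) \<rightarrow>\<^bsub>H'\<^esub> Q v w L" using Q_adj[OF Suc.prems(2), of "L - 1"] L by simp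
      show "game_step H' (Q (S i) (T i) (L - 1)) (f (T i))" if "i < k" for i
        using Q_step[OF move[OF that], of "L - 1"] Q_L'[OF move[OF that]] L by simp
      fix x' assume "Q v w L \<rightarrow>\<^bsub>H'\<^esub> x'"
      then obtain u where u: "w \<rightarrow>\<^bsub>H\<^esub> u" "x' = Q w u 1"
        using Q_L[OF Suc.prems(2)] adj_f[OF wf2[OF Suc.prems(2)]] by auto
      have "chased k d (\<lambda>i. f (T i)) (f w) (Q w u 1)"
      proof (rule Suc.IH[OF _ u(1)])
        show "cop_rank H k n T u" using T u wf2 by (simp add: step_H)
        show "T i \<in> verts H" if "i < k" for i using move[OF that] by (simp add: step_H)
      qed
      then show "chased k d (\<lambda>i. f (T i)) (Q v w L) x'"
        using u Q_L[OF Suc.prems(2)] by simp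
    qed
    then have "chased k d (\<lambda>i. Q (S i) (T i) 0) (Q v w 0) (Q v w (Suc 0))"
      using chased_edge[OF shorter Suc.prems(2), of S T 0] move L by simp
    then show ?thesis
      using chased_cong[of k "\<lambda>i. Q (S i) (T i) 0" "\<lambda>i. f (S i)"] Q_0'[OF move] Q_0[OF Suc.prems(2)] by simp
  qed
qed

text \<open>The cops may be in place while the robber is anywhere on an edge. They rest until he
  passes the next branch vertex; the neighbour for which he then sets out counts as his initial
  placement on \<open>H\<close>.\<close>

lemma chased_wait:
  assumes shorter: "wins_below k d"
    and S: "\<And>i. i < k \<Longrightarrow> S i \<in> verts H" and win: "\<And>r. r \<in> verts H \<Longrightarrow> cop_wins_from H k S r"
    and zx: "z \<rightarrow>\<^bsub>H'\<^esub> x"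
  shows "chased k d (\<lambda>i. f (S i)) z x"
proof -
  have stay: "game_step H' (f (S i)) (f (S i))" if "i < k" for i
    using S[OF that] by (auto simp: game_step_def verts_H')
  have branch: "chased k d (\<lambda>i. f (S i)) z (f v)" if v: "v \<in> verts H" and z: "z \<rightarrow>\<^bsub>H'\<^esub> f v" for v z
  proof (rule chased_move[OF shorter z stay])
    fix x' assume "f v \<rightarrow>\<^bsub>H'\<^esub> x'"
    then obtain w where w: "v \<rightarrow>\<^bsub>H\<^esub> w" "x' = Q v w 1" using adj_f[OF v] by blast
    obtain n where "cop_rank H k n S w" using win[OF wf2[OF w(1)]] by (auto simp: cop_wins_from_def)
    then show "chased k d (\<lambda>i. f (S i)) (f v) x'"
      using chased_simulate[OF shorter _ w(1) S] w by simp
  qed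
  have edge: "chased k d (\<lambda>i. f (S i)) (Q v w j) (Q v w (Suc j))" if vw: "v \<rightarrow>\<^bsub>H\<^esub> w" and j: "Suc j \<le> L" for v w j
  proof -
    have "chased k d (\<lambda>i. Q (S i) (S i) j) (Q v w j) (Q v w (Suc j))"
    proof (rule chased_edge[OF shorter vw _ _ j])
      show "game_step H (S i) (S i)" if "i < k" for i using S[OF that] by (simp add: step_H)
      have "Q v w (L - 1) \<rightarrow>\<^bsub>H'\<^esub> f w" using Q_adj[OF vw, of "L - 1"] L Q_L[OF vw] by simp
      then show "chased k d (\<lambda>i. Q (S i) (S i) (L - 1)) (Q v w (L - 1)) (Q v w L)"
        using branch[OF wf2[OF vw]] Q_L[OF vw] by (simp add: Q_refl)
    qed
    then show ?thesis by (simp add: Q_refl)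
  qed
  from zx obtain v w j where "v \<rightarrow>\<^bsub>H\<^esub> w" "j < L" "z = Q v w j" "x = Q v w (Suc j)"
    unfolding adj_H' by blast
  then show ?thesis using edge by simp
qed

text \<open>The common bound \<open>N\<close> on the distances still to be covered drops with every
  move, wherever the robber runs in the meantime.\<close>

lemma chased_gather:
  assumes shorter: "wins_below k d"
    and S: "\<And>i. i < k \<Longrightarrow> S i \<in> verts H" and win: "\<And>r. r \<in> verts H \<Longrightarrow> cop_wins_from H k S r"
    and zx: "z \<rightarrow>\<^bsub>H'\<^esub> x" and "\<And>i. i < k \<Longrightarrow> \<exists>n\<le>N. trail n (c i) (f (S i))"
  shows "chased k d c z x"
  using zx assms(5)
proof (induction N arbitrary: c z x)
  case 0
  then have "chased k d c z x \<longleftrightarrow> chased k d (\<lambda>i. f (S i)) z x"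
    by (intro chased_cong) auto
  then show ?case using chased_wait[OF shorter S win 0(1)] by simp
next
  case (Suc N)
  have "\<exists>y. game_step H' (c i) y \<and> (\<exists>n\<le>N. trail n y (f (S i)))" if i: "i < k" for i
  proof -
    obtain n where n: "n \<le> Suc N" "trail n (c i) (f (S i))" using Suc.prems(2)[OF i] by blast
    show ?thesis
    proof (cases n)
      case 0
      then show ?thesis using n S[OF i] by (intro exI[of _ "c i"]) (auto simp: game_step_def verts_H' intro!: exI[of _ 0])
    next
      case (Suc m)
      then obtain y where "c i \<rightarrow>\<^bsub>H'\<^esub> y" "trail m y (f (S i))" using n by auto
      then show ?thesis using n Suc wf' by (intro exI[of _ y]) (auto simp: game_step_def)
    qed
  qed
  then obtain c' where c': "\<And>i. i < k \<Longrightarrow> game_step H' (c i) (c' i)"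
      "\<And>i. i < k \<Longrightarrow> \<exists>n\<le>N. trail n (c' i) (f (S i))" by metis
  show ?case
  proof (rule chased_move[OF shorter Suc.prems(1) c'(1)])
    show "chased k d c' x x'" if "x \<rightarrow>\<^bsub>H'\<^esub> x'" for x'
      using Suc.IH[OF that c'(2)] by blast
  qed
qed

text \<open>Induction on the length of the follower's trail; connectedness provides the first trail
  and the ways to the starting vertices \<open>f (S i)\<close>.\<close>

theorem cops_win_subdivision:
  assumes conn: "\<And>x y. x \<in> verts H' \<Longrightarrow> y \<in> verts H' \<Longrightarrow> \<exists>n. trail n x y"
    and ne: "verts H \<noteq> {}" and "cops_win H k"
  shows "cops_win H' (Suc k)"
proof -
  obtain S where S: "\<And>i. i < k \<Longrightarrow> S i \<in> verts H" and win: "\<And>r. r \<in> verts H \<Longrightarrow> cop_wins_from H k S r"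
    using assms(3) cops_win_iff[OF fin] by blast
  obtain v where v: "v \<in> verts H" using ne by blast
  have "cop_wins_from H' (Suc k) (c(k := y)) x"
    if "trail d y x" "x \<in> verts H'" "\<And>i. i < k \<Longrightarrow> c i \<in> verts H'" for d c y x
    using that
  proof (induction d arbitrary: c y x rule: less_induct)
    case (less d)
    show ?case
    proof (cases d)
      case 0
      then have "game_step H' ((c(k := y)) k) x" using less.prems by (simp add: game_step_def)
      then show ?thesis by (rule cop_wins_from_capture[of k "Suc k", OF lessI])
    next
      case (Suc e)
      then obtain z where z: "trail e y z" "z \<rightarrow>\<^bsub>H'\<^esub> x" using less.prems(1) trail_snoc by blast
      have "\<exists>n. trail n (c i) (f (S i))" if "i < k" for i
        using conn[OF less.prems(3)[OF that], of "f (S i)"] S[OF that] by (simp add: verts_H')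
      then obtain n where n: "\<And>i. i < k \<Longrightarrow> trail (n i) (c i) (f (S i))" by metis
      have "wins_below k d"
        unfolding wins_below_def using less.IH by blast
      have "chased k d c z x"
      proof (rule chased_gather[OF \<open>wins_below k d\<close> _ _ z(2), where S = S and N = "Max (insert 0 (n ` {..<k}))"])
        show "\<exists>m\<le>Max (insert 0 (n ` {..<k})). trail m (c i) (f (S i))" if "i < k" for i
          using n[OF that] that by (intro exI[of _ "n i"]) auto
      qed (use S win in auto)
      moreover have "trail (d - 1) y z" using z(1) Suc by simp
      ultimately show ?thesis unfolding chased_def by blast
    qed
  qed
  note reach = this
  have fv: "f u \<in> verts H'" if "u \<in> verts H" for u using that by (simp add: verts_H')
  have "cop_wins_from H' (Suc k) ((\<lambda>i. f (S i))(k := f v)) x" if x: "x \<in> verts H'" for x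
  proof -
    obtain n where "trail n (f v) x" using conn[OF fv[OF v] x] by blast
    from reach[OF this x, of "\<lambda>i. f (S i)"] show ?thesis using fv S by blast
  qed
  moreover have "((\<lambda>i. f (S i))(k := f v)) i \<in> verts H'" if "i < Suc k" for i
    using that fv v S by (cases "i = k") auto
  ultimately show ?thesis
    unfolding cops_win_iff[OF fin'] by blast
qed

lemma cop_number_subdivision:
  assumes "wf_digraph H" "strongly_connected H" "wf_digraph H'" "strongly_connected H'"
  shows "cop_number H' \<in> {cop_number H, cop_number H + 1}"
proof -
  define a where "a = (LEAST k. cops_win H k)"
  define b where "b = (LEAST k. cops_win H' k)"
  have a: "cops_win H a" and b: "cops_win H' b"
    using cops_win_card_verts fin fin' unfolding a_def b_def by (blast intro: LeastI_ex)+
  have "trail n x y" if "(x, y) \<in> arcs_ends H' ^^ n" for n x y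
    using that
  proof (induction n arbitrary: y)
    case (Suc n)
    then show ?case using trail_snoc by auto
  qed auto
  moreover have "\<exists>n. (x, y) \<in> arcs_ends H' ^^ n" if "x \<in> verts H'" "y \<in> verts H'" for x y
  proof -
    have "(x, y) \<in> rtrancl_on (verts H') (arcs_ends H')"
      using assms(4) that by (simp add: strongly_connected_def reachable_def)
    then have "(x, y) \<in> (arcs_ends H')\<^sup>*" by (rule rtrancl_on_rtranclI)
    then show ?thesis by (rule rtrancl_imp_relpow)
  qed
  ultimately have "cops_win H' (Suc a)"
    using cops_win_subdivision[OF _ _ a] assms(2) unfolding strongly_connected_def by blast
  then have "b \<le> Suc a" unfolding b_def by (rule Least_le)
  moreover have "a \<le> b" using cops_win_original[OF b] unfolding a_def by (rule Least_le)
  ultimately show ?thesis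
    using cop_number_connected[OF assms(1,2)] cop_number_connected[OF assms(3,4)]
    by (auto simp: a_def b_def)
qed

end

section \<open>Triangle-free geometric graphs are plane\<close>

lemma convex_comb_dist:
  fixes a b x :: complex
  assumes "x \<in> closed_segment a b"
  shows "dist a x + dist x b = dist a b"
  using between_mem_segment[of a b x] assms by (simp add: between)

text \<open>Two segments from \<open>a\<close> with a further common point lie on one ray, so the
  shorter one is contained in the longer one.\<close>

lemma shared_endpoint_dist:
  fixes a b d x :: complex
  assumes "x \<in> closed_segment a b" "x \<in> closed_segment a d" "x \<noteq> a" "dist a b \<le> r" "dist a d \<le> r"
  shows "dist b d \<le> r"
proof -
  have *: "dist b d \<le> dist a d"
    if x: "x = a + s *\<^sub>R (b - a)" "x = a + t *\<^sub>R (d - a)" and st: "0 \<le> s" "0 \<le> t" "t \<le> s" "x \<noteq> a" for b d s t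
  proof -
    have "s > 0" using x st by (cases "s = 0") auto
    have "s *\<^sub>R (b - a) = t *\<^sub>R (d - a)" using x by simp
    then have "b - a = (t / s) *\<^sub>R (d - a)"
      using \<open>s > 0\<close> by (simp add: divide_inverse_commute) (metis less_numeral_extra(3) real_vector_affinity_eq scaleR_scaleR scaleR_one left_inverse)
    then have "b - d = (t / s - 1) *\<^sub>R (d - a)" by (simp add: algebra_simps)
    then have "dist b d = \<bar>t / s - 1\<bar> * dist a d" by (simp add: dist_norm norm_minus_commute)
    also have "\<dots> \<le> 1 * dist a d"
      using st \<open>s > 0\<close> by (intro mult_right_mono) (auto simp: abs_le_iff)
    finally show ?thesis by simp
  qed
  obtain s where s: "x = a + s *\<^sub>R (b - a)" "0 \<le> s"
    using assms(1) by (auto simp: closed_segment_def algebra_simps)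
  obtain t where t: "x = a + t *\<^sub>R (d - a)" "0 \<le> t"
    using assms(2) by (auto simp: closed_segment_def algebra_simps)
  show ?thesis
    using *[OF s(1) t(1) s(2) t(2) _ assms(3)] *[OF t(1) s(1) t(2) s(2) _ assms(3)] assms(4,5)
    by (cases "t \<le> s") (auto simp: dist_commute)
qed

text \<open>The detour from \<open>a\<close> over \<open>x\<close> to \<open>c\<close> is no longer
  than the way from \<open>d\<close> over \<open>x\<close> to \<open>c\<close>, which is the segment
  itself.\<close>

lemma crossing_dist:
  fixes a b c d x :: complex
  assumes x: "x \<in> closed_segment a b" "x \<in> closed_segment c d" and r: "dist a b \<le> r" "dist c d \<le> r"
    and min: "dist a x \<le> dist b x" "dist a x \<le> dist c x" "dist a x \<le> dist d x"
  shows "dist a c \<le> r" "dist a d \<le> r"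
proof -
  have cd: "dist c x + dist d x \<le> r" using convex_comb_dist[OF x(2)] r by (simp add: dist_commute)
  show "dist a c \<le> r" using dist_triangle2[of a c x] min cd by linarith
  show "dist a d \<le> r" using dist_triangle2[of a d x] min cd by linarith
qed

text \<open>Each defect of the drawing forces a triangle: a crossing by
  \<open>crossing_dist\<close>, an overlap of edges at a common end by
  \<open>shared_endpoint_dist\<close>, and a vertex inside an edge because it is within
  \<open>r\<close> of both ends.\<close>

lemma triangle_free_plane:
  assumes G: "geometric_graph r G"
    and free: "\<And>x y z. (x, y) \<in> parcs G \<Longrightarrow> (y, z) \<in> parcs G \<Longrightarrow> (x, z) \<notin> parcs G"
  shows "planar_geometric_graph r G"
proof -
  have arc: "(u, v) \<in> parcs G \<longleftrightarrow> u \<in> pverts G \<and> v \<in> pverts G \<and> u \<noteq> v \<and> dist u v \<le> r" for u v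
    using G by (auto simp: geometric_graph_def)
  have sym: "(u, v) \<in> parcs G \<Longrightarrow> (v, u) \<in> parcs G" for u v by (auto simp: arc dist_commute)
  have shared: "x = a"
    if "(a, b) \<in> parcs G" "(a, d) \<in> parcs G" "b \<noteq> d" "x \<in> closed_segment a b" "x \<in> closed_segment a d" for a b d x
  proof (rule ccontr)
    assume "x \<noteq> a"
    then have "dist b d \<le> r" using shared_endpoint_dist that by (simp add: arc)
    then have "(b, d) \<in> parcs G" using that by (simp add: arc)
    then show False using free[OF that(1), of d] that(2) by simp
  qed
  \<comment> \<open>The end nearest to the crossing point would form a triangle with the other edge
    unless it belongs to it.\<close>
  have minimal: "a \<in> {c, d}"
    if "(a, b) \<in> parcs G" "(c, d) \<in> parcs G" "x \<in> closed_segment a b" "x \<in> closed_segment c d"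
      "dist a x \<le> dist b x" "dist a x \<le> dist c x" "dist a x \<le> dist d x" for a b c d x
  proof (rule ccontr)
    assume "a \<notin> {c, d}"
    moreover have "dist a c \<le> r" "dist a d \<le> r"
      using crossing_dist[of x a b c d r] that by (simp_all add: arc)
    ultimately have "(a, c) \<in> parcs G" "(a, d) \<in> parcs G" using that by (simp_all add: arc)
    then show False using free[OF _ that(2)] by blast
  qed
  have key: "x \<in> {a, b} \<inter> {c, d}"
    if abcd: "(a, b) \<in> parcs G" "(c, d) \<in> parcs G" "{a, b} \<noteq> {c, d}" "x \<in> closed_segment a b" "x \<in> closed_segment c d" for a b c d x
  proof -
    have "\<exists>w. w \<in> {a, b} \<inter> {c, d}"
    proof -
      note m = minimal[OF abcd(1,2,4,5)] minimal[OF sym[OF abcd(1)] abcd(2) _ abcd(5)]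
        minimal[OF abcd(2,1,5,4)] minimal[OF sym[OF abcd(2)] abcd(1) _ abcd(4)]
      consider "dist a x \<le> dist b x" "dist a x \<le> dist c x" "dist a x \<le> dist d x"
        | "dist b x \<le> dist a x" "dist b x \<le> dist c x" "dist b x \<le> dist d x"
        | "dist c x \<le> dist a x" "dist c x \<le> dist b x" "dist c x \<le> dist d x"
        | "dist d x \<le> dist a x" "dist d x \<le> dist b x" "dist d x \<le> dist c x"
        by linarith
      then show ?thesis
        using m abcd(4,5) by cases (auto simp: closed_segment_commute)
    qed
    then obtain w where w: "w \<in> {a, b}" "w \<in> {c, d}" by blast
    obtain b' where b': "{a, b} = {w, b'}" using w by blast
    obtain d' where d': "{c, d} = {w, d'}" using w by blast
    have "(w, b') \<in> parcs G" "x \<in> closed_segment w b'"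
      using b' abcd sym[OF abcd(1)] by (auto simp: doubleton_eq_iff closed_segment_commute)
    moreover have "(w, d') \<in> parcs G" "x \<in> closed_segment w d'"
      using d' abcd sym[OF abcd(2)] by (auto simp: doubleton_eq_iff closed_segment_commute)
    moreover have "b' \<noteq> d'" using abcd(3) b' d' by auto
    ultimately have "x = w" using shared by blast
    then show ?thesis using w by blast
  qed
  have on_edge: "x \<in> {u, v}" if "(u, v) \<in> parcs G" "x \<in> pverts G" "x \<in> closed_segment u v" for u v x
  proof (rule ccontr)
    assume *: "x \<notin> {u, v}"
    have "dist u x \<le> r" "dist x v \<le> r"
      using convex_comb_dist[OF that(3)] that(1) zero_le_dist[of u x] zero_le_dist[of x v]
      unfolding arc by linarith+
    then have "(u, x) \<in> parcs G" "(x, v) \<in> parcs G" using * that by (auto simp: arc)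
    then show False using free that by blast
  qed
  have "plane_drawing G (\<lambda>x. x) (\<lambda>(u, v). linepath u v)"
    unfolding plane_drawing_def
  proof (intro conjI ballI)
    fix e assume e: "e \<in> parcs G"
    obtain u v where uv: "e = (u, v)" by (cases e)
    then show "case e of (u, v) \<Rightarrow> Path_Connected.arc (case (u, v) of (u, v) \<Rightarrow> linepath u v) \<and>
        pathstart (case (u, v) of (u, v) \<Rightarrow> linepath u v) = u \<and> pathfinish (case (u, v) of (u, v) \<Rightarrow> linepath u v) = v \<and>
        path_image (case (v, u) of (u, v) \<Rightarrow> linepath u v) = path_image (case (u, v) of (u, v) \<Rightarrow> linepath u v)"
      using e by (simp add: arc_linepath arc closed_segment_commute)
    show "case e of (u, v) \<Rightarrow> \<forall>x\<in>pverts G. x \<in> path_image (case (u, v) of (u, v) \<Rightarrow> linepath u v) \<longrightarrow> x \<in> {u, v}"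
      using on_edge[of u v] e uv by simp
    show "case e of (u, v) \<Rightarrow> \<forall>(x, y)\<in>parcs G. {u, v} \<noteq> {x, y} \<longrightarrow>
        path_image (case (u, v) of (u, v) \<Rightarrow> linepath u v) \<inter> path_image (case (x, y) of (u, v) \<Rightarrow> linepath u v)
          \<subseteq> (\<lambda>x. x) ` ({u, v} \<inter> {x, y})"
    proof -
      have "closed_segment u v \<inter> closed_segment c d \<subseteq> {u, v} \<inter> {c, d}"
        if "(c, d) \<in> parcs G" "{u, v} \<noteq> {c, d}" for c d
        using key[of u v c d] e that unfolding uv by blast
      then show ?thesis unfolding uv prod.case image_ident path_image_linepath by blast
    qed
  qed simp
  then show ?thesis using G by (simp add: planar_geometric_graph_def)
qed

section \<open>Subdividing an edge into a path\<close>

text \<open>The path grows from \<open>x 0\<close>. In stage \<open>Hm m\<close> the rest is still a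
  single edge from \<open>x m\<close> to \<open>x L\<close>, and this edge is subdivided
  next.\<close>

lemma subdivision_path:
  fixes x :: "nat \<Rightarrow> 'a"
  assumes sd: "subdivision_pair G H" and arc: "(x 0, x L) \<in> parcs H" and L: "0 < L"
    and inj: "inj_on x {..L}" and fresh: "\<And>i. 0 < i \<Longrightarrow> i < L \<Longrightarrow> x i \<notin> pverts H"
  shows "subdivision_pair G \<lparr>pverts = pverts H \<union> {x i | i. 0 < i \<and> i < L},
    parcs = (parcs H - {(x 0, x L), (x L, x 0)}) \<union> {(x i, x (Suc i)) | i. i < L} \<union> {(x (Suc i), x i) | i. i < L}\<rparr>"
proof -
  interpret H: pair_bidirected_digraph H using bidirected_digraphI_subdivision[OF sd] .
  have arc': "(x L, x 0) \<in> parcs H" using arc H.arcs_symmetric by auto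
  define Hm where "Hm m = \<lparr>pverts = pverts H \<union> {x i | i. 0 < i \<and> i \<le> m},
    parcs = (parcs H - {(x 0, x L), (x L, x 0)}) \<union> {(x i, x (Suc i)) | i. i < m} \<union> {(x (Suc i), x i) | i. i < m}
      \<union> {(x m, x L), (x L, x m)}\<rparr>" for m
  have eq: "x i = x j \<longleftrightarrow> i = j" if "i \<le> L" "j \<le> L" for i j
    using inj that by (auto dest: inj_onD)
  have "subdivision_pair G (Hm m)" if "m < L" for m
    using that
  proof (induction m)
    case 0
    have "Hm 0 = H" using arc arc' by (cases H) (auto simp: Hm_def)
    then show ?case using sd by simp
  next
    case (Suc m)
    have new: "x (Suc m) \<notin> pverts (Hm m)"
      using fresh[of "Suc m"] Suc.prems eq by (auto simp: Hm_def)
    have xm: "x m \<notin> pverts H" if "m > 0" using fresh[of m] Suc.prems that by simp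
    have 1: "(x m, x L) \<notin> parcs H - {(x 0, x L), (x L, x 0)}" "(x L, x m) \<notin> parcs H - {(x 0, x L), (x L, x 0)}"
      using xm H.in_arcsD1 H.in_arcsD2 by (cases "m = 0"; blast)+
    have 2: "(x m, x L) \<noteq> (x i, x (Suc i))" "(x m, x L) \<noteq> (x (Suc i), x i)"
      "(x L, x m) \<noteq> (x i, x (Suc i))" "(x L, x m) \<noteq> (x (Suc i), x i)" if "i < m" for i
      using that Suc.prems eq[of m i] eq[of L i] by auto
    have "subdivide (Hm m) (x m, x L) (x (Suc m)) = Hm (Suc m)"
    proof (rule pair_pre_digraph.equality)
      show "pverts (subdivide (Hm m) (x m, x L) (x (Suc m))) = pverts (Hm (Suc m))"
        by (auto simp: Hm_def le_Suc_eq)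
      have "parcs (Hm m) - {(x m, x L), (x L, x m)} =
          (parcs H - {(x 0, x L), (x L, x 0)}) \<union> {(x i, x (Suc i)) | i. i < m} \<union> {(x (Suc i), x i) | i. i < m}"
      proof -
        have *: "(P \<union> Q \<union> R \<union> {y, z}) - {y, z} = P \<union> Q \<union> R"
          if "y \<notin> P" "z \<notin> P" "y \<notin> Q" "z \<notin> Q" "y \<notin> R" "z \<notin> R"
          for P Q R :: "('a \<times> 'a) set" and y z
          using that by blast
        show ?thesis
          unfolding Hm_def pair_pre_digraph.simps mem_Collect_eq
          by (rule *[OF 1]) (use 2 in fast)+
      qed
      moreover have "{(x i, x (Suc i)) | i. i < Suc m} = insert (x m, x (Suc m)) {(x i, x (Suc i)) | i. i < m}"
        "{(x (Suc i), x i) | i. i < Suc m} = insert (x (Suc m), x m) {(x (Suc i), x i) | i. i < m}"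
        unfolding less_Suc_eq by blast+
      moreover have "S \<union> {q, r, s, t} = P \<union> Q' \<union> R' \<union> {s, t}"
        if "S = P \<union> Q \<union> R" "Q' = insert q Q" "R' = insert r R"
        for S P Q R Q' R' :: "('a \<times> 'a) set" and q r s t
        unfolding that by blast
      ultimately show "parcs (subdivide (Hm m) (x m, x L) (x (Suc m))) = parcs (Hm (Suc m))"
        unfolding arcs_subdivide by (simp only: Hm_def pair_pre_digraph.simps)
    qed simp
    moreover have "(x m, x L) \<in> parcs (Hm m)" by (simp add: Hm_def)
    ultimately show ?case
      using subdivision_pair_divide[OF _ new] Suc by fastforce
  qed
  from this[of "L - 1"] have "subdivision_pair G (Hm (L - 1))" using L by simp
  moreover have "Hm (L - 1) = \<lparr>pverts = pverts H \<union> {x i | i. 0 < i \<and> i < L},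
    parcs = (parcs H - {(x 0, x L), (x L, x 0)}) \<union> {(x i, x (Suc i)) | i. i < L} \<union> {(x (Suc i), x i) | i. i < L}\<rparr>"
  proof -
    obtain l where l: "L = Suc l" using L by (cases L) auto
    have "{(x i, x (Suc i)) | i. i < L} = insert (x (L - 1), x L) {(x i, x (Suc i)) | i. i < L - 1}"
      "{(x (Suc i), x i) | i. i < L} = insert (x L, x (L - 1)) {(x (Suc i), x i) | i. i < L - 1}"
      unfolding l diff_Suc_1 less_Suc_eq by blast+
    moreover have "{x i | i. 0 < i \<and> i \<le> L - 1} = {x i | i. 0 < i \<and> i < L}" unfolding l diff_Suc_1 less_Suc_eq_le by simp
    ultimately show ?thesis unfolding Hm_def by (simp add: insert_commute)
  qed
  ultimately show ?thesis by simp
qed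

section \<open>Uniform subdivisions drawn as geometric graphs\<close>

text \<open>Points have integer coordinates and the parameter of the geometric graph is \<open>10\<close>.\<close>

definition close_pts :: "int \<times> int \<Rightarrow> int \<times> int \<Rightarrow> bool" where
  "close_pts x y \<longleftrightarrow> (fst x - fst y)\<^sup>2 + (snd x - snd y)\<^sup>2 \<le> 100"

definition pt :: "int \<times> int \<Rightarrow> complex" where
  "pt x = Complex (of_int (fst x)) (of_int (snd x))"

lemma pt_eq [simp]: "pt x = pt y \<longleftrightarrow> x = y"
  by (auto simp: pt_def prod_eq_iff)

lemma dist_pt: "dist (pt x) (pt y) \<le> 10 \<longleftrightarrow> close_pts x y"
proof -
  have "dist (pt x) (pt y) = sqrt ((of_int (fst x) - of_int (fst y))\<^sup>2 + (of_int (snd x) - of_int (snd y))\<^sup>2)"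
    by (simp add: pt_def dist_norm cmod_def)
  also have "\<dots> \<le> 10 \<longleftrightarrow> (of_int (fst x) - of_int (fst y) :: real)\<^sup>2 + (of_int (snd x) - of_int (snd y))\<^sup>2 \<le> 100"
    by (subst real_sqrt_le_iff [of _ 100, symmetric]) simp
  also have "\<dots> \<longleftrightarrow> of_int ((fst x - fst y)\<^sup>2 + (snd x - snd y)\<^sup>2) \<le> (of_int 100 :: real)" by simp
  also have "\<dots> \<longleftrightarrow> close_pts x y" unfolding of_int_le_iff close_pts_def ..
  finally show ?thesis .
qed

lemma close_refl [simp]: "close_pts x x"
  by (simp add: close_pts_def)

lemma close_sym: "close_pts x y \<Longrightarrow> close_pts y x"
  by (simp add: close_pts_def power2_commute)

text \<open>Closeness is adjacency in the later geometric graph. The exception in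
  \<open>close_diff\<close> is unavoidable: the centre of a vertex is adjacent to the first point of
  each edge that leaves it.\<close>

locale fine_drawing =
  fixes G :: "'a pair_pre_digraph" and c :: "'a \<Rightarrow> int \<times> int"
    and \<Phi> :: "'a \<Rightarrow> 'a \<Rightarrow> nat \<Rightarrow> int \<times> int" and L :: nat
  assumes graph: "pair_graph G" and L: "2 \<le> L"
    and \<Phi>_0: "(u, v) \<in> parcs G \<Longrightarrow> \<Phi> u v 0 = c u"
    and \<Phi>_rev: "(u, v) \<in> parcs G \<Longrightarrow> i \<le> L \<Longrightarrow> \<Phi> v u i = \<Phi> u v (L - i)"
    and close_same: "(u, v) \<in> parcs G \<Longrightarrow> i \<le> L \<Longrightarrow> j \<le> L \<Longrightarrow> close_pts (\<Phi> u v i) (\<Phi> u v j) \<Longrightarrow>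
      i = j \<or> i = Suc j \<or> j = Suc i"
    and close_Suc: "(u, v) \<in> parcs G \<Longrightarrow> i < L \<Longrightarrow> close_pts (\<Phi> u v i) (\<Phi> u v (Suc i))"
    and \<Phi>_inj: "(u, v) \<in> parcs G \<Longrightarrow> inj_on (\<Phi> u v) {..L}"
    and close_diff: "(u, v) \<in> parcs G \<Longrightarrow> (x, y) \<in> parcs G \<Longrightarrow> {u, v} \<noteq> {x, y} \<Longrightarrow> i \<le> L \<Longrightarrow> j \<le> L \<Longrightarrow>
      close_pts (\<Phi> u v i) (\<Phi> x y j) \<Longrightarrow> \<exists>w\<in>{u, v} \<inter> {x, y}. \<Phi> u v i = c w \<or> \<Phi> x y j = c w"
    and close_vertex: "w \<in> pverts G \<Longrightarrow> (u, v) \<in> parcs G \<Longrightarrow> i \<le> L \<Longrightarrow> close_pts (c w) (\<Phi> u v i) \<Longrightarrow> w \<in> {u, v}"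
    and close_vertices: "u \<in> pverts G \<Longrightarrow> v \<in> pverts G \<Longrightarrow> close_pts (c u) (c v) \<Longrightarrow> u = v"
begin

sublocale G: pair_graph G by (rule graph)

lemma sym: "(u, v) \<in> parcs G \<Longrightarrow> (v, u) \<in> parcs G"
  using G.arcs_symmetric by blast

lemma irrefl: "(u, u) \<notin> parcs G"
  using G.pair_no_loops by fastforce

lemma wf: "(u, v) \<in> parcs G \<Longrightarrow> u \<in> pverts G" "(u, v) \<in> parcs G \<Longrightarrow> v \<in> pverts G"
  using G.in_arcsD1 G.in_arcsD2 by auto

lemma \<Phi>_L: "(u, v) \<in> parcs G \<Longrightarrow> \<Phi> u v L = c v"
  using \<Phi>_rev[OF sym, of u v L] \<Phi>_0[OF sym] by simp

lemma c_inj: "inj_on c (pverts G)"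
  using close_vertices by (intro inj_onI) auto

lemma \<Phi>_eq: "(u, v) \<in> parcs G \<Longrightarrow> i \<le> L \<Longrightarrow> j \<le> L \<Longrightarrow> \<Phi> u v i = \<Phi> u v j \<longleftrightarrow> i = j"
  using \<Phi>_inj[of u v] by (auto dest: inj_onD)

lemma \<Phi>_inner:
  assumes "(u, v) \<in> parcs G" "0 < i" "i < L"
  shows "\<Phi> u v i \<notin> c ` pverts G"
proof
  assume "\<Phi> u v i \<in> c ` pverts G"
  then obtain w where w: "w \<in> pverts G" "\<Phi> u v i = c w" by blast
  then have "w \<in> {u, v}" using close_vertex[OF w(1) assms(1), of i] assms by simp
  then have "\<Phi> u v i = \<Phi> u v 0 \<or> \<Phi> u v i = \<Phi> u v L"
    using w \<Phi>_0[OF assms(1)] \<Phi>_L[OF assms(1)] by auto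
  then show False using \<Phi>_eq[OF assms(1), of i] assms by auto
qed

lemma \<Phi>_eq_diff:
  assumes "(u, v) \<in> parcs G" "(x, y) \<in> parcs G" "0 < i" "i < L" "j \<le> L" "\<Phi> u v i = \<Phi> x y j"
  shows "u = x \<and> v = y \<and> i = j \<or> u = y \<and> v = x \<and> i = L - j"
proof (cases "{u, v} = {x, y}")
  case True
  then consider "u = x" "v = y" | "u = y" "v = x" by (auto simp: doubleton_eq_iff)
  then show ?thesis
  proof cases
    case 1
    then show ?thesis using \<Phi>_eq[OF assms(1), of i j] assms by simp
  next
    case 2
    then have "\<Phi> u v i = \<Phi> u v (L - j)" using assms \<Phi>_rev[OF assms(1), of j] by simp
    then show ?thesis using \<Phi>_eq[OF assms(1), of i "L - j"] assms 2 by simp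
  qed
next
  case False
  then obtain w where "w \<in> {u, v} \<inter> {x, y}" "\<Phi> u v i = c w \<or> \<Phi> x y j = c w"
    using close_diff[OF assms(1,2) False, of i j] assms by auto
  then have "\<Phi> u v i \<in> c ` pverts G" using assms wf by auto
  then show ?thesis using \<Phi>_inner assms by blast
qed

section \<open>The geometric graph of a fine drawing\<close>

definition points :: "'a set \<Rightarrow> complex set" where
  "points W = (\<lambda>w. pt (c w)) ` W \<union> {pt (\<Phi> u v i) | u v i. (u, v) \<in> parcs G \<and> u \<in> W \<and> v \<in> W \<and> i \<le> L}"

definition drawn :: "complex pair_pre_digraph" where
  "drawn = \<lparr>pverts = points (pverts G),
     parcs = {(x, y). x \<in> points (pverts G) \<and> y \<in> points (pverts G) \<and> x \<noteq> y \<and> dist x y \<le> 10}\<rparr>"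

lemma points_cases:
  assumes "p \<in> points (pverts G)"
  obtains w where "w \<in> pverts G" "p = pt (c w)" | u v i where "(u, v) \<in> parcs G" "i \<le> L" "p = pt (\<Phi> u v i)"
  using assms unfolding points_def by blast

text \<open>Closeness between different edges, or between a vertex and an edge, always involves an
  end of the other edge, so that both points can be read off one path.\<close>

lemma on_common_edge:
  assumes "p \<in> points (pverts G)" "q \<in> points (pverts G)" "p \<noteq> q" "dist p q \<le> 10"
  shows "\<exists>u v i j. (u, v) \<in> parcs G \<and> i \<le> L \<and> j \<le> L \<and> p = pt (\<Phi> u v i) \<and> q = pt (\<Phi> u v j)"
proof -
  have endpoint: "\<exists>j\<le>L. c w = \<Phi> u v j" if "(u, v) \<in> parcs G" "w \<in> {u, v}" for u v w
    using that \<Phi>_0[OF that(1)] \<Phi>_L[OF that(1)] by (metis insertE le0 order_refl singletonD)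
  from assms(1) show ?thesis
  proof (cases rule: points_cases)
    case (1 w)
    from assms(2) show ?thesis
    proof (cases rule: points_cases)
      case (1 w')
      then show ?thesis using assms close_vertices[of w w'] \<open>w \<in> pverts G\<close> \<open>p = pt (c w)\<close> by (auto simp: dist_pt)
    next
      case (2 u v i)
      have "close_pts (c w) (\<Phi> u v i)" using assms(4) 1 2 by (simp add: dist_pt)
      then show ?thesis using endpoint[OF 2(1) close_vertex[OF 1(1) 2(1,2)]] 1 2 by auto
    qed
  next
    case (2 u v i)
    from assms(2) show ?thesis
    proof (cases rule: points_cases)
      case (1 w)
      have "close_pts (c w) (\<Phi> u v i)" using assms(4) 1 2 close_sym by (simp add: dist_pt)
      then show ?thesis using endpoint[OF 2(1) close_vertex[OF 1(1) 2(1,2)]] 1 2 by auto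
    next
      case (2 x y j)
      note uv = \<open>(u, v) \<in> parcs G\<close> and i = \<open>i \<le> L\<close> and p = \<open>p = pt (\<Phi> u v i)\<close>
      have cl: "close_pts (\<Phi> u v i) (\<Phi> x y j)" using assms(4) 2 p by (simp add: dist_pt)
      show ?thesis
      proof (cases "{u, v} = {x, y}")
        case True
        then consider "u = x" "v = y" | "u = y" "v = x" by (auto simp: doubleton_eq_iff)
        then show ?thesis
        proof cases
          case 1
          then show ?thesis using 2 uv i p by blast
        next
          case r: 2
          then have "\<Phi> x y j = \<Phi> u v (L - j)" using \<Phi>_rev[OF uv 2(2)] by simp
          then show ?thesis using 2 uv i p diff_le_self by metis
        qed
      next
        case False
        from close_diff[OF uv 2(1) False i 2(2) cl]
        obtain w where w: "w \<in> {u, v} \<inter> {x, y}" "\<Phi> u v i = c w \<or> \<Phi> x y j = c w" by blast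
        from w(2) show ?thesis
        proof
          assume "\<Phi> u v i = c w"
          then show ?thesis using endpoint[OF 2(1), of w] w(1) 2 p by auto
        next
          assume "\<Phi> x y j = c w"
          then show ?thesis using endpoint[OF uv, of w] w(1) uv i 2 p by auto
        qed
      qed
    qed
  qed
qed

lemma drawn_arc_iff:
  "(p, q) \<in> parcs drawn \<longleftrightarrow> (\<exists>u v i. (u, v) \<in> parcs G \<and> i < L \<and> p = pt (\<Phi> u v i) \<and> q = pt (\<Phi> u v (Suc i)))"
proof
  assume "(p, q) \<in> parcs drawn"
  then have pq: "p \<in> points (pverts G)" "q \<in> points (pverts G)" "p \<noteq> q" "dist p q \<le> 10" by (auto simp: drawn_def)
  from on_common_edge[OF this] obtain u v i j where
    *: "(u, v) \<in> parcs G" "i \<le> L" "j \<le> L" "p = pt (\<Phi> u v i)" "q = pt (\<Phi> u v j)" by blast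
  then have "close_pts (\<Phi> u v i) (\<Phi> u v j)" using pq by (simp add: dist_pt)
  from close_same[OF *(1-3) this] consider "i = j" | "i = Suc j" | "j = Suc i" by blast
  then show "\<exists>u v i. (u, v) \<in> parcs G \<and> i < L \<and> p = pt (\<Phi> u v i) \<and> q = pt (\<Phi> u v (Suc i))"
  proof cases
    case 1
    then show ?thesis using * pq by simp
  next
    case 2
    have "p = pt (\<Phi> v u (L - Suc j))" "q = pt (\<Phi> v u (Suc (L - Suc j)))"
      using * 2 \<Phi>_rev[OF *(1), of "L - Suc j"] \<Phi>_rev[OF *(1), of "L - j"] by (auto simp: Suc_diff_Suc)
    then show ?thesis using sym[OF *(1)] 2 * L by (metis diff_less zero_less_Suc order_less_le_trans zero_less_numeral)
  next
    case 3
    then show ?thesis using * by (metis Suc_le_lessD)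
  qed
next
  assume "\<exists>u v i. (u, v) \<in> parcs G \<and> i < L \<and> p = pt (\<Phi> u v i) \<and> q = pt (\<Phi> u v (Suc i))"
  then obtain u v i where *: "(u, v) \<in> parcs G" "i < L" "p = pt (\<Phi> u v i)" "q = pt (\<Phi> u v (Suc i))" by blast
  have pts: "pt (\<Phi> u v j) \<in> points (pverts G)" if "j \<le> L" for j
    using that *(1) wf[OF *(1)] unfolding points_def by blast
  have "p \<noteq> q" using * \<Phi>_eq[OF *(1), of i "Suc i"] by simp
  moreover have "dist p q \<le> 10" using * close_Suc[OF *(1,2)] by (simp add: dist_pt)
  ultimately show "(p, q) \<in> parcs drawn" using pts[of i] pts[of "Suc i"] * by (simp add: drawn_def)
qed

lemma finite_points: "finite (points W)" if "finite W"
proof -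
  have "{pt (\<Phi> u v i) | u v i. (u, v) \<in> parcs G \<and> i \<le> L} = (\<lambda>(e, i). pt (\<Phi> (fst e) (snd e) i)) ` (parcs G \<times> {..L})"
    by force
  then have "finite {pt (\<Phi> u v i) | u v i. (u, v) \<in> parcs G \<and> i \<le> L}"
    using G.pair_finite_arcs by simp
  then have "finite {pt (\<Phi> u v i) | u v i. (u, v) \<in> parcs G \<and> u \<in> W \<and> v \<in> W \<and> i \<le> L}"
    by (rule rev_finite_subset) blast
  then show ?thesis
    unfolding points_def using that by simp
qed

text \<open>As \<open>L\<close> is at least 2, every edge of a triangle would contain an inner
  vertex of some path. The only neighbours of such a vertex are its predecessor and successor, whose
  indices differ by 2.\<close>

lemma drawn_planar: "planar_geometric_graph 10 drawn"
proof (rule triangle_free_plane)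
  show "geometric_graph 10 drawn"
    using finite_points[OF G.pair_finite_verts] by (auto simp: geometric_graph_def drawn_def)
  have dsym: "(y, x) \<in> parcs drawn" if "(x, y) \<in> parcs drawn" for x y
    using that by (auto simp: drawn_def dist_commute)
  have inner: False
    if xy: "(pt (\<Phi> u v i), x) \<in> parcs drawn" "(pt (\<Phi> u v i), y) \<in> parcs drawn" "(x, y) \<in> parcs drawn"
      and uv: "(u, v) \<in> parcs G" "0 < i" "i < L" for u v i x y
  proof -
    have nb: "z = pt (\<Phi> u v (i - 1)) \<or> z = pt (\<Phi> u v (Suc i))" if z: "(pt (\<Phi> u v i), z) \<in> parcs drawn" for z
    proof -
      obtain a b j where *: "(a, b) \<in> parcs G" "j < L" "\<Phi> u v i = \<Phi> a b j" "z = pt (\<Phi> a b (Suc j))"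
        using z unfolding drawn_arc_iff by auto
      from \<Phi>_eq_diff[OF uv(1) *(1) uv(2,3) _ *(3)] *(2)
      consider "u = a" "v = b" "i = j" | "u = b" "v = a" "i = L - j" by auto
      then show ?thesis
      proof cases
        case 2
        then have "\<Phi> a b (Suc j) = \<Phi> u v (L - Suc j)" "L - Suc j = i - 1"
          using \<Phi>_rev[OF uv(1), of "Suc j"] * by auto
        then show ?thesis using * by simp
      qed (use * in simp)
    qed
    have "x \<noteq> y" using xy(3) by (auto simp: drawn_def)
    moreover have "dist x y \<le> 10" "dist y x \<le> 10"
      using xy(3) dsym[OF xy(3)] by (auto simp: drawn_def)
    ultimately have "close_pts (\<Phi> u v (i - 1)) (\<Phi> u v (Suc i))"
      using nb[OF xy(1)] nb[OF xy(2)] by (metis dist_pt)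
    then show False using close_same[OF uv(1), of "i - 1" "Suc i"] uv by arith
  qed
  fix x y z assume xy: "(x, y) \<in> parcs drawn" and yz: "(y, z) \<in> parcs drawn"
  show "(x, z) \<notin> parcs drawn"
  proof
    assume xz: "(x, z) \<in> parcs drawn"
    obtain u v i where *: "(u, v) \<in> parcs G" "i < L" "x = pt (\<Phi> u v i)" "y = pt (\<Phi> u v (Suc i))"
      using xy unfolding drawn_arc_iff by blast
    show False
    proof (cases "i = 0")
      case True
      then have y: "y = pt (\<Phi> u v 1)" using *(4) by simp
      show False
        by (rule inner[OF dsym[OF xy, unfolded y] yz[unfolded y] xz *(1)]) (use L in simp_all)
    next
      case False
      show False
        by (rule inner[OF xy[unfolded *(3)] xz[unfolded *(3)] yz *(1)]) (use False *(2) in simp_all)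
    qed
  qed
qed

definition copy :: "complex pair_pre_digraph" where
  "copy = \<lparr>pverts = (\<lambda>w. pt (c w)) ` pverts G, parcs = (\<lambda>(u, v). (pt (c u), pt (c v))) ` parcs G\<rparr>"

lemma copy_iso: "digraph_iso (with_proj G) (with_proj copy)"
proof -
  define h where "h = \<lparr>iso_verts = (\<lambda>w. pt (c w)), iso_arcs = (\<lambda>(u, v). (pt (c u), pt (c v))),
    iso_head = snd, iso_tail = fst\<rparr>"
  have inj: "inj_on (\<lambda>w. pt (c w)) (pverts G)"
    using c_inj by (simp add: inj_on_def)
  have "inj_on (\<lambda>(u, v). (pt (c u), pt (c v))) (parcs G)"
  proof (rule inj_onI)
    fix d e assume "d \<in> parcs G" "e \<in> parcs G"
      "(case d of (u, v) \<Rightarrow> (pt (c u), pt (c v))) = (case e of (u, v) \<Rightarrow> (pt (c u), pt (c v)))"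
    then show "d = e"
      using inj_on_eq_iff[OF c_inj] wf by (cases d; cases e) simp
  qed
  then have "pre_digraph.digraph_isomorphism (with_proj G) h"
    unfolding pre_digraph.digraph_isomorphism_def h_def
    using inj G.wf_digraph by (simp add: split_beta)
  moreover have "with_proj copy = app_iso h (with_proj G)"
    by (simp add: app_iso_def h_def copy_def with_proj_def)
  ultimately show ?thesis unfolding digraph_iso_def by blast
qed

lemma copy_pair_graph: "pair_graph copy"
proof
  show "symmetric (with_proj copy)"
    unfolding symmetric_def with_proj_simps
  proof (rule symI)
    fix a b assume "(a, b) \<in> parcs copy"
    then obtain u v where "(u, v) \<in> parcs G" "a = pt (c u)" "b = pt (c v)" by (auto simp: copy_def)
    then show "(b, a) \<in> parcs copy" using sym[of u v] by (force simp: copy_def)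
  qed
  show "fst e \<noteq> snd e" if "e \<in> parcs copy" for e
    using that irrefl wf c_inj by (auto simp: copy_def inj_on_eq_iff)
qed (use G.pair_finite_verts G.pair_finite_arcs wf in \<open>auto simp: copy_def\<close>)

end

text \<open>In a symmetric digraph reachability is an equivalence relation, and the strong
  components are the subgraphs induced by its classes.\<close>

lemma (in pair_sym_digraph) scc_properties:
  assumes X: "X \<in> sccs"
  shows "wf_digraph X" "strongly_connected X" "verts X \<subseteq> pverts G"
    "x \<rightarrow>\<^bsub>X\<^esub> y \<longleftrightarrow> (x, y) \<in> parcs G \<and> x \<in> verts X \<and> y \<in> verts X"
    "x \<in> verts X \<Longrightarrow> y \<in> verts X \<longleftrightarrow> x \<rightarrow>\<^sup>*\<^bsub>G\<^esub> y"
proof -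
  have ind: "induced_subgraph X (with_proj G)" and sc: "strongly_connected X"
    using X by (auto simp: sccs_def)
  then have sub: "subgraph X (with_proj G)" by blast
  show "wf_digraph X" "strongly_connected X" using sub sc by (auto simp: subgraph_def)
  show vs: "verts X \<subseteq> pverts G" using sub by (auto simp: subgraph_def)
  have tl: "tail X = fst" "head X = snd" using sub by (auto simp: subgraph_def compatible_def)
  have ar: "arcs X = {e \<in> parcs G. fst e \<in> verts X \<and> snd e \<in> verts X}"
    using ind by (simp add: induced_subgraph_def)
  show "x \<rightarrow>\<^bsub>X\<^esub> y \<longleftrightarrow> (x, y) \<in> parcs G \<and> x \<in> verts X \<and> y \<in> verts X"
    unfolding arcs_ends_def arc_to_ends_def tl ar by auto
  have "verts X \<in> sccs_verts" using X by (intro in_sccs_vertsI_sccs) auto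
  then show "x \<in> verts X \<Longrightarrow> y \<in> verts X \<longleftrightarrow> x \<rightarrow>\<^sup>*\<^bsub>G\<^esub> y"
    unfolding in_sccs_verts_conv_reachable using symmetric_reachable' by blast
qed

section \<open>Components of the drawn graph\<close>

context fine_drawing begin

lemma drawn_pair_graph: "pair_graph drawn"
proof
  show "symmetric (with_proj drawn)"
    unfolding symmetric_def with_proj_simps by (rule symI) (auto simp: drawn_def dist_commute)
  have fin: "finite (points (pverts G))" using finite_points G.pair_finite_verts by blast
  then show "finite (pverts drawn)" by (simp add: drawn_def)
  have "parcs drawn \<subseteq> points (pverts G) \<times> points (pverts G)" by (auto simp: drawn_def)
  then show "finite (parcs drawn)" using fin finite_subset by blast
qed (auto simp: drawn_def)

sublocale D: pair_graph drawn by (rule drawn_pair_graph)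

lemma reach_edge:
  assumes "(u, v) \<in> parcs G" "i \<le> L"
  shows "pt (c u) \<rightarrow>\<^sup>*\<^bsub>drawn\<^esub> pt (\<Phi> u v i)"
  using assms(2)
proof (induction i)
  case 0
  have "pt (c u) \<in> pverts drawn" using wf[OF assms(1)] by (simp add: drawn_def points_def)
  then show ?case using \<Phi>_0[OF assms(1)] by auto
next
  case (Suc i)
  then have "(pt (\<Phi> u v i), pt (\<Phi> u v (Suc i))) \<in> parcs drawn"
    unfolding drawn_arc_iff using assms(1) by (metis Suc_le_lessD)
  then show ?case using Suc D.reachable_adj_trans by auto
qed

lemma points_pathI: "(u, v) \<in> parcs G \<Longrightarrow> u \<in> W \<Longrightarrow> v \<in> W \<Longrightarrow> i \<le> L \<Longrightarrow> pt (\<Phi> u v i) \<in> points W"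
  unfolding points_def by blast

text \<open>A branch point determines its vertex and an inner point determines its edge, so no arc
  leads from the paths over \<open>W\<close> to those of another component.\<close>

lemma points_closed:
  assumes W: "W \<subseteq> pverts G" and closed: "\<And>u v. (u, v) \<in> parcs G \<Longrightarrow> u \<in> W \<Longrightarrow> v \<in> W"
    and p: "p \<in> points W" and pq: "(p, q) \<in> parcs drawn"
  shows "q \<in> points W"
proof -
  obtain u v i where *: "(u, v) \<in> parcs G" "i < L" "p = pt (\<Phi> u v i)" "q = pt (\<Phi> u v (Suc i))"
    using pq unfolding drawn_arc_iff by blast
  have end_in: "w \<in> W" if "(a, b) \<in> parcs G" "a \<in> W" "b \<in> W" "j \<le> L" "w \<in> pverts G" "\<Phi> a b j = c w" for a b j w
    using close_vertex[of w a b j] that by auto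
  have "u \<in> W \<or> v \<in> W"
  proof (cases "i = 0")
    case True
    then have pu: "p = pt (c u)" using * \<Phi>_0 by simp
    from p consider w where "w \<in> W" "p = pt (c w)" | a b j where "(a, b) \<in> parcs G" "a \<in> W" "b \<in> W" "j \<le> L" "p = pt (\<Phi> a b j)"
      unfolding points_def by blast
    then show ?thesis
    proof cases
      case 1
      then show ?thesis using pu inj_on_eq_iff[OF c_inj, of w u] W wf(1)[OF *(1)] by auto
    next
      case 2
      then show ?thesis using pu end_in[OF 2(1-4) wf(1)[OF *(1)]] by auto
    qed
  next
    case False
    then have inner: "\<Phi> u v i \<notin> c ` pverts G" using \<Phi>_inner * by simp
    from p consider w where "w \<in> W" "p = pt (c w)" | a b j where "(a, b) \<in> parcs G" "a \<in> W" "b \<in> W" "j \<le> L" "p = pt (\<Phi> a b j)"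
      unfolding points_def by blast
    then show ?thesis
    proof cases
      case 1
      then show ?thesis using inner * W by auto
    next
      case 2
      then show ?thesis using \<Phi>_eq_diff[OF *(1) 2(1) _ *(2) 2(4)] * False by auto
    qed
  qed
  then have "u \<in> W" "v \<in> W" using closed[OF *(1)] closed[OF sym[OF *(1)]] by auto
  then show ?thesis using points_pathI[OF *(1), of W "Suc i"] *(2,4) by simp
qed

text \<open>The renaming \<open>g\<close> covers two uses: the identity on all of \<open>G\<close>,
  and on a component of \<open>copy\<close> the inverse of the map from vertices to points.\<close>

lemma component_uniform:
  fixes H :: "('b, 'c) pre_digraph" and H' :: "(complex, 'd) pre_digraph"
  assumes g: "inj_on g (verts H)" "g ` verts H \<subseteq> pverts G"
    and H_adj: "\<And>u v. u \<rightarrow>\<^bsub>H\<^esub> v \<longleftrightarrow> u \<in> verts H \<and> v \<in> verts H \<and> (g u, g v) \<in> parcs G"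
    and closed: "\<And>u v. (u, v) \<in> parcs G \<Longrightarrow> u \<in> g ` verts H \<Longrightarrow> v \<in> g ` verts H"
    and H': "verts H' = points (g ` verts H)"
    and H'_adj: "\<And>p q. p \<rightarrow>\<^bsub>H'\<^esub> q \<longleftrightarrow> (p, q) \<in> parcs drawn \<and> p \<in> verts H' \<and> q \<in> verts H'"
  shows "uniform_subdivision H H' (\<lambda>u. pt (c (g u))) (\<lambda>u v i. if u = v then pt (c (g u)) else pt (\<Phi> (g u) (g v) i)) L"
proof
  have finW: "finite (g ` verts H)" using g(2) G.pair_finite_verts finite_subset by blast
  show "finite (verts H)" using finW g(1) finite_image_iff by blast
  show "finite (verts H')" using finite_points[OF finW] H' by simp
  show "u \<rightarrow>\<^bsub>H\<^esub> v \<Longrightarrow> u \<in> verts H" for u v using H_adj by simp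
  show "u \<rightarrow>\<^bsub>H\<^esub> v \<Longrightarrow> v \<rightarrow>\<^bsub>H\<^esub> u" for u v using H_adj sym by simp
  show irr: "\<not> u \<rightarrow>\<^bsub>H\<^esub> u" for u using H_adj irrefl by simp
  show "2 \<le> L" by (rule L)
  let ?Q = "\<lambda>u v i. if u = v then pt (c (g u)) else pt (\<Phi> (g u) (g v) i)"
  have Q: "?Q u v i = pt (\<Phi> (g u) (g v) i)" if "u \<rightarrow>\<^bsub>H\<^esub> v" for u v i
    using that irr by auto
  have A: "(g u, g v) \<in> parcs G" if "u \<rightarrow>\<^bsub>H\<^esub> v" for u v using H_adj that by simp
  have "{pt (\<Phi> u v i) | u v i. (u, v) \<in> parcs G \<and> u \<in> g ` verts H \<and> v \<in> g ` verts H \<and> i \<le> L} =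
      {?Q u v i | u v i. u \<rightarrow>\<^bsub>H\<^esub> v \<and> i \<le> L}" (is "?l = ?r")
  proof
    show "?l \<subseteq> ?r"
    proof
      fix p assume "p \<in> ?l"
      then obtain u v i where "(g u, g v) \<in> parcs G" "u \<in> verts H" "v \<in> verts H" "i \<le> L" "p = pt (\<Phi> (g u) (g v) i)"
        by blast
      then have "u \<rightarrow>\<^bsub>H\<^esub> v" "p = ?Q u v i" "i \<le> L" using Q[of u v i] H_adj by simp_all
      then show "p \<in> ?r" by blast
    qed
    show "?r \<subseteq> ?l"
    proof
      fix p assume "p \<in> ?r"
      then obtain u v i where "u \<rightarrow>\<^bsub>H\<^esub> v" "i \<le> L" "p = ?Q u v i" by blast
      then have "(g u, g v) \<in> parcs G" "u \<in> verts H" "v \<in> verts H" "i \<le> L" "p = pt (\<Phi> (g u) (g v) i)"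
        using Q[of u v i] H_adj by simp_all
      then show "p \<in> ?l" by blast
    qed
  qed
  then show "verts H' = (\<lambda>u. pt (c (g u))) ` verts H \<union> {?Q u v i | u v i. u \<rightarrow>\<^bsub>H\<^esub> v \<and> i \<le> L}"
    unfolding H' points_def image_image by simp
  show "?Q u v 0 = pt (c (g u))" if "u \<rightarrow>\<^bsub>H\<^esub> v" for u v using Q[OF that] \<Phi>_0[OF A[OF that]] by simp
  show "?Q u u i = pt (c (g u))" for u i by simp
  show "?Q v u i = ?Q u v (L - i)" if "u \<rightarrow>\<^bsub>H\<^esub> v" "i \<le> L" for u v i
  proof -
    have vu: "v \<rightarrow>\<^bsub>H\<^esub> u" using that H_adj sym by simp
    show ?thesis using Q[OF vu] Q[OF that(1)] \<Phi>_rev[OF A[OF that(1)] that(2)] by simp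
  qed
  show "p \<rightarrow>\<^bsub>H'\<^esub> q \<longleftrightarrow> (\<exists>u v i. u \<rightarrow>\<^bsub>H\<^esub> v \<and> i < L \<and> p = ?Q u v i \<and> q = ?Q u v (Suc i))" for p q
  proof
    assume pq: "p \<rightarrow>\<^bsub>H'\<^esub> q"
    then obtain u v i where *: "(u, v) \<in> parcs G" "i < L" "p = pt (\<Phi> u v i)" "q = pt (\<Phi> u v (Suc i))"
      using H'_adj drawn_arc_iff by blast
    have "u \<in> g ` verts H \<or> v \<in> g ` verts H"
    proof (rule ccontr)
      assume n: "\<not> ?thesis"
      \<comment> \<open>One end of every arc is an inner point, since \<open>L\<close> is at least
        2, and it belongs to no other edge. So the whole edge lies in the component.\<close>
      have "\<exists>j. 0 < j \<and> j < L \<and> pt (\<Phi> u v j) \<in> points (g ` verts H)"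
      proof (cases "i = 0")
        case True
        then show ?thesis using pq H'_adj H' * L by (intro exI[of _ 1]) auto
      next
        case False
        then show ?thesis using pq H'_adj H' * by (intro exI[of _ i]) auto
      qed
      then obtain j where j: "0 < j" "j < L" "pt (\<Phi> u v j) \<in> points (g ` verts H)" by blast
      have inner: "\<Phi> u v j \<notin> c ` pverts G" using \<Phi>_inner * j by simp
      then obtain a b k where "(a, b) \<in> parcs G" "a \<in> g ` verts H" "b \<in> g ` verts H" "k \<le> L" "\<Phi> u v j = \<Phi> a b k"
        using j(3) g(2) unfolding points_def by auto
      then show False using \<Phi>_eq_diff[OF *(1) _ j(1,2)] n by blast
    qed
    then have "u \<in> g ` verts H" "v \<in> g ` verts H" using closed[OF *(1)] closed[OF sym[OF *(1)]] by auto
    then obtain a b where ab: "a \<in> verts H" "b \<in> verts H" "u = g a" "v = g b" by blast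
    then have "a \<rightarrow>\<^bsub>H\<^esub> b" using H_adj * by simp
    then show "\<exists>u v i. u \<rightarrow>\<^bsub>H\<^esub> v \<and> i < L \<and> p = ?Q u v i \<and> q = ?Q u v (Suc i)"
      using Q[of a b] * ab by metis
  next
    assume "\<exists>u v i. u \<rightarrow>\<^bsub>H\<^esub> v \<and> i < L \<and> p = ?Q u v i \<and> q = ?Q u v (Suc i)"
    then obtain u v i where *: "u \<rightarrow>\<^bsub>H\<^esub> v" "i < L" "p = ?Q u v i" "q = ?Q u v (Suc i)" by blast
    have pt_in: "pt (\<Phi> (g u) (g v) j) \<in> points (g ` verts H)" if "j \<le> L" for j
      using that A[OF *(1)] *(1) H_adj unfolding points_def by blast
    have pq: "p = pt (\<Phi> (g u) (g v) i)" "q = pt (\<Phi> (g u) (g v) (Suc i))" using * Q[OF *(1)] by simp_all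
    have "(p, q) \<in> parcs drawn" using pq A[OF *(1)] *(2) drawn_arc_iff by blast
    then show "p \<rightarrow>\<^bsub>H'\<^esub> q" unfolding H'_adj H' using pt_in[of i] pt_in[of "Suc i"] pq *(2) by simp
  qed
  show "inj_on (\<lambda>u. pt (c (g u))) (verts H)"
  proof (rule inj_onI)
    fix x y assume xy: "x \<in> verts H" "y \<in> verts H" "pt (c (g x)) = pt (c (g y))"
    then have "g x = g y" using g(2) inj_on_eq_iff[OF c_inj] by (simp add: image_subset_iff)
    then show "x = y" using xy g(1) by (simp add: inj_on_eq_iff)
  qed
  show "?Q u v i \<notin> (\<lambda>u. pt (c (g u))) ` verts H" if "u \<rightarrow>\<^bsub>H\<^esub> v" "0 < i" "i < L" for u v i
    using \<Phi>_inner[OF A[OF that(1)] that(2,3)] Q[OF that(1)] g(2) by auto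
  show "u = u' \<and> v = v' \<and> i = j \<or> u = v' \<and> v = u' \<and> i = L - j"
    if "u \<rightarrow>\<^bsub>H\<^esub> v" "u' \<rightarrow>\<^bsub>H\<^esub> v'" "0 < i" "i < L" "j < L" "?Q u v i = ?Q u' v' j" for u v u' v' i j
  proof -
    have "\<Phi> (g u) (g v) i = \<Phi> (g u') (g v') j" using that(6) Q[OF that(1)] Q[OF that(2)] by simp
    from \<Phi>_eq_diff[OF A[OF that(1)] A[OF that(2)] that(3,4) _ this] that(5)
    have "g u = g u' \<and> g v = g v' \<and> i = j \<or> g u = g v' \<and> g v = g u' \<and> i = L - j" by simp
    then show ?thesis using that(1,2) H_adj inj_on_eq_iff[OF g(1)] by auto
  qed
qed

lemma reach_points:
  fixes H :: "('b, 'c) pre_digraph"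
  assumes wfH: "wf_digraph H" and g: "g ` verts H \<subseteq> pverts G" and sc: "strongly_connected H"
    and H_adj: "\<And>u v. u \<rightarrow>\<^bsub>H\<^esub> v \<Longrightarrow> (g u, g v) \<in> parcs G"
    and pq: "p \<in> points (g ` verts H)" "q \<in> points (g ` verts H)"
  shows "p \<rightarrow>\<^sup>*\<^bsub>drawn\<^esub> q"
proof -
  interpret H: wf_digraph H by fact
  have in_drawn: "pt (c (g u)) \<in> pverts drawn" if "u \<in> verts H" for u
    using that g by (auto simp: drawn_def points_def)
  have vv: "pt (c (g u)) \<rightarrow>\<^sup>*\<^bsub>drawn\<^esub> pt (c (g v))" if "u \<rightarrow>\<^sup>*\<^bsub>H\<^esub> v" for u v
    using that
  proof (induction rule: H.reachable_induct)
    case base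
    then show ?case using in_drawn H.reachable_in_verts[OF that] by auto
  next
    case (step x y)
    have "pt (c (g x)) \<rightarrow>\<^sup>*\<^bsub>drawn\<^esub> pt (c (g y))"
      using reach_edge[OF H_adj[OF step(2)] order_refl] \<Phi>_L[OF H_adj[OF step(2)]] by simp
    then show ?case using step D.reachable_trans by blast
  qed
  have start: "\<exists>u\<in>verts H. pt (c (g u)) \<rightarrow>\<^sup>*\<^bsub>drawn\<^esub> p" if "p \<in> points (g ` verts H)" for p
    using that in_drawn reach_edge unfolding points_def by blast
  obtain u where u: "u \<in> verts H" "pt (c (g u)) \<rightarrow>\<^sup>*\<^bsub>drawn\<^esub> p" using start pq by blast
  obtain v where v: "v \<in> verts H" "pt (c (g v)) \<rightarrow>\<^sup>*\<^bsub>drawn\<^esub> q" using start pq by blast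
  have "u \<rightarrow>\<^sup>*\<^bsub>H\<^esub> v" using sc u v by (simp add: strongly_connected_def)
  from D.symmetric_reachable'[OF u(2)] vv[OF this] v(2) show ?thesis
    by (meson D.reachable_trans)
qed

end

section \<open>The drawn graph as an iterated subdivision\<close>

context fine_drawing begin

text \<open>An intermediate stage: edges with an orientation in \<open>E\<close> are already
  replaced by their paths, the others are still arcs between the points of their ends.\<close>

definition partly_subdivided :: "('a \<times> 'a) set \<Rightarrow> complex pair_pre_digraph" where
  "partly_subdivided E = \<lparr>pverts = pverts copy \<union> {pt (\<Phi> u v i) | u v i. (u, v) \<in> E \<and> 0 < i \<and> i < L},
     parcs = {(pt (c u), pt (c v)) | u v. (u, v) \<in> parcs G \<and> (u, v) \<notin> E \<and> (v, u) \<notin> E}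
       \<union> {(pt (\<Phi> u v i), pt (\<Phi> u v (Suc i))) | u v i. (u, v) \<in> E \<and> i < L}
       \<union> {(pt (\<Phi> u v (Suc i)), pt (\<Phi> u v i)) | u v i. (u, v) \<in> E \<and> i < L}\<rparr>"

text \<open>No step of a path joins two original vertices. Hence removing the arcs of the edge that
  is subdivided next does not damage the paths inserted before.\<close>

lemma inner_point:
  assumes "(u, v) \<in> parcs G" "i < L"
  shows "pt (\<Phi> u v i) \<notin> pverts copy \<or> pt (\<Phi> u v (Suc i)) \<notin> pverts copy"
proof (cases "i = 0")
  case True
  then show ?thesis using \<Phi>_inner[OF assms(1), of 1] L by (auto simp: copy_def)
next
  case False
  then show ?thesis using \<Phi>_inner[OF assms(1), of i] assms by (auto simp: copy_def)
qed

lemma partly_subdivided_insert: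
  assumes E: "insert (a, b) E \<subseteq> parcs G" "(a, b) \<notin> E" "(b, a) \<notin> E"
    and sd: "subdivision_pair copy (partly_subdivided E)"
  shows "subdivision_pair copy (partly_subdivided (insert (a, b) E))"
proof -
  define x where "x i = pt (\<Phi> a b i)" for i
  have ab: "(a, b) \<in> parcs G" using E by simp
  have x0: "x 0 = pt (c a)" and xL: "x L = pt (c b)" using \<Phi>_0[OF ab] \<Phi>_L[OF ab] by (simp_all add: x_def)
  have in_copy: "pt (c u) \<in> pverts copy" if "u \<in> pverts G" for u using that by (simp add: copy_def)
  have *: "subdivision_pair copy \<lparr>pverts = pverts (partly_subdivided E) \<union> {x i | i. 0 < i \<and> i < L},
    parcs = (parcs (partly_subdivided E) - {(x 0, x L), (x L, x 0)}) \<union> {(x i, x (Suc i)) | i. i < L} \<union> {(x (Suc i), x i) | i. i < L}\<rparr>"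
  proof (rule subdivision_path[OF sd])
    show "(x 0, x L) \<in> parcs (partly_subdivided E)"
      unfolding x0 xL partly_subdivided_def pair_pre_digraph.simps using ab E by blast
    show "0 < L" using L by simp
    show "inj_on x {..L}" using \<Phi>_inj[OF ab] by (simp add: x_def inj_on_def)
    show "x i \<notin> pverts (partly_subdivided E)" if i: "0 < i" "i < L" for i
    proof
      assume "x i \<in> pverts (partly_subdivided E)"
      moreover have "x i \<notin> pverts copy" using \<Phi>_inner[OF ab i] by (auto simp: x_def copy_def)
      ultimately obtain u v j where uv: "(u, v) \<in> E" "j < L" "\<Phi> a b i = \<Phi> u v j"
        unfolding partly_subdivided_def by (auto simp: x_def)
      then show False using \<Phi>_eq_diff[OF ab _ i _ uv(3)] E by auto
    qed
  qed
  have 1: "{(pt (c u), pt (c v)) | u v. (u, v) \<in> parcs G \<and> (u, v) \<notin> E \<and> (v, u) \<notin> E} - {(x 0, x L), (x L, x 0)} =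
      {(pt (c u), pt (c v)) | u v. (u, v) \<in> parcs G \<and> (u, v) \<notin> insert (a, b) E \<and> (v, u) \<notin> insert (a, b) E}" (is "?l = ?r")
  proof
    show "?l \<subseteq> ?r" unfolding x0 xL by blast
    show "?r \<subseteq> ?l"
    proof
      fix e assume "e \<in> ?r"
      then obtain u v where uv: "e = (pt (c u), pt (c v))" "(u, v) \<in> parcs G" "(u, v) \<notin> insert (a, b) E" "(v, u) \<notin> insert (a, b) E"
        by blast
      have "e \<noteq> (x 0, x L)" "e \<noteq> (x L, x 0)"
        using uv inj_on_eq_iff[OF c_inj] wf[OF ab] wf[OF uv(2)] unfolding x0 xL by auto
      then show "e \<in> ?l" using uv by blast
    qed
  qed
  have 2: "(x 0, x L) \<noteq> (pt (\<Phi> u v i), pt (\<Phi> u v (Suc i)))" "(x L, x 0) \<noteq> (pt (\<Phi> u v i), pt (\<Phi> u v (Suc i)))"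
    "(x 0, x L) \<noteq> (pt (\<Phi> u v (Suc i)), pt (\<Phi> u v i))" "(x L, x 0) \<noteq> (pt (\<Phi> u v (Suc i)), pt (\<Phi> u v i))"
    if "(u, v) \<in> E" "i < L" for u v i
    using inner_point[of u v i] that E in_copy[OF wf(1)[OF ab]] in_copy[OF wf(2)[OF ab]]
    unfolding x0 xL prod.inject by (metis insert_subset subsetD)+
  have "\<lparr>pverts = pverts (partly_subdivided E) \<union> {x i | i. 0 < i \<and> i < L},
    parcs = (parcs (partly_subdivided E) - {(x 0, x L), (x L, x 0)}) \<union> {(x i, x (Suc i)) | i. i < L} \<union> {(x (Suc i), x i) | i. i < L}\<rparr>
    = partly_subdivided (insert (a, b) E)"
  proof (rule pair_pre_digraph.equality)
    have "{pt (\<Phi> u v i) | u v i. (u, v) \<in> insert (a, b) E \<and> 0 < i \<and> i < L} =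
      {pt (\<Phi> u v i) | u v i. (u, v) \<in> E \<and> 0 < i \<and> i < L} \<union> {x i | i. 0 < i \<and> i < L}"
      unfolding x_def by blast
    then show "pverts \<lparr>pverts = pverts (partly_subdivided E) \<union> {x i | i. 0 < i \<and> i < L},
      parcs = (parcs (partly_subdivided E) - {(x 0, x L), (x L, x 0)}) \<union> {(x i, x (Suc i)) | i. i < L} \<union> {(x (Suc i), x i) | i. i < L}\<rparr>
      = pverts (partly_subdivided (insert (a, b) E))"
      unfolding partly_subdivided_def pair_pre_digraph.simps by (simp only: Un_assoc)
    have A: "{(pt (\<Phi> u v i), pt (\<Phi> u v (Suc i))) | u v i. (u, v) \<in> insert (a, b) E \<and> i < L} =
      {(pt (\<Phi> u v i), pt (\<Phi> u v (Suc i))) | u v i. (u, v) \<in> E \<and> i < L} \<union> {(x i, x (Suc i)) | i. i < L}"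
      unfolding x_def by blast
    have B: "{(pt (\<Phi> u v (Suc i)), pt (\<Phi> u v i)) | u v i. (u, v) \<in> insert (a, b) E \<and> i < L} =
      {(pt (\<Phi> u v (Suc i)), pt (\<Phi> u v i)) | u v i. (u, v) \<in> E \<and> i < L} \<union> {(x (Suc i), x i) | i. i < L}"
      unfolding x_def by blast
    have "(x 0, x L) \<notin> {(pt (\<Phi> u v i), pt (\<Phi> u v (Suc i))) | u v i. (u, v) \<in> E \<and> i < L}"
      "(x L, x 0) \<notin> {(pt (\<Phi> u v i), pt (\<Phi> u v (Suc i))) | u v i. (u, v) \<in> E \<and> i < L}"
      "(x 0, x L) \<notin> {(pt (\<Phi> u v (Suc i)), pt (\<Phi> u v i)) | u v i. (u, v) \<in> E \<and> i < L}"
      "(x L, x 0) \<notin> {(pt (\<Phi> u v (Suc i)), pt (\<Phi> u v i)) | u v i. (u, v) \<in> E \<and> i < L}"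
      using 2 by blast+
    moreover have "(P \<union> Q \<union> R) - {y, z} \<union> S \<union> T = (P - {y, z}) \<union> (Q \<union> S) \<union> (R \<union> T)"
      if "y \<notin> Q" "z \<notin> Q" "y \<notin> R" "z \<notin> R" for P Q R S T :: "(complex \<times> complex) set" and y z
      using that by blast
    ultimately show "parcs \<lparr>pverts = pverts (partly_subdivided E) \<union> {x i | i. 0 < i \<and> i < L},
      parcs = (parcs (partly_subdivided E) - {(x 0, x L), (x L, x 0)}) \<union> {(x i, x (Suc i)) | i. i < L} \<union> {(x (Suc i), x i) | i. i < L}\<rparr>
      = parcs (partly_subdivided (insert (a, b) E))"
      unfolding partly_subdivided_def pair_pre_digraph.simps A B 1[symmetric] by presburger
  qed simp
  then show ?thesis using * by simp
qed

text \<open>Comparing the values of an injection \<open>h\<close> into the naturals selects one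
  orientation per edge, so the induction over arcs subdivides every edge once.\<close>

lemma subdivision_drawn: "subdivision_pair copy drawn"
proof -
  obtain h :: "'a \<Rightarrow> nat" where h: "inj_on h (pverts G)"
    using finite_imp_inj_to_nat_seg[OF G.pair_finite_verts] by blast
  define E where "E = {(u, v). (u, v) \<in> parcs G \<and> h u < h v}"
  have E: "(u, v) \<in> E \<or> (v, u) \<in> E" if "(u, v) \<in> parcs G" for u v
    using that sym[OF that] wf[OF that] inj_on_eq_iff[OF h, of u v] irrefl
    by (cases "h u = h v") (auto simp: E_def)
  have EG: "E \<subseteq> parcs G" by (auto simp: E_def)
  have "subdivision_pair copy (partly_subdivided F)" if "finite F" "F \<subseteq> E" for F
    using that
  proof (induction F)
    case empty
    interpret C: pair_graph copy by (rule copy_pair_graph)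
    have "partly_subdivided {} = copy"
      by (rule pair_pre_digraph.equality) (auto simp: partly_subdivided_def copy_def image_iff)
    then show ?case using subdivision_pair_base C.pair_bidirected_digraph_axioms by simp
  next
    case (insert e F)
    obtain a b where e: "e = (a, b)" by (cases e)
    have "(a, b) \<in> E" using insert e by simp
    then have "(b, a) \<notin> F" using insert.prems by (auto simp: E_def)
    then show ?case using insert EG e partly_subdivided_insert[of a b F] by auto
  qed
  moreover have "finite E" using EG G.pair_finite_arcs finite_subset by blast
  ultimately have "subdivision_pair copy (partly_subdivided E)" by simp
  moreover have "partly_subdivided E = drawn"
  proof (rule pair_pre_digraph.equality)
    have "points (pverts G) \<subseteq> pverts (partly_subdivided E)"
    proof
      fix p assume "p \<in> points (pverts G)"
      then show "p \<in> pverts (partly_subdivided E)"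
      proof (cases rule: points_cases)
        case (1 w)
        then show ?thesis by (simp add: partly_subdivided_def copy_def)
      next
        case (2 u v i)
        consider "i = 0" | "i = L" | "0 < i" "i < L" using 2 by linarith
        then show ?thesis
        proof cases
          case 1
          then show ?thesis using 2 \<Phi>_0[OF 2(1)] wf[OF 2(1)] by (simp add: partly_subdivided_def copy_def)
        next
          case i: 2
          then show ?thesis using 2 \<Phi>_L[OF 2(1)] wf[OF 2(1)] by (simp add: partly_subdivided_def copy_def)
        next
          case i: 3
          have "p = pt (\<Phi> v u (L - i))" "0 < L - i" "L - i < L"
            using 2 i \<Phi>_rev[OF 2(1), of "L - i"] by simp_all
          then show ?thesis
            using E[OF 2(1)] 2 i unfolding partly_subdivided_def pair_pre_digraph.simps by blast
        qed
      qed
    qed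
    moreover have "pverts (partly_subdivided E) \<subseteq> points (pverts G)"
      unfolding partly_subdivided_def copy_def points_def pair_pre_digraph.simps
      using EG wf less_imp_le by blast
    ultimately show "pverts (partly_subdivided E) = pverts drawn" by (simp add: drawn_def)
    show "parcs (partly_subdivided E) = parcs drawn"
    proof (intro set_eqI iffI)
      fix e assume "e \<in> parcs (partly_subdivided E)"
      then consider u v i where "(u, v) \<in> E" "i < L" "e = (pt (\<Phi> u v i), pt (\<Phi> u v (Suc i)))"
        | u v i where "(u, v) \<in> E" "i < L" "e = (pt (\<Phi> u v (Suc i)), pt (\<Phi> u v i))"
        using E unfolding partly_subdivided_def pair_pre_digraph.simps by blast
      then show "e \<in> parcs drawn"
      proof cases
        case 1
        then show ?thesis using EG drawn_arc_iff by blast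
      next
        case 2
        then have "(pt (\<Phi> u v i), pt (\<Phi> u v (Suc i))) \<in> parcs drawn" using EG drawn_arc_iff by blast
        then show ?thesis using 2 D.arcs_symmetric by simp
      qed
    next
      fix e assume "e \<in> parcs drawn"
      moreover obtain p q where e: "e = (p, q)" by (cases e)
      ultimately obtain u v i where *: "(u, v) \<in> parcs G" "i < L" "p = pt (\<Phi> u v i)" "q = pt (\<Phi> u v (Suc i))"
        using drawn_arc_iff by blast
      have r: "L - Suc i < L" "p = pt (\<Phi> v u (Suc (L - Suc i)))" "q = pt (\<Phi> v u (L - Suc i))"
        using * \<Phi>_rev[OF *(1), of "L - i"] \<Phi>_rev[OF *(1), of "L - Suc i"] by (simp_all add: Suc_diff_Suc)
      from E[OF *(1)] show "e \<in> parcs (partly_subdivided E)"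
      proof
        assume "(u, v) \<in> E"
        then show ?thesis unfolding e partly_subdivided_def pair_pre_digraph.simps using * by blast
      next
        assume "(v, u) \<in> E"
        then show ?thesis unfolding e partly_subdivided_def pair_pre_digraph.simps using r by blast
      qed
    qed
  qed simp
  ultimately show ?thesis by simp
qed

lemma component_cop_number:
  fixes H :: "(complex, complex \<times> complex) pre_digraph"
  assumes H: "H \<in> pre_digraph.sccs (with_proj copy)" and H': "H' \<in> pre_digraph.sccs (with_proj drawn)"
    and sub: "verts H \<subseteq> verts H'"
  shows "cop_number H' \<in> {cop_number H, cop_number H + 1}"
proof -
  interpret C: pair_graph copy by (rule copy_pair_graph)
  note sH = C.scc_properties[OF H] and sH' = D.scc_properties[OF H']
  define g where "g = inv_into (pverts G) (\<lambda>w. pt (c w))"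
  have inj: "inj_on (\<lambda>w. pt (c w)) (pverts G)" using c_inj by (simp add: inj_on_def)
  have g_pt: "g (pt (c w)) = w" if "w \<in> pverts G" for w
    using inv_into_f_f[OF inj that] by (simp add: g_def)
  have vH: "verts H \<subseteq> (\<lambda>w. pt (c w)) ` pverts G" using sH(3) by (simp add: copy_def)
  have pt_g: "pt (c (g x)) = x" "g x \<in> pverts G" if "x \<in> verts H" for x
    using vH that g_pt by auto
  have arcs_copy: "(x, y) \<in> parcs copy \<longleftrightarrow> (g x, g y) \<in> parcs G" if "x \<in> verts H" "y \<in> verts H" for x y
  proof
    assume "(x, y) \<in> parcs copy"
    then obtain u v where uv: "(u, v) \<in> parcs G" "x = pt (c u)" "y = pt (c v)" by (auto simp: copy_def)
    then show "(g x, g y) \<in> parcs G" using g_pt wf[OF uv(1)] by simp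
  next
    assume "(g x, g y) \<in> parcs G"
    then have "(pt (c (g x)), pt (c (g y))) \<in> parcs copy" by (force simp: copy_def)
    then show "(x, y) \<in> parcs copy" using pt_g that by simp
  qed
  have H_adj: "x \<rightarrow>\<^bsub>H\<^esub> y \<longleftrightarrow> x \<in> verts H \<and> y \<in> verts H \<and> (g x, g y) \<in> parcs G" for x y
    using sH(4) arcs_copy by blast
  have gV: "g ` verts H \<subseteq> pverts G" using pt_g by blast
  have closed: "v \<in> g ` verts H" if uv: "(u, v) \<in> parcs G" "u \<in> g ` verts H" for u v
  proof -
    obtain x where x: "x \<in> verts H" "u = g x" using uv by blast
    have "(pt (c u), pt (c v)) \<in> parcs copy" using uv by (force simp: copy_def)
    then have "x \<rightarrow>\<^sup>*\<^bsub>copy\<^esub> pt (c v)" using x pt_g by auto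
    then have "pt (c v) \<in> verts H" using sH(5)[OF x(1)] by simp
    then show ?thesis using g_pt[OF wf(2)[OF uv(1)]] by (metis imageI)
  qed
  have pts: "verts H \<subseteq> points (g ` verts H)"
    using pt_g by (auto simp: points_def image_image)
  \<comment> \<open>\<open>sub\<close> singles out the component of \<open>drawn\<close> above
    \<open>H\<close>. It consists of the paths over \<open>H\<close>: all of them can be reached,
    and by \<open>points_closed\<close> no arc leaves them.\<close>
  have vH': "verts H' = points (g ` verts H)"
  proof -
    obtain x where x: "x \<in> verts H" using sH(2) by (auto simp: strongly_connected_def)
    have "q \<in> verts H'" if "q \<in> points (g ` verts H)" for q
      using reach_points[OF sH(1) gV sH(2) _ _ that, of x] H_adj sH'(5)[of x q] x pts sub by blast
    moreover have "q \<in> points (g ` verts H)" if "q \<in> verts H'" for q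
    proof -
      have "x \<rightarrow>\<^sup>*\<^bsub>drawn\<^esub> q" using sH'(5)[of x q] that x sub by blast
      then show ?thesis
      proof (induction rule: D.reachable_induct)
        case base
        then show ?case using x pts by blast
      next
        case (step y z)
        have "(y, z) \<in> parcs drawn" using step.hyps by simp
        from points_closed[OF gV closed step.IH this] show ?case .
      qed
    qed
    ultimately show ?thesis by blast
  qed
  have "inj_on g (verts H)" using pt_g by (intro inj_onI) metis
  from component_uniform[OF this gV H_adj closed vH' sH'(4)]
  interpret U: uniform_subdivision H H' "\<lambda>u. pt (c (g u))"
    "\<lambda>u v i. if u = v then pt (c (g u)) else pt (\<Phi> (g u) (g v) i)" L .
  show ?thesis using U.cop_number_subdivision sH(1,2) sH'(1,2) .
qed

lemma connected_cop_number:
  assumes "Digraph_Component.connected (with_proj G)"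
  shows "cop_number (with_proj drawn) \<in> {cop_number (with_proj G), cop_number (with_proj G) + 1}"
proof -
  have sc: "strongly_connected (with_proj G)"
    using G.symmetric_connected_imp_strongly_connected G.sym_arcs assms by blast
  interpret U: uniform_subdivision "with_proj G" "with_proj drawn" "\<lambda>u. pt (c u)"
    "\<lambda>u v i. if u = v then pt (c u) else pt (\<Phi> u v i)" L
    by (rule component_uniform[where g = "\<lambda>x. x"]) (use wf D.in_arcsD1 D.in_arcsD2 in \<open>auto simp: drawn_def\<close>)
  have ne: "points (pverts G) \<noteq> {}" using sc by (auto simp: strongly_connected_def points_def)
  have "p \<rightarrow>\<^sup>*\<^bsub>drawn\<^esub> q" if "p \<in> points (pverts G)" "q \<in> points (pverts G)" for p q
    using reach_points[OF G.wf_digraph _ sc, of "\<lambda>x. x" p q] that by simp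
  then have "strongly_connected (with_proj drawn)"
    using ne by (simp add: strongly_connected_def drawn_def)
  then show ?thesis using U.cop_number_subdivision[OF G.wf_digraph sc D.wf_digraph] by simp
qed

theorem fine_drawing_subdivision:
  "\<exists>r>0. \<exists>G0 G' :: complex pair_pre_digraph.
    digraph_iso (with_proj G) (with_proj G0) \<and>
    subdivision_pair G0 G' \<and>
    planar_geometric_graph r G' \<and>
    (Digraph_Component.connected (with_proj G) \<longrightarrow>
       cop_number (with_proj G') \<in> {cop_number (with_proj G), cop_number (with_proj G) + 1}) \<and>
    (\<forall>H \<in> pre_digraph.sccs (with_proj G0). \<forall>H' \<in> pre_digraph.sccs (with_proj G').
       verts H \<subseteq> verts H' \<longrightarrow> cop_number H' \<in> {cop_number H, cop_number H + 1})"
proof (intro exI conjI impI ballI)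
  show "(0 :: real) < 10" by simp
qed (fact copy_iso subdivision_drawn drawn_planar connected_cop_number component_cop_number)+

end

section \<open>Induced paths\<close>

text \<open>An induced path with \<open>n\<close> edges in the graph of closeness. Hiding the
  parametrization allows pieces to be glued by looking only at their point sets and ends.\<close>

definition ipath :: "(int \<times> int) set \<Rightarrow> int \<times> int \<Rightarrow> int \<times> int \<Rightarrow> nat \<Rightarrow> bool" where
  "ipath S a b n \<longleftrightarrow> (\<exists>f. f 0 = a \<and> f n = b \<and> S = f ` {..n} \<and> inj_on f {..n} \<and>
     (\<forall>i<n. close_pts (f i) (f (Suc i))) \<and>
     (\<forall>i\<le>n. \<forall>j\<le>n. close_pts (f i) (f j) \<longrightarrow> i = j \<or> i = Suc j \<or> j = Suc i))"

text \<open>The third bound is the comparison of the sum norm with the Euclidean norm: the square of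
  the sum is at most 200, which is less than \<open>15^2\<close>.\<close>

lemma close_ptsD:
  assumes "close_pts x y"
  shows "\<bar>fst x - fst y\<bar> \<le> 10" "\<bar>snd x - snd y\<bar> \<le> 10" "\<bar>fst x - fst y\<bar> + \<bar>snd x - snd y\<bar> \<le> 14"
proof -
  define a b where "a = fst x - fst y" and "b = snd x - snd y"
  have ab: "a\<^sup>2 + b\<^sup>2 \<le> 100" using assms by (simp add: close_pts_def a_def b_def)
  have "a\<^sup>2 \<le> 100" "b\<^sup>2 \<le> 100" using ab zero_le_power2[of a] zero_le_power2[of b] by linarith+
  then show "\<bar>fst x - fst y\<bar> \<le> 10" "\<bar>snd x - snd y\<bar> \<le> 10"
    unfolding a_def[symmetric] b_def[symmetric] using abs_le_square_iff[of a 10] abs_le_square_iff[of b 10] by simp_all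
  have "(\<bar>a\<bar> + \<bar>b\<bar>)\<^sup>2 + (\<bar>a\<bar> - \<bar>b\<bar>)\<^sup>2 = 2 * (a\<^sup>2 + b\<^sup>2)"
    by (simp add: power2_sum power2_diff)
  moreover have "s \<le> 200" if "s + t = 2 * u" "u \<le> 100" "0 \<le> t" for s t u :: int using that by linarith
  ultimately have "(\<bar>a\<bar> + \<bar>b\<bar>)\<^sup>2 \<le> 200" using ab zero_le_power2[of "\<bar>a\<bar> - \<bar>b\<bar>"] by blast
  then have "(\<bar>a\<bar> + \<bar>b\<bar>)\<^sup>2 < 15\<^sup>2" by simp
  then have "\<bar>a\<bar> + \<bar>b\<bar> < 15" using power2_less_imp_less[of "\<bar>a\<bar> + \<bar>b\<bar>" 15] by simp
  then show "\<bar>fst x - fst y\<bar> + \<bar>snd x - snd y\<bar> \<le> 14" by (simp add: a_def b_def)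
qed

lemma ipath_ends: "ipath S a b n \<Longrightarrow> a \<in> S" "ipath S a b n \<Longrightarrow> b \<in> S"
  unfolding ipath_def by auto

lemma ipath_single: "ipath {a} a a 0"
  unfolding ipath_def by (intro exI[of _ "\<lambda>_. a"]) auto

lemma ipath_edge: "close_pts a b \<Longrightarrow> a \<noteq> b \<Longrightarrow> ipath {a, b} a b 1"
  unfolding ipath_def
  by (intro exI[of _ "\<lambda>i::nat. if i = 0 then a else b"]) (auto simp: inj_on_def le_Suc_eq)

text \<open>Closeness between the two parts always involves the joint \<open>b\<close>, so no
  shortcut arises and the union is again induced.\<close>

lemma ipath_concat:
  assumes S: "ipath S a b n" and T: "ipath T b c k"
    and sep: "\<And>x y. x \<in> S \<Longrightarrow> y \<in> T \<Longrightarrow> close_pts x y \<Longrightarrow> x = b \<or> y = b"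
  shows "ipath (S \<union> T) a c (n + k)"
proof -
  obtain f where f: "f 0 = a" "f n = b" "S = f ` {..n}" "inj_on f {..n}" "\<And>i. i < n \<Longrightarrow> close_pts (f i) (f (Suc i))"
    "\<And>i j. i \<le> n \<Longrightarrow> j \<le> n \<Longrightarrow> close_pts (f i) (f j) \<Longrightarrow> i = j \<or> i = Suc j \<or> j = Suc i"
    using S unfolding ipath_def by blast
  obtain g where g: "g 0 = b" "g k = c" "T = g ` {..k}" "inj_on g {..k}" "\<And>i. i < k \<Longrightarrow> close_pts (g i) (g (Suc i))"
    "\<And>i j. i \<le> k \<Longrightarrow> j \<le> k \<Longrightarrow> close_pts (g i) (g j) \<Longrightarrow> i = j \<or> i = Suc j \<or> j = Suc i"
    using T unfolding ipath_def by blast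
  define h where "h i = (if i \<le> n then f i else g (i - n))" for i
  have hf: "h i = f i" if "i \<le> n" for i using that by (simp add: h_def)
  have hg: "h (n + i) = g i" for i using f g by (cases i) (auto simp: h_def)
  have cross: "i = n \<or> j = 0" if "i \<le> n" "j \<le> k" "close_pts (f i) (g j)" for i j
  proof -
    have "f i \<in> S" "g j \<in> T" unfolding f(3) g(3) using that(1,2) by simp_all
    then have "f i = b \<or> g j = b" using that(3) by (rule sep)
    then have "f i = f n \<or> g j = g 0" unfolding f(2) g(1) .
    then show ?thesis using inj_onD[OF f(4), of i n] inj_onD[OF g(4), of j 0] that by auto
  qed
  have adj: "i = j \<or> i = Suc j \<or> j = Suc i" if "i \<le> j" "j \<le> n + k" "close_pts (h i) (h j)" for i j
  proof -
    consider "j \<le> n" | "i \<ge> n" | "i < n" "n < j" using that by linarith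
    then show ?thesis
    proof cases
      case 1
      show ?thesis
        by (rule f(6)) (use that 1 hf[of i] hf[of j] in simp_all)
    next
      case 2
      define i' j' where "i' = i - n" and "j' = j - n"
      then have ij: "i = n + i'" "j = n + j'" using 2 that(1) by simp_all
      have "i' = j' \<or> i' = Suc j' \<or> j' = Suc i'"
        by (rule g(6)) (use that(2,3) that(1) in \<open>simp_all add: ij hg\<close>)
      then show ?thesis by (auto simp: ij)
    next
      case 3
      define j' where "j' = j - n"
      then have j': "j = n + j'" "0 < j'" using 3 by simp_all
      have "i = n \<or> j' = 0"
        by (rule cross) (use that(2,3) 3 hf[of i] hg[of j'] in \<open>simp_all add: j'(1)\<close>)
      then show ?thesis using 3 j'(2) by simp
    qed
  qed
  have "S \<union> T = h ` {..n + k}"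
  proof (intro equalityI subsetI)
    fix x assume "x \<in> S \<union> T"
    then consider i where "i \<le> n" "x = f i" | i where "i \<le> k" "x = g i" unfolding f(3) g(3) by blast
    then show "x \<in> h ` {..n + k}"
    proof cases
      case 1
      then have "x = h i" "i \<le> n + k" by (simp_all add: hf)
      then show ?thesis by blast
    next
      case 2
      then have "x = h (n + i)" "n + i \<le> n + k" by (simp_all add: hg)
      then show ?thesis by blast
    qed
  next
    fix x assume "x \<in> h ` {..n + k}"
    then obtain i where i: "i \<le> n + k" "x = h i" by blast
    then show "x \<in> S \<union> T" unfolding f(3) g(3) by (cases "i \<le> n") (auto simp: h_def)
  qed
  \<comment> \<open>Equal points are close, so by \<open>adj\<close> only neighbouring indices could
    coincide, and these lie in one of the two parts.\<close>
  moreover have "inj_on h {..n + k}"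
  proof (rule linorder_inj_onI')
    fix i j assume "i \<in> {..n + k}" "j \<in> {..n + k}" "i < j"
    show "h i \<noteq> h j"
    proof
      assume eq: "h i = h j"
      then have "close_pts (h i) (h j)" by simp
      then have "i = j \<or> i = Suc j \<or> j = Suc i"
        using \<open>i < j\<close> \<open>j \<in> _\<close> by (intro adj) simp_all
      then have j: "j = Suc i" using \<open>i < j\<close> by simp
      show False
      proof (cases "i < n")
        case True
        then show False using eq j inj_onD[OF f(4), of i "Suc i"] by (simp add: hf)
      next
        case False
        then have "i = n + (i - n)" by simp
        then obtain i' where i': "i = n + i'" by blast
        then have "g i' = g (Suc i')" using eq j hg[of i'] hg[of "Suc i'"] by simp
        then show False using inj_onD[OF g(4), of i' "Suc i'"] i' j \<open>j \<in> _\<close> by simp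
      qed
    qed
  qed
  moreover have "close_pts (h i) (h (Suc i))" if "i < n + k" for i
  proof (cases "i < n")
    case True
    then show ?thesis using f(5)[of i] by (simp add: hf)
  next
    case False
    then have "i = n + (i - n)" by simp
    then obtain i' where i': "i = n + i'" by blast
    then show ?thesis using g(5)[of i'] that hg[of i'] hg[of "Suc i'"] by simp
  qed
  moreover have "i = j \<or> i = Suc j \<or> j = Suc i" if "i \<le> n + k" "j \<le> n + k" "close_pts (h i) (h j)" for i j
    using adj[of i j] adj[of j i] that close_sym by (cases "i \<le> j") auto
  ultimately show ?thesis
    unfolding ipath_def using hf[of 0] hg[of k] f(1) g(2) by (intro exI[of _ h]) simp
qed

lemma ipath_rev: "ipath S a b n \<Longrightarrow> ipath S b a n"
proof -
  assume "ipath S a b n"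
  then obtain f where f: "f 0 = a" "f n = b" "S = f ` {..n}" "inj_on f {..n}" "\<And>i. i < n \<Longrightarrow> close_pts (f i) (f (Suc i))"
    "\<And>i j. i \<le> n \<Longrightarrow> j \<le> n \<Longrightarrow> close_pts (f i) (f j) \<Longrightarrow> i = j \<or> i = Suc j \<or> j = Suc i"
    unfolding ipath_def by blast
  have "S = (\<lambda>i. f (n - i)) ` {..n}"
  proof -
    have "(\<lambda>i. n - i) ` {..n} = {..n}"
      by (auto simp: image_iff) (metis diff_diff_cancel diff_le_self atMost_iff)
    then show ?thesis using f(3) by (metis image_image)
  qed
  moreover have "inj_on (\<lambda>i. f (n - i)) {..n}"
    using f(4) by (fastforce simp: inj_on_def)
  moreover have "close_pts (f (n - i)) (f (n - Suc i))" if "i < n" for i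
    using f(5)[of "n - Suc i"] that by (simp add: Suc_diff_Suc close_sym)
  moreover have "i = j \<or> i = Suc j \<or> j = Suc i" if "i \<le> n" "j \<le> n" "close_pts (f (n - i)) (f (n - j))" for i j
    using f(6)[OF _ _ that(3)] that(1,2) by auto
  ultimately show ?thesis
    unfolding ipath_def using f(1,2) by (intro exI[of _ "\<lambda>i. f (n - i)"]) simp
qed

lemma ipath_image:
  assumes "ipath S a b n" and h: "\<And>x y. close_pts (h x) (h y) \<longleftrightarrow> close_pts x y" "inj h"
  shows "ipath (h ` S) (h a) (h b) n"
proof -
  obtain f where f: "f 0 = a" "f n = b" "S = f ` {..n}" "inj_on f {..n}" "\<And>i. i < n \<Longrightarrow> close_pts (f i) (f (Suc i))"
    "\<And>i j. i \<le> n \<Longrightarrow> j \<le> n \<Longrightarrow> close_pts (f i) (f j) \<Longrightarrow> i = j \<or> i = Suc j \<or> j = Suc i"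
    using assms(1) unfolding ipath_def by blast
  have "inj_on (\<lambda>i. h (f i)) {..n}" using inj_on_eq_iff[OF f(4)] injD[OF h(2)] by (intro inj_onI) blast
  then show ?thesis
    unfolding ipath_def using f h(1) by (intro exI[of _ "\<lambda>i. h (f i)"]) (simp add: image_image)
qed

definition straight :: "int \<times> int \<Rightarrow> int \<times> int \<Rightarrow> nat \<Rightarrow> (int \<times> int) set" where
  "straight a d n = {(fst a + 10 * int k * fst d, snd a + 10 * int k * snd d) | k. k \<le> n}"

definition unit_vectors :: "(int \<times> int) set" where
  "unit_vectors = {(1, 0), (-1, 0), (0, 1), (0, -1)}"

lemma unit_vectors_cases:
  assumes "d \<in> unit_vectors"
  obtains "fst d = 1" "snd d = 0" | "fst d = -1" "snd d = 0" | "fst d = 0" "snd d = 1" | "fst d = 0" "snd d = -1"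
  using assms by (auto simp: unit_vectors_def)

lemma ipath_straight:
  assumes d: "d \<in> unit_vectors"
  shows "ipath (straight a d n) a (fst a + 10 * int n * fst d, snd a + 10 * int n * snd d) n"
proof (induction n)
  case 0
  then show ?case using ipath_single[of a] by (simp add: straight_def)
next
  case (Suc n)
  define p where "p k = (fst a + 10 * int k * fst d, snd a + 10 * int k * snd d)" for k
  have diff: "fst (p k) - fst (p l) = 10 * (int k - int l) * fst d" "snd (p k) - snd (p l) = 10 * (int k - int l) * snd d" for k l
    by (simp_all add: p_def algebra_simps)
  have neq: "p k \<noteq> p l" if "k < l" for k l
    using d
  proof (cases rule: unit_vectors_cases)
    case 1 then show ?thesis using diff(1)[of k l] that by auto
  next
    case 2 then show ?thesis using diff(1)[of k l] that by auto
  next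
    case 3 then show ?thesis using diff(2)[of k l] that by auto
  next
    case 4 then show ?thesis using diff(2)[of k l] that by auto
  qed
  have far: "\<not> close_pts (p k) (p l)" if "Suc k < l" for k l
  proof
    assume "close_pts (p k) (p l)"
    note D = close_ptsD(1,2)[OF this] diff[of k l]
    from d show False
      by (cases rule: unit_vectors_cases) (use D that in simp_all)
  qed
  have edge: "ipath {p n, p (Suc n)} (p n) (p (Suc n)) 1"
  proof (rule ipath_edge)
    from d show "close_pts (p n) (p (Suc n))"
      by (cases rule: unit_vectors_cases) (simp_all add: close_pts_def diff)
    show "p n \<noteq> p (Suc n)" using neq by simp
  qed
  have S: "straight a d m = p ` {..m}" for m
    unfolding straight_def p_def by blast
  have sep: "x = p n \<or> y = p n" if "x \<in> straight a d n" "y \<in> {p n, p (Suc n)}" "close_pts x y" for x y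
    using that far[of _ "Suc n"] unfolding S by (auto simp: le_less)
  have "ipath (straight a d n \<union> {p n, p (Suc n)}) a (p (Suc n)) (n + 1)"
    by (rule ipath_concat[OF Suc[folded p_def] edge sep])
  moreover have "straight a d n \<union> {p n, p (Suc n)} = straight a d (Suc n)"
    unfolding S by (auto simp: le_Suc_eq)
  ultimately show ?case unfolding p_def by simp
qed

section \<open>Paths of prescribed length near a segment\<close>

text \<open>One tooth of a comb. It lengthens four straight steps by \<open>2 * h\<close>; its two
  legs are 20 apart and hence not close.\<close>

lemma ipath_bump:
  "ipath (straight (x, 0) (1, 0) 1 \<union> straight (x + 10, 0) (0, 1) h \<union> straight (x + 10, 10 * int h) (1, 0) 2
     \<union> straight (x + 30, 0) (0, 1) h \<union> straight (x + 30, 0) (1, 0) 1) (x, 0) (x + 40, 0) (4 + 2 * h)"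
proof -
  have 1: "ipath (straight (x, 0) (1, 0) 1) (x, 0) (x + 10, 0) 1"
    using ipath_straight[of "(1, 0)" "(x, 0)" 1] by (simp add: unit_vectors_def)
  have 2: "ipath (straight (x + 10, 0) (0, 1) h) (x + 10, 0) (x + 10, 10 * int h) h"
    using ipath_straight[of "(0, 1)" "(x + 10, 0)" h] by (simp add: unit_vectors_def)
  have 3: "ipath (straight (x + 10, 10 * int h) (1, 0) 2) (x + 10, 10 * int h) (x + 30, 10 * int h) 2"
    using ipath_straight[of "(1, 0)" "(x + 10, 10 * int h)" 2] by (simp add: unit_vectors_def add.commute)
  have 4: "ipath (straight (x + 30, 0) (0, 1) h) (x + 30, 10 * int h) (x + 30, 0) h"
    using ipath_rev[OF ipath_straight[of "(0, 1)" "(x + 30, 0)" h]] by (simp add: unit_vectors_def)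
  have 5: "ipath (straight (x + 30, 0) (1, 0) 1) (x + 30, 0) (x + 40, 0) 1"
    using ipath_straight[of "(1, 0)" "(x + 30, 0)" 1] by (simp add: unit_vectors_def add.commute)
  have k1: "k \<le> 1 \<longleftrightarrow> k = 0 \<or> k = 1" and k2: "k \<le> 2 \<longleftrightarrow> k = 0 \<or> k = 1 \<or> k = 2" for k :: nat
    by auto
  have A: "p \<in> straight (y, 0) (1, 0) 1 \<longleftrightarrow> p = (y, 0) \<or> p = (y + 10, 0)" for p y
    unfolding straight_def mem_Collect_eq k1 ex_disj_distrib conj_disj_distribL by simp
  have B: "p \<in> straight (y, z) (1, 0) 2 \<longleftrightarrow> p = (y, z) \<or> p = (y + 10, z) \<or> p = (y + 20, z)" for p y z
    unfolding straight_def mem_Collect_eq k2 ex_disj_distrib conj_disj_distribL by simp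
  have C: "p \<in> straight (y, 0) (0, 1) h \<longleftrightarrow> (\<exists>k\<le>h. p = (y, 10 * int k))" for p y
    unfolding straight_def by auto
  have 12: "ipath (straight (x, 0) (1, 0) 1 \<union> straight (x + 10, 0) (0, 1) h) (x, 0) (x + 10, 10 * int h) (1 + h)"
  proof (rule ipath_concat[OF 1 2])
    fix p q assume p: "p \<in> straight (x, 0) (1, 0) 1" and q: "q \<in> straight (x + 10, 0) (0, 1) h" and "close_pts p q"
    from q obtain k where "q = (x + 10, 10 * int k)" unfolding C by blast
    then show "p = (x + 10, 0) \<or> q = (x + 10, 0)"
      using p[unfolded A] close_ptsD(3)[OF \<open>close_pts p q\<close>] by auto
  qed
  have 123: "ipath (straight (x, 0) (1, 0) 1 \<union> straight (x + 10, 0) (0, 1) h \<union> straight (x + 10, 10 * int h) (1, 0) 2)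
     (x, 0) (x + 30, 10 * int h) (1 + h + 2)"
  proof (rule ipath_concat[OF 12 3])
    fix p q assume p: "p \<in> straight (x, 0) (1, 0) 1 \<union> straight (x + 10, 0) (0, 1) h"
      and q: "q \<in> straight (x + 10, 10 * int h) (1, 0) 2" and "close_pts p q"
    from p have "p = (x, 0) \<or> (\<exists>k\<le>h. p = (x + 10, 10 * int k))" unfolding Un_iff A C by force
    then show "p = (x + 10, 10 * int h) \<or> q = (x + 10, 10 * int h)"
      using q[unfolded B] close_ptsD(3)[OF \<open>close_pts p q\<close>] by auto
  qed
  have 1234: "ipath (straight (x, 0) (1, 0) 1 \<union> straight (x + 10, 0) (0, 1) h \<union> straight (x + 10, 10 * int h) (1, 0) 2
     \<union> straight (x + 30, 0) (0, 1) h) (x, 0) (x + 30, 0) (1 + h + 2 + h)"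
  proof (rule ipath_concat[OF 123 4])
    fix p q assume p: "p \<in> straight (x, 0) (1, 0) 1 \<union> straight (x + 10, 0) (0, 1) h \<union> straight (x + 10, 10 * int h) (1, 0) 2"
      and q: "q \<in> straight (x + 30, 0) (0, 1) h" and "close_pts p q"
    from p have "fst p \<le> x + 10 \<or> p = (x + 20, 10 * int h) \<or> p = (x + 30, 10 * int h)" unfolding Un_iff A B C by auto
    moreover from q obtain k where "k \<le> h" "q = (x + 30, 10 * int k)" unfolding C by blast
    ultimately show "p = (x + 30, 10 * int h) \<or> q = (x + 30, 10 * int h)"
      using close_ptsD(1,3)[OF \<open>close_pts p q\<close>] by auto
  qed
  have "ipath (straight (x, 0) (1, 0) 1 \<union> straight (x + 10, 0) (0, 1) h \<union> straight (x + 10, 10 * int h) (1, 0) 2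
     \<union> straight (x + 30, 0) (0, 1) h \<union> straight (x + 30, 0) (1, 0) 1) (x, 0) (x + 40, 0) (1 + h + 2 + h + 1)"
  proof (rule ipath_concat[OF 1234 5])
    fix p q assume p: "p \<in> straight (x, 0) (1, 0) 1 \<union> straight (x + 10, 0) (0, 1) h \<union> straight (x + 10, 10 * int h) (1, 0) 2
       \<union> straight (x + 30, 0) (0, 1) h"
      and q: "q \<in> straight (x + 30, 0) (1, 0) 1" and "close_pts p q"
    from p have "fst p \<le> x + 20 \<or> (\<exists>k. p = (x + 30, 10 * int k))" unfolding Un_iff A B C by auto
    then show "p = (x + 30, 0) \<or> q = (x + 30, 0)"
      using q[unfolded A] close_ptsD(1,3)[OF \<open>close_pts p q\<close>] by auto
  qed
  moreover have "1 + h + 2 + h + 1 = 4 + 2 * h" by simp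
  ultimately show ?thesis by (simp only:)
qed

text \<open>Filling the teeth greedily, each up to height \<open>H\<close>, absorbs every detour up
  to \<open>B * H\<close>. The clauses about the two ends ensure that only the end points are close
  to whatever is attached there.\<close>

lemma ipath_comb:
  assumes "j \<le> B * H"
  shows "\<exists>S. ipath S (x, 0) (x + 40 * int B, 0) (4 * B + 2 * j) \<and>
    (\<forall>p\<in>S. x \<le> fst p \<and> fst p \<le> x + 40 * int B \<and> 0 \<le> snd p \<and> snd p \<le> 10 * int H \<and>
       (p = (x, 0) \<or> x + 10 \<le> fst p) \<and> (p = (x + 40 * int B, 0) \<or> fst p \<le> x + 40 * int B - 10))"
  using assms
proof (induction B arbitrary: x j)
  case 0
  then show ?case using ipath_single[of "(x, 0)"] by (intro exI[of _ "{(x, 0)}"]) simp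
next
  case (Suc B)
  define h where "h = min j H"
  have "j - h \<le> B * H" "h \<le> j" "h \<le> H" using Suc.prems by (auto simp: h_def)
  from Suc.IH[OF this(1), of "x + 40"] obtain S where
    S: "ipath S (x + 40, 0) (x + 40 + 40 * int B, 0) (4 * B + 2 * (j - h))"
    and S_reg: "\<And>p. p \<in> S \<Longrightarrow> x + 40 \<le> fst p \<and> fst p \<le> x + 40 + 40 * int B \<and> 0 \<le> snd p \<and> snd p \<le> 10 * int H \<and>
       (p = (x + 40, 0) \<or> x + 40 + 10 \<le> fst p) \<and> (p = (x + 40 + 40 * int B, 0) \<or> fst p \<le> x + 40 + 40 * int B - 10)" by blast
  define T where "T = straight (x, 0) (1, 0) 1 \<union> straight (x + 10, 0) (0, 1) h \<union> straight (x + 10, 10 * int h) (1, 0) 2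
     \<union> straight (x + 30, 0) (0, 1) h \<union> straight (x + 30, 0) (1, 0) 1"
  have T: "ipath T (x, 0) (x + 40, 0) (4 + 2 * h)"
    unfolding T_def by (rule ipath_bump)
  have T_reg: "x \<le> fst p \<and> fst p \<le> x + 40 \<and> 0 \<le> snd p \<and> snd p \<le> 10 * int H \<and>
      (p = (x, 0) \<or> x + 10 \<le> fst p) \<and> (p = (x + 40, 0) \<or> fst p \<le> x + 30)" if "p \<in> T" for p
  proof -
    from that obtain k :: nat where "k \<le> 1 \<and> p = (x + 10 * int k, 0) \<or> k \<le> h \<and> p = (x + 10, 10 * int k) \<or>
      k \<le> 2 \<and> p = (x + 10 + 10 * int k, 10 * int h) \<or> k \<le> h \<and> p = (x + 30, 10 * int k) \<or> k \<le> 1 \<and> p = (x + 30 + 10 * int k, 0)"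
      unfolding T_def straight_def Un_iff mem_Collect_eq fst_conv snd_conv by (simp, blast)
    then show ?thesis
      using \<open>h \<le> H\<close> by (elim disjE conjE) (cases "k = 0"; simp)+
  qed
  have "ipath (T \<union> S) (x, 0) (x + 40 + 40 * int B, 0) (4 + 2 * h + (4 * B + 2 * (j - h)))"
  proof (rule ipath_concat[OF T S])
    fix p q assume "p \<in> T" "q \<in> S" and cl: "close_pts p q"
    then show "p = (x + 40, 0) \<or> q = (x + 40, 0)"
      using T_reg[of p] S_reg[of q] close_ptsD(1)[OF cl] by auto
  qed
  moreover have "4 + 2 * h + (4 * B + 2 * (j - h)) = 4 * Suc B + 2 * j" using \<open>h \<le> j\<close> by simp
  moreover have "x + 40 + 40 * int B = x + 40 * int (Suc B)" by simp
  ultimately have "ipath (T \<union> S) (x, 0) (x + 40 * int (Suc B), 0) (4 * Suc B + 2 * j)" by (simp only:)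
  moreover have "x \<le> fst p \<and> fst p \<le> x + 40 * int (Suc B) \<and> 0 \<le> snd p \<and> snd p \<le> 10 * int H \<and>
       (p = (x, 0) \<or> x + 10 \<le> fst p) \<and> (p = (x + 40 * int (Suc B), 0) \<or> fst p \<le> x + 40 * int (Suc B) - 10)"
    if "p \<in> T \<union> S" for p
  proof (cases "p \<in> S")
    case True
    then show ?thesis using S_reg[OF True] by (auto simp: prod_eq_iff)
  next
    case False
    then show ?thesis using that T_reg[of p] ipath_ends(1)[OF S] by (cases "B = 0") auto
  qed
  ultimately show ?case by blast
qed

text \<open>In the square on its diagonal, the segment from \<open>(0, 0)\<close> to \<open>(M, 0)\<close> may be replaced by a path in
  this region. The squares on different edges of a square grid overlap in corners only.\<close>

definition block_region :: "int \<Rightarrow> int \<times> int \<Rightarrow> bool" where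
  "block_region M p \<longleftrightarrow> \<bar>2 * fst p - M\<bar> + 2 * \<bar>snd p\<bar> \<le> M - 40 \<or> snd p = 0 \<and> fst p \<in> {0, 10, M - 10, M}"

text \<open>The number of teeth depends on \<open>K\<close> alone, while their height grows with
  \<open>m\<close>; so a large block absorbs \<open>K * m\<close> although the comb takes up only a
  bounded number of steps along the edge.\<close>

lemma ipath_block:
  "\<exists>m0. \<forall>m\<ge>m0. \<forall>j\<le>K * m. \<exists>S. ipath S (0, 0) (10 * int m, 0) (m + 2 * j) \<and> (\<forall>p\<in>S. block_region (10 * int m) p)"
\<comment> \<open>As \<open>H\<close> is at most \<open>m / 6\<close>, this bound leaves room for
  the \<open>4 * B\<close> steps of the comb between two margins of more than \<open>H\<close>
  steps. It also gives \<open>5 * K \<le> 6 * H\<close>, which \<open>K * m \<le> B * H\<close>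
  requires.\<close>
proof (rule exI[of _ "36 * K + 100"], intro allI impI)
  define B where "B = 6 * K + 6"
  fix m j :: nat
  assume m: "m \<ge> 36 * K + 100" and j: "j \<le> K * m"
  define H where "H = m div 6"
  have H6: "6 * H \<le> m" "m \<le> 6 * H + 5" by (simp_all add: H_def)
  have "K * m \<le> B * H"
  proof -
    have "K * m \<le> K * (6 * H + 5)" using H6(2) by (rule mult_le_mono2)
    also have "\<dots> \<le> B * H"
    proof -
      have "5 * K \<le> 6 * H" using m H6 by linarith
      then show ?thesis by (simp add: B_def algebra_simps)
    qed
    finally show ?thesis .
  qed
  then have jB: "j \<le> B * H" using j by simp
  \<comment> \<open>Teeth of height \<open>10 * H\<close> that begin at \<open>10 * H + 20\<close>
    lie in the diamond shrunk by 40.\<close>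
  define a where "a = H + 2"
  have "2 * H + 24 * K + 30 \<le> m" using m H6(1) by linarith
  then have B4: "a + 4 * B + a + 2 \<le> m" unfolding a_def B_def by simp
  define e where "e = m - (a + 4 * B)"
  from ipath_comb[OF jB, of "10 * int a"]
  obtain S where S: "ipath S (10 * int a, 0) (10 * int a + 40 * int B, 0) (4 * B + 2 * j)"
    and reg: "\<forall>p\<in>S. 10 * int a \<le> fst p \<and> fst p \<le> 10 * int a + 40 * int B \<and> 0 \<le> snd p \<and> snd p \<le> 10 * int H \<and>
       (p = (10 * int a, 0) \<or> 10 * int a + 10 \<le> fst p) \<and> (p = (10 * int a + 40 * int B, 0) \<or> fst p \<le> 10 * int a + 40 * int B - 10)"
    by (elim exE conjE)
  note S_reg = bspec[OF reg]
  define A where "A = straight (0, 0) (1, 0) a"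
  define C where "C = straight (10 * int a + 40 * int B, 0) (1, 0) e"
  have em: "10 * int a + 40 * int B + 10 * int e = 10 * int m" using B4 by (simp add: e_def)
  have A: "ipath A (0, 0) (10 * int a, 0) a"
    using ipath_straight[of "(1, 0)" "(0, 0)" a] by (simp add: A_def unit_vectors_def)
  have C: "ipath C (10 * int a + 40 * int B, 0) (10 * int m, 0) e"
    using ipath_straight[of "(1, 0)" "(10 * int a + 40 * int B, 0)" e] em by (simp add: C_def unit_vectors_def)
  have A_reg: "\<exists>k. p = (10 * int k, 0) \<and> k \<le> a" if "p \<in> A" for p
    using that unfolding A_def straight_def by simp
  have C_reg: "\<exists>k. p = (10 * int a + 40 * int B + 10 * int k, 0) \<and> k \<le> e" if "p \<in> C" for p
    using that unfolding C_def straight_def by simp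
  have AS: "ipath (A \<union> S) (0, 0) (10 * int a + 40 * int B, 0) (a + (4 * B + 2 * j))"
  proof (rule ipath_concat[OF A S])
    fix p q assume p: "p \<in> A" and q: "q \<in> S" and cl: "close_pts p q"
    obtain k where k: "k \<le> a" "p = (10 * int k, 0)" using A_reg[OF p] by blast
    show "p = (10 * int a, 0) \<or> q = (10 * int a, 0)"
    proof (cases "k = a")
      case False
      then have "fst p \<le> 10 * int a - 10" using k by simp
      then show ?thesis using S_reg[OF q] close_ptsD(1)[OF cl] by linarith
    qed (use k in simp)
  qed
  have "ipath (A \<union> S \<union> C) (0, 0) (10 * int m, 0) (a + (4 * B + 2 * j) + e)"
  proof (rule ipath_concat[OF AS C])
    fix p q assume p: "p \<in> A \<union> S" and q: "q \<in> C" and cl: "close_pts p q"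
    obtain k where k: "k \<le> e" "q = (10 * int a + 40 * int B + 10 * int k, 0)" using C_reg[OF q] by blast
    have "p = (10 * int a + 40 * int B, 0) \<or> fst p \<le> 10 * int a + 40 * int B - 10"
    proof (cases "p \<in> S")
      case True
      then show ?thesis using S_reg by blast
    next
      case False
      then have "p \<in> A" using p by blast
      then obtain l where l: "l \<le> a" "p = (10 * int l, 0)" using A_reg by blast
      have "l \<noteq> a" using l False ipath_ends(1)[OF S] by auto
      then show ?thesis using l by simp
    qed
    then show "p = (10 * int a + 40 * int B, 0) \<or> q = (10 * int a + 40 * int B, 0)"
      using close_ptsD(1)[OF cl] k by (cases "k = 0") auto
  qed
  moreover have "a + (4 * B + 2 * j) + e = m + 2 * j" using B4 by (simp add: e_def)
  moreover have "block_region (10 * int m) p" if pm: "p \<in> A \<union> S \<union> C" for p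
  proof -
    have B4': "int a + 4 * int B + int a + 2 \<le> int m" using B4 by linarith
    have axis: "block_region (10 * int m) (10 * int k, 0)" if "k \<le> m" for k
    proof (cases "k \<le> 1 \<or> m - 1 \<le> k")
      case True
      then have "k = 0 \<or> k = 1 \<or> k = m \<or> int k = int m - 1" using that by linarith
      then show ?thesis by (auto simp: block_region_def)
    qed (use that in \<open>auto simp: block_region_def\<close>)
    consider "p \<in> A" | "p \<in> S" | "p \<in> C" using pm by blast
    then show ?thesis
    proof cases
      case 1
      then obtain k where k: "k \<le> a" "p = (10 * int k, 0)" using A_reg by blast
      moreover have "k \<le> m" using k B4 by linarith
      ultimately show ?thesis using axis by blast
    next
      case 2
      have "int a = int H + 2" by (simp add: a_def)
      then show ?thesis using S_reg[OF 2] B4' unfolding block_region_def by linarith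
    next
      case 3
      then obtain k where k: "k \<le> e" "p = (10 * int a + 40 * int B + 10 * int k, 0)" using C_reg by blast
      then have "p = (10 * int (a + 4 * B + k), 0)" by simp
      moreover have "a + 4 * B + k \<le> m" using k B4 by (simp add: e_def)
      ultimately show ?thesis using axis by blast
    qed
  qed
  ultimately show "\<exists>S. ipath S (0, 0) (10 * int m, 0) (m + 2 * j) \<and> (\<forall>p\<in>S. block_region (10 * int m) p)"
    by (metis (no_types, lifting))
qed

subsection \<open>Separation of blocks\<close>

text \<open>With points read as complex numbers this is \<open>M * z + d * p\<close>, a rotation by
  the unit \<open>d\<close> followed by a shift.\<close>

definition block_map :: "int \<Rightarrow> int \<times> int \<Rightarrow> int \<times> int \<Rightarrow> int \<times> int \<Rightarrow> int \<times> int" where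
  "block_map M z d p = (M * fst z + fst p * fst d - snd p * snd d, M * snd z + fst p * snd d + snd p * fst d)"

definition scale_pt :: "int \<Rightarrow> int \<times> int \<Rightarrow> int \<times> int" where
  "scale_pt M z = (M * fst z, M * snd z)"

lemma block_map_close:
  assumes "d \<in> unit_vectors"
  shows "close_pts (block_map M z d p) (block_map M z d q) \<longleftrightarrow> close_pts p q" "inj (block_map M z d)"
    "block_map M z d (0, 0) = scale_pt M z" "block_map M z d (M, 0) = scale_pt M (z + d)"
proof -
  from assms show "close_pts (block_map M z d p) (block_map M z d q) \<longleftrightarrow> close_pts p q"
    by (cases rule: unit_vectors_cases)
      (simp_all add: close_pts_def block_map_def power2_commute add.commute)
  from assms show "inj (block_map M z d)"
    by (cases rule: unit_vectors_cases) (auto simp: inj_def block_map_def)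
  show "block_map M z d (0, 0) = scale_pt M z" "block_map M z d (M, 0) = scale_pt M (z + d)"
    by (simp_all add: block_map_def scale_pt_def algebra_simps)
qed

lemma block_region_cases:
  assumes "block_region M p"
  obtains "\<bar>2 * fst p - M\<bar> + 2 * \<bar>snd p\<bar> \<le> M - 40" | "p = (0, 0)" | "p = (M, 0)" | "p = (10, 0)" | "p = (M - 10, 0)"
  using assms by (cases p) (auto simp: block_region_def)

text \<open>The half turn about the midpoint preserves the region, so a block can be described from
  either end.\<close>

lemma block_region_flip:
  assumes "block_region M p"
  shows "block_region M (M - fst p, - snd p)" "block_map M z d p = block_map M (z + d) (- d) (M - fst p, - snd p)"
proof -
  have "2 * (M - fst p) - M = - (2 * fst p - M)" by (simp add: algebra_simps)
  then have "\<bar>2 * (M - fst p) - M\<bar> = \<bar>2 * fst p - M\<bar>" by (simp only: abs_minus_cancel)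
  then show "block_region M (M - fst p, - snd p)" using assms by (auto simp: block_region_def)
  show "block_map M z d p = block_map M (z + d) (- d) (M - fst p, - snd p)"
    by (simp add: block_map_def algebra_simps)
qed

text \<open>The sum norm is invariant under quarter turns. Coordinates are doubled so that the
  midpoint of a grid edge is integral.\<close>

lemma block_diamond:
  assumes "d \<in> unit_vectors"
  shows "\<bar>2 * fst (block_map M z d p) - M * fst (z + (z + d))\<bar> + \<bar>2 * snd (block_map M z d p) - M * snd (z + (z + d))\<bar>
    = \<bar>2 * fst p - M\<bar> + 2 * \<bar>snd p\<bar>"
  using assms
  by (cases rule: unit_vectors_cases) (auto simp: block_map_def algebra_simps abs_if)

lemma abs_mult_ge:
  fixes M k :: int
  assumes "0 \<le> M" "n \<le> \<bar>k\<bar>"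
  shows "M * n \<le> \<bar>M * k\<bar>"
  using assms by (simp add: abs_mult mult_left_mono)

lemma midpoints_apart:
  assumes d: "d \<in> unit_vectors" and e: "e \<in> unit_vectors" and neq: "{z, z + d} \<noteq> {w, w + e}"
  shows "2 \<le> \<bar>fst (z + (z + d)) - fst (w + (w + e))\<bar> + \<bar>snd (z + (z + d)) - snd (w + (w + e))\<bar>"
proof (rule ccontr)
  define a b where "a = fst z - fst w" and "b = snd z - snd w"
  assume "\<not> ?thesis"
  then have le: "\<bar>2 * a + (fst d - fst e)\<bar> + \<bar>2 * b + (snd d - snd e)\<bar> \<le> 1"
    by (simp add: a_def b_def algebra_simps)
  have zw: "fst z = fst w + a" "snd z = snd w + b" by (simp_all add: a_def b_def)
  have "{z, z + d} = {w, w + e}"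
    unfolding doubleton_eq_iff prod_eq_iff fst_add snd_add zw
    using d e le
    by (elim unit_vectors_cases) (simp; presburger)+
  then show False using neq by simp
qed

text \<open>In doubled sum norm the centres are at least \<open>2 * M\<close> apart, a block reaches
  at most \<open>M\<close> from its centre, and closeness bridges at most 28. A point of the shrunk
  diamond would lose 40, so both points are among the four special ones. Two points at distance 10
  from the ends would again lose 40 together, so one of the points is a grid vertex.\<close>

lemma blocks_apart:
  assumes M: "100 \<le> M" and d: "d \<in> unit_vectors" and e: "e \<in> unit_vectors" and neq: "{z, z + d} \<noteq> {w, w + e}"
    and p: "block_region M p" and q: "block_region M q"
    and cl: "close_pts (block_map M z d p) (block_map M w e q)"
  shows "\<exists>y\<in>{z, z + d} \<inter> {w, w + e}. block_map M z d p = scale_pt M y \<or> block_map M w e q = scale_pt M y"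
proof -
  define P where "P = block_map M z d p"
  define R where "R = block_map M w e q"
  define U where "U = z + (z + d)"
  define W where "W = w + (w + e)"
  define sp where "sp = \<bar>2 * fst p - M\<bar> + 2 * \<bar>snd p\<bar>"
  define sq where "sq = \<bar>2 * fst q - M\<bar> + 2 * \<bar>snd q\<bar>"
  have 1: "\<bar>2 * fst P - M * fst U\<bar> + \<bar>2 * snd P - M * snd U\<bar> = sp"
    unfolding P_def U_def sp_def by (rule block_diamond[OF d])
  have 2: "\<bar>2 * fst R - M * fst W\<bar> + \<bar>2 * snd R - M * snd W\<bar> = sq"
    unfolding R_def W_def sq_def by (rule block_diamond[OF e])
  have 3: "\<bar>fst P - fst R\<bar> + \<bar>snd P - snd R\<bar> \<le> 14" using close_ptsD(3)[OF cl] by (simp add: P_def R_def)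
  have "2 \<le> \<bar>fst U - fst W\<bar> + \<bar>snd U - snd W\<bar>"
    unfolding U_def W_def by (rule midpoints_apart[OF d e neq])
  then have "M * 2 \<le> M * (\<bar>fst U - fst W\<bar> + \<bar>snd U - snd W\<bar>)" using M by (intro mult_left_mono) simp_all
  also have "\<dots> = \<bar>M * fst U - M * fst W\<bar> + \<bar>M * snd U - M * snd W\<bar>"
    using M by (simp add: distrib_left abs_mult flip: right_diff_distrib)
  also have "\<dots> \<le> sp + sq + 28" using 1 2 3 by linarith
  finally have big: "2 * M \<le> sp + sq + 28" by simp
  have node: "\<exists>y\<in>{z, z + d}. \<exists>a\<in>{0, 10}. \<exists>u\<in>unit_vectors. block_map M z d p = (M * fst y + a * fst u, M * snd y + a * snd u) \<and> 
      sp = M - 2 * a"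
    if big: "\<not> sp \<le> M - 40" and d: "d \<in> unit_vectors" and p: "block_region M p" and sp: "sp = \<bar>2 * fst p - M\<bar> + 2 * \<bar>snd p\<bar>"
    for z d p sp
  proof -
    have md: "- d \<in> unit_vectors" using d by (auto simp: unit_vectors_def)
    from p consider "p = (0, 0)" | "p = (M, 0)" | "p = (10, 0)" | "p = (M - 10, 0)"
      using big unfolding sp by (elim block_region_cases) blast+
    then show ?thesis
    proof cases
      case 1
      then show ?thesis using d M sp by (intro bexI[of _ z] bexI[of _ 0] bexI[of _ d]) (simp_all add: block_map_def)
    next
      case 2
      then show ?thesis using d M sp
        by (intro bexI[of _ "z + d"] bexI[of _ 0] bexI[of _ d]) (simp_all add: block_map_def algebra_simps)
    next
      case 3
      then show ?thesis using d M sp by (intro bexI[of _ z] bexI[of _ 10] bexI[of _ d]) (simp_all add: block_map_def)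
    next
      case 4
      then show ?thesis using md M sp
        by (intro bexI[of _ "z + d"] bexI[of _ 10] bexI[of _ "- d"]) (simp_all add: block_map_def algebra_simps)
    qed
  qed
  have bounds: "sp \<le> M" "sq \<le> M"
    using p q M unfolding sp_def sq_def by (auto elim!: block_region_cases)
  have spM: "\<not> sp \<le> M - 40" and sqM: "\<not> sq \<le> M - 40" using big bounds by linarith+
  obtain y a u where y: "y \<in> {z, z + d}" "a \<in> {0, 10}" "u \<in> unit_vectors"
      "P = (M * fst y + a * fst u, M * snd y + a * snd u)" "sp = M - 2 * a"
    using node[OF spM d p sp_def] unfolding P_def by blast
  obtain y' a' u' where y': "y' \<in> {w, w + e}" "a' \<in> {0, 10}" "u' \<in> unit_vectors"
      "R = (M * fst y' + a' * fst u', M * snd y' + a' * snd u')" "sq = M - 2 * a'"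
    using node[OF sqM e q sq_def] unfolding R_def by blast
  have a0: "a = 0 \<or> a' = 0" using big y(2,5) y'(2,5) by auto
  have small: "k = 0" if "\<bar>M * k\<bar> \<le> 50" for k
    using abs_mult_ge[of M 1 k] M that by linarith
  have "\<bar>M * (fst y - fst y')\<bar> \<le> 50" "\<bar>M * (snd y - snd y')\<bar> \<le> 50"
    using 3 y(2,3,4) y'(2,3,4) by (auto simp: unit_vectors_def right_diff_distrib)
  then have "fst y - fst y' = 0" "snd y - snd y' = 0" by (auto dest: small)
  then have "y = y'" by (simp add: prod_eq_iff)
  then have "y \<in> {z, z + d} \<inter> {w, w + e}" using y(1) y'(1) by blast
  moreover have "P = scale_pt M y \<or> R = scale_pt M y"
    using a0 y(4) y'(4) \<open>y = y'\<close> by (auto simp: scale_pt_def)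
  ultimately show ?thesis
    unfolding P_def[symmetric] R_def[symmetric] by blast
qed

section \<open>The drawing near a vertex\<close>

text \<open>Five points within distance \<open>10\<close> of a vertex and more than \<open>10\<close> apart cannot all lie on
  the grid lines through it, so four of the five paths that leave a vertex start off these lines.\<close>

definition port_dir :: "nat \<Rightarrow> int \<times> int" where
  "port_dir i = [(1, 0), (0, 1), (-1, 1), (-1, -1), (0, -1)] ! i"

definition mirror :: "int \<times> int \<Rightarrow> int \<times> int" where
  "mirror p = (fst p, - snd p)"

text \<open>The first points (8, 0), (3, 9), (-8, 6), (-8, -6), (3, -9) are within 10 of the centre
  and pairwise more than 10 apart. The upright arms lean to the right because (0, 10) is too close
  to (-8, 6).\<close>

definition arm_start :: "nat \<Rightarrow> (int \<times> int) set" where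
  "arm_start i = [{(0, 0), (8, 0), (16, 0), (24, 0)}, {(0, 0), (3, 9), (0, 18), (0, 24)},
     {(0, 0), (-8, 6), (-16, 12), (-20, 20), (-30, 20)}, {(0, 0), (-8, -6), (-16, -12), (-20, -20), (-30, -20)},
     {(0, 0), (3, -9), (0, -18), (0, -24)}] ! i"

text \<open>From coordinates of size 30 on, the arms follow grid lines; the two diagonal ones are
  staircases that alternate between the diagonal and the points 10 beside it.\<close>

definition arm_end :: "int \<Rightarrow> nat \<Rightarrow> int \<times> int \<Rightarrow> bool" where
  "arm_end M i p \<longleftrightarrow> [snd p = 0 \<and> 30 \<le> fst p \<and> fst p \<le> M, fst p = 0 \<and> 30 \<le> snd p \<and> snd p \<le> M,
     fst p \<le> -30 \<and> 30 \<le> snd p \<and> snd p \<le> M \<and> -M \<le> fst p \<and> (fst p + snd p = 0 \<or> fst p + snd p = -10),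
     fst p \<le> -30 \<and> snd p \<le> -30 \<and> -M \<le> snd p \<and> -M \<le> fst p \<and> (fst p - snd p = 0 \<or> fst p - snd p = -10),
     fst p = 0 \<and> snd p \<le> -30 \<and> -M \<le> snd p] ! i"

lemma less_5_cases:
  assumes "i < 5"
  obtains "i = 0" | "i = 1" | "i = 2" | "i = 3" | "i = (4::nat)"
  using assms by linarith

lemmas arm_simps = port_dir_def arm_start_def arm_end_def

lemma ipath_snoc:
  assumes "ipath S a b n" "close_pts b c" "b \<noteq> c" "\<forall>x\<in>S. x \<noteq> b \<longrightarrow> \<not> close_pts x c"
  shows "ipath (insert c S) a c (Suc n)"
proof -
  have "ipath (S \<union> {b, c}) a c (n + 1)"
    by (rule ipath_concat[OF assms(1) ipath_edge[OF assms(2,3)]]) (use assms(4) in auto)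
  moreover have "S \<union> {b, c} = insert c S" using ipath_ends(2)[OF assms(1)] by auto
  ultimately show ?thesis by simp
qed

lemma ipath_mirror: "ipath S a b n \<Longrightarrow> ipath (mirror ` S) (mirror a) (mirror b) n"
proof (rule ipath_image)
  show "close_pts (mirror x) (mirror y) \<longleftrightarrow> close_pts x y" for x y
    by (simp add: close_pts_def mirror_def power2_commute)
  show "inj mirror" by (rule injI) (simp add: mirror_def prod_eq_iff)
qed

text \<open>Steps of lengths 8, 8, 8, 6 reach 30 with four edges instead of three; the additional
  edge makes the length odd for even \<open>m\<close>.\<close>

lemma ipath_arm0:
  assumes "3 \<le> m"
  shows "\<exists>S. ipath S (0, 0) (10 * int m, 0) (m + 1) \<and> (\<forall>p\<in>S. p \<in> arm_start 0 \<or> arm_end (10 * int m) 0 p)"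
proof -
  note 1 = ipath_edge[of "(0, 0)" "(8, 0)"]
  note 2 = ipath_snoc[OF 1, of "(16, 0)"]
  note 3 = ipath_snoc[OF 2, of "(24, 0)"]
  note 4 = ipath_snoc[OF 3, of "(30, 0)"]
  have G: "ipath {(30, 0), (24, 0), (16, 0), (0, 0), (8, 0)} (0, 0) (30, 0) 4"
    using 4 by (simp add: close_pts_def numeral_eq_Suc)
  have T: "ipath (straight (30, 0) (1, 0) (m - 3)) (30, 0) (10 * int m, 0) (m - 3)"
    using ipath_straight[of "(1, 0)" "(30, 0)" "m - 3"] assms by (simp add: unit_vectors_def of_nat_diff)
  have T_reg: "p = (30, 0) \<or> 40 \<le> fst p \<and> fst p \<le> 10 * int m \<and> snd p = 0" if "p \<in> straight (30, 0) (1, 0) (m - 3)" for p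
  proof -
    from that obtain k where k: "p = (30 + 10 * int k, 0)" "k \<le> m - 3" unfolding straight_def by auto
    then show ?thesis using assms by (cases "k = 0") auto
  qed
  have "ipath ({(30, 0), (24, 0), (16, 0), (0, 0), (8, 0)} \<union> straight (30, 0) (1, 0) (m - 3)) (0, 0) (10 * int m, 0) (4 + (m - 3))"
  proof (rule ipath_concat[OF G T])
    fix x y :: "int \<times> int"
    assume x: "x \<in> {(30, 0), (24, 0), (16, 0), (0, 0), (8, 0)}" and y: "y \<in> straight (30, 0) (1, 0) (m - 3)" and cl: "close_pts x y"
    show "x = (30, 0) \<or> y = (30, 0)"
      using T_reg[OF y] x close_ptsD(1)[OF cl] by auto
  qed
  moreover have "4 + (m - 3) = m + 1" using assms by simp
  moreover have "p \<in> arm_start 0 \<or> arm_end (10 * int m) 0 p"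
    if "p \<in> {(30, 0), (24, 0), (16, 0), (0, 0), (8, 0)} \<union> straight (30, 0) (1, 0) (m - 3)" for p
    using that T_reg[of p] assms by (auto simp: arm_simps)
  ultimately show ?thesis by metis
qed

lemma ipath_arm1:
  assumes "3 \<le> m"
  shows "\<exists>S. ipath S (0, 0) (0, 10 * int m) (m + 1) \<and> (\<forall>p\<in>S. p \<in> arm_start 1 \<or> arm_end (10 * int m) 1 p)"
proof -
  note 1 = ipath_edge[of "(0, 0)" "(3, 9)"]
  note 2 = ipath_snoc[OF 1, of "(0, 18)"]
  note 3 = ipath_snoc[OF 2, of "(0, 24)"]
  note 4 = ipath_snoc[OF 3, of "(0, 30)"]
  have G: "ipath {(0, 30), (0, 24), (0, 18), (0, 0), (3, 9)} (0, 0) (0, 30) 4"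
    using 4 by (simp add: close_pts_def numeral_eq_Suc)
  have T: "ipath (straight (0, 30) (0, 1) (m - 3)) (0, 30) (0, 10 * int m) (m - 3)"
    using ipath_straight[of "(0, 1)" "(0, 30)" "m - 3"] assms by (simp add: unit_vectors_def of_nat_diff)
  have T_reg: "p = (0, 30) \<or> 40 \<le> snd p \<and> snd p \<le> 10 * int m \<and> fst p = 0" if "p \<in> straight (0, 30) (0, 1) (m - 3)" for p
  proof -
    from that obtain k where k: "p = (0, 30 + 10 * int k)" "k \<le> m - 3" unfolding straight_def by auto
    then show ?thesis using assms by (cases "k = 0") auto
  qed
  have "ipath ({(0, 30), (0, 24), (0, 18), (0, 0), (3, 9)} \<union> straight (0, 30) (0, 1) (m - 3)) (0, 0) (0, 10 * int m) (4 + (m - 3))"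
  proof (rule ipath_concat[OF G T])
    fix x y :: "int \<times> int"
    assume x: "x \<in> {(0, 30), (0, 24), (0, 18), (0, 0), (3, 9)}" and y: "y \<in> straight (0, 30) (0, 1) (m - 3)" and cl: "close_pts x y"
    show "x = (0, 30) \<or> y = (0, 30)"
      using T_reg[OF y] x close_ptsD(2)[OF cl] by auto
  qed
  moreover have "4 + (m - 3) = m + 1" using assms by simp
  moreover have "p \<in> arm_start 1 \<or> arm_end (10 * int m) 1 p"
    if "p \<in> {(0, 30), (0, 24), (0, 18), (0, 0), (3, 9)} \<union> straight (0, 30) (0, 1) (m - 3)" for p
    using that T_reg[of p] assms by (auto simp: arm_simps)
  ultimately show ?thesis by metis
qed

text \<open>Five edges lead to (-30, 30). Each further diagonal takes one step to the left and one
  upwards, which gives \<open>5 + 2 * (m - 3)\<close> edges.\<close>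

lemma ipath_arm2:
  assumes "3 \<le> m"
  shows "\<exists>S. ipath S (0, 0) (- 10 * int m, 10 * int m) (2 * m - 1) \<and>
    (\<forall>p\<in>S. p \<in> arm_start 2 \<or> arm_end (10 * int m) 2 p)"
  using assms
proof (induction m rule: dec_induct)
  case base
  note 1 = ipath_edge[of "(0, 0)" "(-8, 6)"]
  note 2 = ipath_snoc[OF 1, of "(-16, 12)"]
  note 3 = ipath_snoc[OF 2, of "(-20, 20)"]
  note 4 = ipath_snoc[OF 3, of "(-30, 20)"]
  note 5 = ipath_snoc[OF 4, of "(-30, 30)"]
  have "ipath {(-30, 30), (-30, 20), (-20, 20), (-16, 12), (0, 0), (-8, 6)} (0, 0) (-30, 30) 5"
    using 5 by (simp add: close_pts_def numeral_eq_Suc)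
  then show ?case
    by (intro exI[of _ "{(-30, 30), (-30, 20), (-20, 20), (-16, 12), (0, 0), (-8, 6)}"]) (simp add: arm_simps)
next
  case (step m)
  then obtain S where S: "ipath S (0, 0) (- 10 * int m, 10 * int m) (2 * m - 1)"
    and reg: "\<forall>p\<in>S. p \<in> arm_start 2 \<or> arm_end (10 * int m) 2 p" by (elim exE conjE)
  let ?a = "(- 10 * int m, 10 * int m)" and ?b = "(- 10 * int m - 10, 10 * int m)" and ?c = "(- 10 * int m - 10, 10 * int m + 10)"
  have box: "- 10 * int m \<le> fst p \<and> snd p \<le> 10 * int m \<and> (fst p = - 10 * int m \<longrightarrow> p = ?a \<or> p = (- 10 * int m, 10 * int m - 10))"
    if "p \<in> S" for p
    using bspec[OF reg that] step(1) by (auto simp: arm_simps prod_eq_iff)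
  have "ipath (insert ?b S) (0, 0) ?b (Suc (2 * m - 1))"
  proof (rule ipath_snoc[OF S])
    show "\<forall>x\<in>S. x \<noteq> ?a \<longrightarrow> \<not> close_pts x ?b"
    proof (intro ballI impI notI)
      fix x assume x: "x \<in> S" "x \<noteq> ?a" and cl: "close_pts x ?b"
      show False using box[OF x(1)] x(2) close_ptsD(1,3)[OF cl] by auto
    qed
  qed (simp_all add: close_pts_def)
  then have "ipath (insert ?c (insert ?b S)) (0, 0) ?c (Suc (Suc (2 * m - 1)))"
  proof (rule ipath_snoc)
    show "\<forall>x\<in>insert ?b S. x \<noteq> ?b \<longrightarrow> \<not> close_pts x ?c"
    proof (intro ballI impI notI)
      fix x assume x: "x \<in> insert ?b S" "x \<noteq> ?b" and cl: "close_pts x ?c"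
      then have "x \<in> S" by simp
      from box[OF this] show False using close_ptsD[OF cl] by auto
    qed
  qed (simp_all add: close_pts_def)
  moreover have "Suc (Suc (2 * m - 1)) = 2 * Suc m - 1" using step(1) by simp
  moreover have "?c = (- 10 * int (Suc m), 10 * int (Suc m))" by simp
  ultimately have path: "ipath (insert ?c (insert ?b S)) (0, 0) (- 10 * int (Suc m), 10 * int (Suc m)) (2 * Suc m - 1)"
    by (simp only:)
  have "p \<in> arm_start 2 \<or> arm_end (10 * int (Suc m)) 2 p" if "p \<in> insert ?c (insert ?b S)" for p
  proof -
    have "arm_end (10 * int m) 2 p \<Longrightarrow> arm_end (10 * int (Suc m)) 2 p" by (simp add: arm_end_def)
    moreover have "arm_end (10 * int (Suc m)) 2 ?b" "arm_end (10 * int (Suc m)) 2 ?c"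
      using step(1) by (simp_all add: arm_end_def)
    ultimately show ?thesis using that bspec[OF reg, of p] by blast
  qed
  with path show ?case by blast
qed

definition in_arm :: "int \<Rightarrow> nat \<Rightarrow> int \<times> int \<Rightarrow> bool" where
  "in_arm M i p \<longleftrightarrow> p \<in> arm_start i \<or> arm_end M i p"

lemma in_arm_mirror:
  "in_arm M 2 p \<Longrightarrow> in_arm M 3 (mirror p)" "in_arm M 1 p \<Longrightarrow> in_arm M 4 (mirror p)"
  by (auto simp: in_arm_def arm_simps mirror_def)

text \<open>The parity is the point: for even \<open>m\<close> both lengths, \<open>m + 1\<close>
  and \<open>2 * m - 1\<close>, are odd, so the two arms of a route always contribute an even
  number.\<close>

lemma ipath_arm:
  assumes m: "3 \<le> m" "even m" and i: "i < 5"
  shows "\<exists>S n. ipath S (0, 0) (scale_pt (10 * int m) (port_dir i)) n \<and> odd n \<and> n \<le> 2 * m \<and>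
    (\<forall>p\<in>S. in_arm (10 * int m) i p)"
  using i
proof (cases rule: less_5_cases)
  case 1
  from ipath_arm0[OF m(1)] obtain S where S: "ipath S (0, 0) (10 * int m, 0) (m + 1)"
    "\<forall>p\<in>S. in_arm (10 * int m) 0 p" unfolding in_arm_def by blast
  have "ipath S (0, 0) (scale_pt (10 * int m) (port_dir 0)) (m + 1)"
    using S(1) by (simp add: port_dir_def scale_pt_def)
  moreover have "odd (m + 1)" "m + 1 \<le> 2 * m" using m by simp_all
  ultimately show ?thesis using S(2) unfolding 1 by blast
next
  case 2
  from ipath_arm1[OF m(1)] obtain S where S: "ipath S (0, 0) (0, 10 * int m) (m + 1)"
    "\<forall>p\<in>S. in_arm (10 * int m) 1 p" unfolding in_arm_def by blast
  have "ipath S (0, 0) (scale_pt (10 * int m) (port_dir 1)) (m + 1)"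
    using S(1) by (simp add: port_dir_def scale_pt_def)
  moreover have "odd (m + 1)" "m + 1 \<le> 2 * m" using m by simp_all
  ultimately show ?thesis using S(2) unfolding 2 by blast
next
  case 3
  from ipath_arm2[OF m(1)] obtain S where S: "ipath S (0, 0) (- 10 * int m, 10 * int m) (2 * m - 1)"
    "\<forall>p\<in>S. in_arm (10 * int m) 2 p" unfolding in_arm_def by blast
  have "ipath S (0, 0) (scale_pt (10 * int m) (port_dir 2)) (2 * m - 1)"
    using S(1) by (simp add: port_dir_def scale_pt_def)
  moreover have "odd (2 * m - 1)" "2 * m - 1 \<le> 2 * m" using m by simp_all
  ultimately show ?thesis using S(2) unfolding 3 by blast
next
  case 4
  from ipath_arm2[OF m(1)] obtain S where S: "ipath S (0, 0) (- 10 * int m, 10 * int m) (2 * m - 1)"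
    "\<forall>p\<in>S. in_arm (10 * int m) 2 p" unfolding in_arm_def by blast
  have "ipath (mirror ` S) (0, 0) (scale_pt (10 * int m) (port_dir 3)) (2 * m - 1)"
    using ipath_mirror[OF S(1)] by (simp add: mirror_def port_dir_def scale_pt_def)
  moreover have "\<forall>p\<in>mirror ` S. in_arm (10 * int m) 3 p" using S(2) in_arm_mirror by blast
  moreover have "odd (2 * m - 1)" "2 * m - 1 \<le> 2 * m" using m by simp_all
  ultimately show ?thesis unfolding 4 by blast
next
  case 5
  from ipath_arm1[OF m(1)] obtain S where S: "ipath S (0, 0) (0, 10 * int m) (m + 1)"
    "\<forall>p\<in>S. in_arm (10 * int m) 1 p" unfolding in_arm_def by blast
  have "ipath (mirror ` S) (0, 0) (scale_pt (10 * int m) (port_dir 4)) (m + 1)"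
    using ipath_mirror[OF S(1)] by (simp add: mirror_def port_dir_def scale_pt_def)
  moreover have "\<forall>p\<in>mirror ` S. in_arm (10 * int m) 4 p" using S(2) in_arm_mirror by blast
  moreover have "odd (m + 1)" "m + 1 \<le> 2 * m" using m by simp_all
  ultimately show ?thesis unfolding 5 by blast
qed

section \<open>Distances between arms, ports and blocks\<close>

lemma in_arm_bound:
  assumes "in_arm M i p" "i < 5" "100 \<le> M"
  shows "\<bar>fst p\<bar> \<le> M" "\<bar>snd p\<bar> \<le> M"
proof -
  have "\<bar>fst p\<bar> \<le> M \<and> \<bar>snd p\<bar> \<le> M"
    using assms(2)
    by (cases rule: less_5_cases) (use assms(1,3) in \<open>auto simp: in_arm_def arm_simps\<close>)
  then show "\<bar>fst p\<bar> \<le> M" "\<bar>snd p\<bar> \<le> M" by simp_all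
qed

text \<open>The starts are compared point by point. As soon as the end of an arm is involved, some
  coordinate differs by more than 10.\<close>

lemma arms_apart_less:
  assumes "i < k" "k < 5" and p: "in_arm M i p" and q: "in_arm M k q" and cl: "close_pts p q"
  shows "p = (0, 0) \<or> q = (0, 0)"
proof -
  have i5: "i < 5" using assms(1,2) by simp
  from p q consider "p \<in> arm_start i" "q \<in> arm_start k" | "p \<in> arm_start i" "arm_end M k q"
    | "arm_end M i p" "q \<in> arm_start k" | "arm_end M i p" "arm_end M k q"
    unfolding in_arm_def by blast
  then show ?thesis
  proof cases
    case 1
    show ?thesis
      by (rule less_5_cases[OF i5]; rule less_5_cases[OF assms(2)]) (use assms(1) 1 cl in \<open>auto simp: arm_start_def close_pts_def\<close>)
  next
    case 2
    show ?thesis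
      by (rule less_5_cases[OF i5]; rule less_5_cases[OF assms(2)]) (use assms(1) 2 close_ptsD(1,2)[OF cl] in \<open>auto simp: arm_simps\<close>)
  next
    case 3
    show ?thesis
      by (rule less_5_cases[OF i5]; rule less_5_cases[OF assms(2)]) (use assms(1) 3 close_ptsD(1,2)[OF cl] in \<open>auto simp: arm_simps\<close>)
  next
    case 4
    show ?thesis
      by (rule less_5_cases[OF i5]; rule less_5_cases[OF assms(2)]) (use assms(1) 4 close_ptsD(1,2)[OF cl] in \<open>auto simp: arm_simps\<close>)
  qed
qed

lemma arms_apart:
  assumes "i \<noteq> k" "i < 5" "k < 5" "in_arm M i p" "in_arm M k q" "close_pts p q"
  shows "p = (0, 0) \<or> q = (0, 0)"
  using arms_apart_less[of i k M p q] arms_apart_less[of k i M q p] assms close_sym[OF assms(6)]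
  by (cases "i < k") auto

lemma arm_near_port:
  assumes i: "i < 5" and k: "k < 5" and M: "100 \<le> M" and p: "in_arm M i p" and cl: "close_pts p (scale_pt M (port_dir k))"
  shows "i = k"
proof -
  note D = close_ptsD(1,2)[OF cl]
  from i show ?thesis
  proof (cases rule: less_5_cases)
    case 1
    from k show ?thesis by (cases rule: less_5_cases) (use 1 p M D in \<open>auto simp: in_arm_def arm_simps scale_pt_def\<close>)
  next
    case 2
    from k show ?thesis by (cases rule: less_5_cases) (use 2 p M D in \<open>auto simp: in_arm_def arm_simps scale_pt_def\<close>)
  next
    case 3
    from k show ?thesis by (cases rule: less_5_cases) (use 3 p M D in \<open>auto simp: in_arm_def arm_simps scale_pt_def\<close>)
  next
    case 4
    from k show ?thesis by (cases rule: less_5_cases) (use 4 p M D in \<open>auto simp: in_arm_def arm_simps scale_pt_def\<close>)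
  next
    case 5
    from k show ?thesis by (cases rule: less_5_cases) (use 5 p M D in \<open>auto simp: in_arm_def arm_simps scale_pt_def\<close>)
  qed
qed

text \<open>The condition \<open>out\<close> leaves seven pairs of port and outward direction. In
  each of them the first point behind the port is close to no point of an arm except the
  port.\<close>

lemma arm_near_exit:
  assumes i: "i < 5" and k: "k < 5" and M: "100 \<le> M" and p: "in_arm M i p" and d: "d \<in> unit_vectors"
    and out: "2 \<le> \<bar>fst (port_dir k + d)\<bar> \<or> 2 \<le> \<bar>snd (port_dir k + d)\<bar>"
    and cl: "close_pts p (block_map M (port_dir k) d (10, 0))"
  shows "i = k" "p = scale_pt M (port_dir k)"
proof -
  define e where "e = block_map M (port_dir k) d (10, 0)"
  consider "k = 0" "d = (1, 0)" | "k = 1" "d = (0, 1)" | "k = 2" "d = (-1, 0)" | "k = 2" "d = (0, 1)"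
    | "k = 3" "d = (-1, 0)" | "k = 3" "d = (0, -1)" | "k = 4" "d = (0, -1)"
    using k d out by (elim less_5_cases) (auto simp: unit_vectors_def port_dir_def)
  then have "i = k \<and> p = scale_pt M (port_dir k)"
  proof cases
    case 1
    have "e = (M + 10, 0)" by (simp add: e_def 1 block_map_def port_dir_def)
    note D = close_ptsD[OF cl[folded e_def, unfolded this]]
    from i show ?thesis by (cases rule: less_5_cases) (use 1 p M D in \<open>auto simp: in_arm_def arm_simps scale_pt_def prod_eq_iff\<close>)
  next
    case 2
    have "e = (0, M + 10)" by (simp add: e_def 2 block_map_def port_dir_def)
    note D = close_ptsD[OF cl[folded e_def, unfolded this]]
    from i show ?thesis by (cases rule: less_5_cases) (use 2 p M D in \<open>auto simp: in_arm_def arm_simps scale_pt_def prod_eq_iff\<close>)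
  next
    case 3
    have "e = (- M - 10, M)" by (simp add: e_def 3 block_map_def port_dir_def)
    note D = close_ptsD[OF cl[folded e_def, unfolded this]]
    from i show ?thesis by (cases rule: less_5_cases) (use 3 p M D in \<open>auto simp: in_arm_def arm_simps scale_pt_def prod_eq_iff\<close>)
  next
    case 4
    have "e = (- M, M + 10)" by (simp add: e_def 4 block_map_def port_dir_def)
    note D = close_ptsD[OF cl[folded e_def, unfolded this]]
    from i show ?thesis by (cases rule: less_5_cases) (use 4 p M D in \<open>auto simp: in_arm_def arm_simps scale_pt_def prod_eq_iff\<close>)
  next
    case 5
    have "e = (- M - 10, - M)" by (simp add: e_def 5 block_map_def port_dir_def)
    note D = close_ptsD[OF cl[folded e_def, unfolded this]]
    from i show ?thesis by (cases rule: less_5_cases) (use 5 p M D in \<open>auto simp: in_arm_def arm_simps scale_pt_def prod_eq_iff\<close>)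
  next
    case 6
    have "e = (- M, - M - 10)" by (simp add: e_def 6 block_map_def port_dir_def)
    note D = close_ptsD[OF cl[folded e_def, unfolded this]]
    from i show ?thesis by (cases rule: less_5_cases) (use 6 p M D in \<open>auto simp: in_arm_def arm_simps scale_pt_def prod_eq_iff\<close>)
  next
    case 7
    have "e = (0, - M - 10)" by (simp add: e_def 7 block_map_def port_dir_def)
    note D = close_ptsD[OF cl[folded e_def, unfolded this]]
    from i show ?thesis by (cases rule: less_5_cases) (use 7 p M D in \<open>auto simp: in_arm_def arm_simps scale_pt_def prod_eq_iff\<close>)
  qed
  then show "i = k" "p = scale_pt M (port_dir k)" by simp_all
qed

text \<open>In doubled coordinates the midpoint has a coordinate of size at least
  \<open>4 * M\<close> and the block reaches at most \<open>M\<close> from it, so the block stays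
  out of reach of arms, which end at \<open>M\<close>.\<close>

lemma block_outside:
  assumes d: "d \<in> unit_vectors" and p: "block_region M p" and M: "100 \<le> M"
    and z: "2 \<le> \<bar>fst z\<bar> \<or> 2 \<le> \<bar>snd z\<bar>" "2 \<le> \<bar>fst (z + d)\<bar> \<or> 2 \<le> \<bar>snd (z + d)\<bar>"
  shows "3 * M \<le> 2 * \<bar>fst (block_map M z d p)\<bar> \<or> 3 * M \<le> 2 * \<bar>snd (block_map M z d p)\<bar>"
proof -
  define U where "U = z + (z + d)"
  have le: "\<bar>2 * fst p - M\<bar> + 2 * \<bar>snd p\<bar> \<le> M" using p M by (auto elim!: block_region_cases)
  have dia: "\<bar>2 * fst (block_map M z d p) - M * fst U\<bar> \<le> M" "\<bar>2 * snd (block_map M z d p) - M * snd U\<bar> \<le> M"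
    using block_diamond[OF d, of M z p] le unfolding U_def by linarith+
  have "4 \<le> \<bar>fst U\<bar> \<or> 4 \<le> \<bar>snd U\<bar>"
    using d z unfolding U_def by (elim unit_vectors_cases) auto
  then have "4 * M \<le> \<bar>M * fst U\<bar> \<or> 4 * M \<le> \<bar>M * snd U\<bar>"
    using abs_mult_ge[of M 4 "fst U"] abs_mult_ge[of M 4 "snd U"] M by auto
  then show ?thesis using dia by linarith
qed

text \<open>Along an edge that leaves the box, the first coordinate measures the excess over
  \<open>M\<close>. From 20 on this is out of reach of the arms, and only the port and the point
  next to it remain to be examined.\<close>

lemma block_exit:
  assumes d: "d \<in> unit_vectors" and p: "block_region M p" and M: "100 \<le> M"
    and z: "\<bar>fst z\<bar> \<le> 1" "\<bar>snd z\<bar> \<le> 1" and out: "2 \<le> \<bar>fst (z + d)\<bar> \<or> 2 \<le> \<bar>snd (z + d)\<bar>"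
  shows "M + fst p \<le> \<bar>fst (block_map M z d p)\<bar> \<or> M + fst p \<le> \<bar>snd (block_map M z d p)\<bar>"
    "0 \<le> fst p" "p = (0, 0) \<or> p = (10, 0) \<or> 20 \<le> fst p"
proof -
  show "0 \<le> fst p" "p = (0, 0) \<or> p = (10, 0) \<or> 20 \<le> fst p"
    using p M by (auto elim!: block_region_cases)
  from d show "M + fst p \<le> \<bar>fst (block_map M z d p)\<bar> \<or> M + fst p \<le> \<bar>snd (block_map M z d p)\<bar>"
  proof (cases rule: unit_vectors_cases)
    case 1
    then have "fst z = 1" using z out by auto
    then show ?thesis using 1 abs_ge_self[of "M + fst p"] by (simp add: block_map_def)
  next
    case 2
    then have "fst z = - 1" using z out by auto
    then show ?thesis using 2 abs_ge_minus_self[of "- M - fst p"] by (simp add: block_map_def)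
  next
    case 3
    then have "snd z = 1" using z out by auto
    then show ?thesis using 3 abs_ge_self[of "M + fst p"] by (simp add: block_map_def)
  next
    case 4
    then have "snd z = - 1" using z out by auto
    then show ?thesis using 4 abs_ge_minus_self[of "- M - fst p"] by (simp add: block_map_def)
  qed
qed

section \<open>From a drawing in a square grid to a geometric graph\<close>

text \<open>The 3 by 3 box of grid points around each \<open>q w\<close> is reserved for arms. Paths
  begin and end at ports on the border of such boxes and otherwise avoid them; \<open>E\<close>
  holds one orientation of every edge.\<close>

locale coarse_drawing =
  fixes G :: "'a pair_pre_digraph" and E :: "('a \<times> 'a) set" and q :: "'a \<Rightarrow> int \<times> int"
    and dir :: "'a \<Rightarrow> 'a \<Rightarrow> nat" and P :: "'a \<Rightarrow> 'a \<Rightarrow> nat \<Rightarrow> int \<times> int" and len :: "'a \<Rightarrow> 'a \<Rightarrow> nat"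
  assumes graph: "pair_graph G"
    and E_sub: "E \<subseteq> parcs G" and E_or: "(u, v) \<in> parcs G \<Longrightarrow> (u, v) \<in> E \<or> (v, u) \<in> E"
    and E_asym: "(u, v) \<in> E \<Longrightarrow> (v, u) \<notin> E"
    and dir_less: "(u, v) \<in> parcs G \<Longrightarrow> dir u v < 5"
    and dir_inj: "(u, v) \<in> parcs G \<Longrightarrow> (u, w) \<in> parcs G \<Longrightarrow> dir u v = dir u w \<Longrightarrow> v = w"
    and P_0: "(u, v) \<in> E \<Longrightarrow> P u v 0 = q u + port_dir (dir u v)"
    and P_len: "(u, v) \<in> E \<Longrightarrow> P u v (len u v) = q v + port_dir (dir v u)"
    and P_step: "(u, v) \<in> E \<Longrightarrow> i < len u v \<Longrightarrow> P u v (Suc i) - P u v i \<in> unit_vectors"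
    and P_inj: "(u, v) \<in> E \<Longrightarrow> inj_on (P u v) {..len u v}"
    and P_disj: "(u, v) \<in> E \<Longrightarrow> (x, y) \<in> E \<Longrightarrow> (u, v) \<noteq> (x, y) \<Longrightarrow> i \<le> len u v \<Longrightarrow> j \<le> len x y \<Longrightarrow>
      P u v i \<noteq> P x y j"
    and P_box: "(u, v) \<in> E \<Longrightarrow> w \<in> pverts G \<Longrightarrow> i \<le> len u v \<Longrightarrow> \<bar>fst (P u v i - q w)\<bar> \<le> 1 \<Longrightarrow>
      \<bar>snd (P u v i - q w)\<bar> \<le> 1 \<Longrightarrow> w = u \<and> i = 0 \<or> w = v \<and> i = len u v"
    and q_sep: "u \<in> pverts G \<Longrightarrow> w \<in> pverts G \<Longrightarrow> u \<noteq> w \<Longrightarrow>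
      4 \<le> \<bar>fst (q u - q w)\<bar> \<or> 4 \<le> \<bar>snd (q u - q w)\<bar>"

section \<open>Routes composed of arms and blocks\<close>

locale refined_drawing = coarse_drawing +
  fixes M :: int and A :: "nat \<Rightarrow> (int \<times> int) set" and al :: "nat \<Rightarrow> nat"
    and B :: "'a \<Rightarrow> 'a \<Rightarrow> nat \<Rightarrow> (int \<times> int) set" and bl :: "'a \<Rightarrow> 'a \<Rightarrow> nat \<Rightarrow> nat"
  assumes M: "100 \<le> M"
    and arm_path: "i < 5 \<Longrightarrow> ipath (A i) (0, 0) (scale_pt M (port_dir i)) (al i)"
    and arm_in: "i < 5 \<Longrightarrow> p \<in> A i \<Longrightarrow> in_arm M i p"
    and block_path: "(u, v) \<in> E \<Longrightarrow> i < len u v \<Longrightarrow> ipath (B u v i) (0, 0) (M, 0) (bl u v i)"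
    and block_reg: "(u, v) \<in> E \<Longrightarrow> i < len u v \<Longrightarrow> p \<in> B u v i \<Longrightarrow> block_region M p"
begin

sublocale G: pair_graph G by (rule graph)

lemma E_verts: "(u, v) \<in> E \<Longrightarrow> u \<in> pverts G" "(u, v) \<in> E \<Longrightarrow> v \<in> pverts G" "(u, v) \<in> E \<Longrightarrow> u \<noteq> v"
  using E_sub G.in_arcsD1 G.in_arcsD2 G.pair_no_loops by fastforce+

lemma E_arcs: "(u, v) \<in> E \<Longrightarrow> (u, v) \<in> parcs G" "(u, v) \<in> E \<Longrightarrow> (v, u) \<in> parcs G"
  using E_sub G.arcs_symmetric by auto

definition centre :: "'a \<Rightarrow> int \<times> int" where
  "centre w = scale_pt M (q w)"

definition arm :: "'a \<Rightarrow> 'a \<Rightarrow> (int \<times> int) set" where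
  "arm u v = (\<lambda>p. centre u + p) ` A (dir u v)"

definition blk :: "'a \<Rightarrow> 'a \<Rightarrow> nat \<Rightarrow> (int \<times> int) set" where
  "blk u v i = block_map M (P u v i) (P u v (Suc i) - P u v i) ` B u v i"

definition route :: "'a \<Rightarrow> 'a \<Rightarrow> (int \<times> int) set" where
  "route u v = arm u v \<union> (\<Union>i<len u v. blk u v i) \<union> arm v u"

lemma scale_add: "scale_pt M (y + z) = scale_pt M y + scale_pt M z"
  by (simp add: scale_pt_def algebra_simps)

lemma P_eq: "(u, v) \<in> E \<Longrightarrow> i \<le> len u v \<Longrightarrow> j \<le> len u v \<Longrightarrow> P u v i = P u v j \<longleftrightarrow> i = j"
  using P_inj[of u v] by (auto dest: inj_onD)

lemma blk_path:
  assumes "(u, v) \<in> E" "i < len u v"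
  shows "ipath (blk u v i) (scale_pt M (P u v i)) (scale_pt M (P u v (Suc i))) (bl u v i)"
proof -
  note d = P_step[OF assms]
  note b = block_map_close[OF d, of M "P u v i"]
  from ipath_image[OF block_path[OF assms], of "block_map M (P u v i) (P u v (Suc i) - P u v i)", OF b(1,2)]
  show ?thesis unfolding blk_def b(3,4) by simp
qed

text \<open>By \<open>blocks_apart\<close> close blocks share a grid vertex. Paths of different
  edges have none in common, so both blocks belong to one path.\<close>

lemma blk_apart:
  assumes uv: "(u, v) \<in> E" "i < len u v" and xy: "(x, y) \<in> E" "j < len x y" and neq: "(u, v, i) \<noteq> (x, y, j)"
    and a: "a \<in> blk u v i" and b: "b \<in> blk x y j" and cl: "close_pts a b"
  shows "(u, v) = (x, y) \<and> (\<exists>k\<in>{i, Suc i} \<inter> {j, Suc j}. a = scale_pt M (P u v k) \<or> b = scale_pt M (P u v k))"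
proof -
  obtain p where p: "p \<in> B u v i" "a = block_map M (P u v i) (P u v (Suc i) - P u v i) p"
    using a unfolding blk_def by blast
  obtain r where r: "r \<in> B x y j" "b = block_map M (P x y j) (P x y (Suc j) - P x y j) r"
    using b unfolding blk_def by blast
  have ends: "P u v i + (P u v (Suc i) - P u v i) = P u v (Suc i)" "P x y j + (P x y (Suc j) - P x y j) = P x y (Suc j)"
    by simp_all
  have same: "(u, v) = (x, y)" if "s \<in> {P u v i, P u v (Suc i)} \<inter> {P x y j, P x y (Suc j)}" for s
    using that P_disj[OF uv(1) xy(1)] uv(2) xy(2) by (metis IntE Suc_leI insertE less_imp_le singletonD)
  have "{P u v i, P u v (Suc i)} \<noteq> {P x y j, P x y (Suc j)}"
  proof
    assume eq: "{P u v i, P u v (Suc i)} = {P x y j, P x y (Suc j)}"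
    then have e: "(u, v) = (x, y)" using same by blast
    then have "{i, Suc i} = {j, Suc j}"
      using eq uv xy by (auto simp: doubleton_eq_iff P_eq)
    then have "i = j" by (auto simp: doubleton_eq_iff)
    then show False using neq e by simp
  qed
  then have neq': "{P u v i, P u v i + (P u v (Suc i) - P u v i)} \<noteq> {P x y j, P x y j + (P x y (Suc j) - P x y j)}"
    unfolding ends .
  from blocks_apart[OF M P_step[OF uv] P_step[OF xy] neq' block_reg[OF uv p(1)] block_reg[OF xy r(1)] cl[unfolded p(2) r(2)],
      folded p(2) r(2), unfolded ends]
  obtain s where s: "s \<in> {P u v i, P u v (Suc i)} \<inter> {P x y j, P x y (Suc j)}" "a = scale_pt M s \<or> b = scale_pt M s"
    by blast
  have e: "(u, v) = (x, y)" using same[OF s(1)] .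
  obtain k l where k: "k \<in> {i, Suc i}" "s = P u v k" "l \<in> {j, Suc j}" "s = P x y l" using s(1) by blast
  then have "k = l" using P_eq[OF uv(1), of k l] uv xy e by auto
  then show ?thesis using k s(2) e by blast
qed

text \<open>The start is added to the union because for \<open>n = 0\<close> there is no block to
  contain it.\<close>

lemma mid_path:
  assumes uv: "(u, v) \<in> E" and n: "n \<le> len u v"
  shows "ipath (insert (scale_pt M (P u v 0)) (\<Union>i<n. blk u v i)) (scale_pt M (P u v 0)) (scale_pt M (P u v n)) (\<Sum>i<n. bl u v i)"
  using n
proof (induction n)
  case 0
  then show ?case using ipath_single by simp
next
  case (Suc n)
  have IH: "ipath (insert (scale_pt M (P u v 0)) (\<Union>i<n. blk u v i)) (scale_pt M (P u v 0)) (scale_pt M (P u v n)) (\<Sum>i<n. bl u v i)"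
    using Suc by simp
  have nl: "n < len u v" using Suc.prems by simp
  have "ipath (insert (scale_pt M (P u v 0)) (\<Union>i<n. blk u v i) \<union> blk u v n) (scale_pt M (P u v 0)) (scale_pt M (P u v (Suc n)))
      ((\<Sum>i<n. bl u v i) + bl u v n)"
  proof (rule ipath_concat[OF IH blk_path[OF uv nl]])
    fix a b assume a: "a \<in> insert (scale_pt M (P u v 0)) (\<Union>i<n. blk u v i)" and b: "b \<in> blk u v n" and cl: "close_pts a b"
    show "a = scale_pt M (P u v n) \<or> b = scale_pt M (P u v n)"
    proof (cases "n = 0")
      case True
      then show ?thesis using a by simp
    next
      case False
      then have "scale_pt M (P u v 0) \<in> blk u v 0" using ipath_ends(1)[OF blk_path[OF uv, of 0]] nl by simp
      then have "a \<in> (\<Union>i<n. blk u v i)" using a False by auto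
      then obtain i where i: "i < n" "a \<in> blk u v i" by blast
      have "i < len u v" "(u, v, i) \<noteq> (u, v, n)" using i nl by auto
      from blk_apart[OF uv this(1) uv nl this(2) i(2) b cl]
      obtain k where k: "k \<in> {i, Suc i} \<inter> {n, Suc n}" "a = scale_pt M (P u v k) \<or> b = scale_pt M (P u v k)" by blast
      then have "k = n" using i by auto
      then show ?thesis using k by simp
    qed
  qed
  moreover have "insert (scale_pt M (P u v 0)) (\<Union>i<n. blk u v i) \<union> blk u v n = insert (scale_pt M (P u v 0)) (\<Union>i<Suc n. blk u v i)"
    by (auto simp: lessThan_Suc)
  ultimately show ?case by simp
qed

text \<open>Ports of different vertices are different grid points. So each route has a first block,
  the one that will be lengthened.\<close>

lemma len_pos:
  assumes uv: "(u, v) \<in> E"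
  shows "0 < len u v"
proof (rule ccontr)
  assume "\<not> 0 < len u v"
  then have eq: "q u + port_dir (dir u v) = q v + port_dir (dir v u)" using P_0[OF uv] P_len[OF uv] by simp
  have "\<bar>fst (port_dir i)\<bar> \<le> 1 \<and> \<bar>snd (port_dir i)\<bar> \<le> 1" if "i < 5" for i
    using that by (cases rule: less_5_cases) (simp_all add: port_dir_def)
  note D = this[OF dir_less[OF E_arcs(1)[OF uv]]] this[OF dir_less[OF E_arcs(2)[OF uv]]]
  have "fst (q u - q v) = fst (port_dir (dir v u)) - fst (port_dir (dir u v))"
    "snd (q u - q v) = snd (port_dir (dir v u)) - snd (port_dir (dir u v))"
    using arg_cong[OF eq, of fst] arg_cong[OF eq, of snd] by simp_all
  then show False using q_sep[OF E_verts[OF uv]] D by linarith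
qed

lemma port_small: "i < 5 \<Longrightarrow> \<bar>fst (port_dir i)\<bar> \<le> 1 \<and> \<bar>snd (port_dir i)\<bar> \<le> 1"
  by (erule less_5_cases) (simp_all add: port_dir_def)

lemma block_map_shift: "block_map M z d p = centre w + block_map M (z - q w) d p"
  by (simp add: block_map_def centre_def scale_pt_def algebra_simps)

text \<open>Relative to \<open>w\<close>, a block is either out of reach of the arms or the first or
  last one of a path at \<open>w\<close>. In the second case it is described from the port outwards;
  a last block is reversed for this purpose.\<close>

lemma blk_cases:
  assumes uv: "(u, v) \<in> E" "k < len u v" and y: "y \<in> blk u v k" and w: "w \<in> pverts G"
  obtains r where "y = centre w + r" "3 * M \<le> 2 * \<bar>fst r\<bar> \<or> 3 * M \<le> 2 * \<bar>snd r\<bar>"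
  | t j d p where "t \<le> len u v" "w = u \<and> t = 0 \<or> w = v \<and> t = len u v" "j < 5" "P u v t = q w + port_dir j" "d \<in> unit_vectors"
    "block_region M p" "y = centre w + block_map M (port_dir j) d p"
    "2 \<le> \<bar>fst (port_dir j + d)\<bar> \<or> 2 \<le> \<bar>snd (port_dir j + d)\<bar>"
proof -
  define z d where "z = P u v k - q w" and "d = P u v (Suc k) - P u v k"
  obtain p where p: "p \<in> B u v k" "y = block_map M (P u v k) d p"
    using y unfolding blk_def d_def by blast
  have yr: "y = centre w + block_map M z d p" using p(2) block_map_shift unfolding z_def by simp
  have d: "d \<in> unit_vectors" using P_step[OF uv] by (simp add: d_def)
  have reg: "block_region M p" using block_reg[OF uv p(1)] .
  have zd: "z + d = P u v (Suc k) - q w" by (simp add: z_def d_def)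
  have box0: "k = 0 \<and> w = u" if "\<not> (2 \<le> \<bar>fst z\<bar> \<or> 2 \<le> \<bar>snd z\<bar>)"
    using P_box[OF uv(1) w, of k] that uv(2) by (simp add: z_def)
  have box1: "Suc k = len u v \<and> w = v" if "\<not> (2 \<le> \<bar>fst (z + d)\<bar> \<or> 2 \<le> \<bar>snd (z + d)\<bar>)"
    using P_box[OF uv(1) w, of "Suc k"] that uv(2) unfolding zd by simp
  show thesis
  proof (cases "2 \<le> \<bar>fst z\<bar> \<or> 2 \<le> \<bar>snd z\<bar>")
    case z0: True
    show thesis
    proof (cases "2 \<le> \<bar>fst (z + d)\<bar> \<or> 2 \<le> \<bar>snd (z + d)\<bar>")
      case True
      from that(1)[OF yr block_outside[OF d reg M z0 True]] show thesis .
    next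
      case False
      from box1[OF False] have e: "Suc k = len u v" "w = v" by auto
      have port: "z + d = port_dir (dir v u)" using P_len[OF uv(1)] e unfolding zd by simp
      have flip: "block_region M (M - fst p, - snd p)" "block_map M z d p = block_map M (z + d) (- d) (M - fst p, - snd p)"
        by (rule block_region_flip[OF reg])+
      have "- d \<in> unit_vectors" using d by (auto simp: unit_vectors_def)
      moreover have "z = port_dir (dir v u) + - d" using port by (simp add: algebra_simps)
      ultimately show thesis
        by (intro that(2)[of "len u v" "dir v u" "- d" "(M - fst p, - snd p)"])
          (use e dir_less[OF E_arcs(2)[OF uv(1)]] P_len[OF uv(1)] flip yr z0 port in simp_all)
    qed
  next
    case False
    from box0[OF False] have e: "k = 0" "w = u" by auto
    have port: "z = port_dir (dir u v)" using P_0[OF uv(1)] e by (simp add: z_def)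
    have "2 \<le> \<bar>fst (z + d)\<bar> \<or> 2 \<le> \<bar>snd (z + d)\<bar>" using box1 e E_verts(3)[OF uv(1)] by blast
    then show thesis
      using that(2)[of 0 "dir u v" d p] e dir_less[OF E_arcs(1)[OF uv(1)]] P_0[OF uv(1)] reg d yr port by simp
  qed
qed

lemma blk_far:
  assumes "(u, v) \<in> E" "k < len u v" "y \<in> blk u v k" "w \<in> pverts G"
  shows "\<not> close_pts (centre w) y"
proof
  assume cl: "close_pts (centre w) y"
  from assms show False
  proof (cases rule: blk_cases)
    case (1 r)
    then show False using close_ptsD(1,2)[OF cl] M by auto
  next
    case (2 t j d p)
    note b = block_exit[OF 2(5,6) M _ _ 2(8)] port_small[OF 2(3)]
    then show False using close_ptsD(1,2)[OF cl] M unfolding 2(7) by auto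
  qed
qed

text \<open>Beyond the first two points a block is too far from every arm. Those two are treated by
  \<open>arm_near_port\<close> and \<open>arm_near_exit\<close>, and in both cases the arm is the
  one that ends at the port of the block.\<close>

lemma arm_blk:
  assumes uv: "(u, v) \<in> E" "k < len u v" "y \<in> blk u v k" and w: "w \<in> pverts G" and i: "i < 5"
    and a: "in_arm M i a" and cl: "close_pts (centre w + a) y"
  shows "\<exists>t\<le>len u v. (w = u \<and> t = 0 \<or> w = v \<and> t = len u v) \<and> P u v t = q w + port_dir i \<and>
    (a = scale_pt M (port_dir i) \<or> y = scale_pt M (P u v t))"
proof -
  note ab = in_arm_bound[OF a i M]
  from uv w show ?thesis
  proof (cases rule: blk_cases)
    case (1 r)
    then show ?thesis using close_ptsD(1,2)[OF cl] M ab by auto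
  next
    case (2 t j d p)
    have cl': "close_pts a (block_map M (port_dir j) d p)"
      using cl unfolding 2(7) by (simp add: close_pts_def)
    note b = block_exit[OF 2(5,6) M _ _ 2(8)]
    have pj: "\<bar>fst (port_dir j)\<bar> \<le> 1" "\<bar>snd (port_dir j)\<bar> \<le> 1" using port_small[OF 2(3)] by simp_all
    consider "p = (0, 0)" | "p = (10, 0)" | "20 \<le> fst p" using b(3)[OF pj] by blast
    then show ?thesis
    proof cases
      case 1
      have bm: "block_map M (port_dir j) d (0, 0) = scale_pt M (port_dir j)" by (rule block_map_close(3)[OF 2(5)])
      have "i = j" using arm_near_port[OF i 2(3) M a] cl' unfolding 1 bm by simp
      moreover have "y = scale_pt M (P u v t)" unfolding 2(4) 2(7) 1 bm scale_add centre_def ..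
      ultimately show ?thesis using 2(1,2,4) by blast
    next
      case p: 2
      from arm_near_exit[OF i 2(3) M a 2(5) 2(8)] cl' have "i = j" "a = scale_pt M (port_dir j)"
        unfolding p by simp_all
      then show ?thesis using 2(1,2,4) by blast
    next
      case 3
      then show ?thesis using b(1)[OF pj] ab close_ptsD(1,2)[OF cl'] by linarith
    qed
  qed
qed

lemma arms_far:
  assumes "u \<in> pverts G" "w \<in> pverts G" "u \<noteq> w" "i < 5" "j < 5" "in_arm M i a" "in_arm M j b"
  shows "\<not> close_pts (centre u + a) (centre w + b)"
proof
  assume cl: "close_pts (centre u + a) (centre w + b)"
  have "4 * M \<le> \<bar>M * fst (q u - q w)\<bar> \<or> 4 * M \<le> \<bar>M * snd (q u - q w)\<bar>"
    using q_sep[OF assms(1-3)] abs_mult_ge[of M 4] M by (metis dual_order.trans mult.commute zero_le_numeral)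
  moreover have "fst (centre u + a) - fst (centre w + b) = M * fst (q u - q w) + fst a - fst b"
    "snd (centre u + a) - snd (centre w + b) = M * snd (q u - q w) + snd a - snd b"
    by (simp_all add: centre_def scale_pt_def algebra_simps)
  ultimately show False
    using close_ptsD(1,2)[OF cl] in_arm_bound[OF assms(6,4) M] in_arm_bound[OF assms(7,5) M] M by linarith
qed

lemma in_arm_0: "i < 5 \<Longrightarrow> in_arm M i (0, 0)"
  using arm_in ipath_ends(1)[OF arm_path] by blast

lemma armE:
  assumes "a \<in> arm u v" "(u, v) \<in> parcs G"
  obtains p where "a = centre u + p" "in_arm M (dir u v) p" "dir u v < 5"
  using assms arm_in[OF dir_less[OF assms(2)]] dir_less[OF assms(2)] unfolding arm_def by blast

lemma ipath_arm_at:
  assumes "(u, v) \<in> parcs G"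
  shows "ipath (arm u v) (centre u) (scale_pt M (q u + port_dir (dir u v))) (al (dir u v))"
proof -
  have "ipath (arm u v) (centre u + (0, 0)) (centre u + scale_pt M (port_dir (dir u v))) (al (dir u v))"
    unfolding arm_def
  proof (rule ipath_image[OF arm_path[OF dir_less[OF assms]]])
    show "close_pts (centre u + x) (centre u + y) \<longleftrightarrow> close_pts x y" for x y by (simp add: close_pts_def)
    show "inj (\<lambda>p. centre u + p)" by simp
  qed
  moreover have "centre u + (0, 0) = centre u" by (simp add: zero_prod_def[symmetric])
  ultimately show ?thesis by (simp add: scale_add centre_def)
qed

lemma route_path:
  assumes uv: "(u, v) \<in> E"
  shows "ipath (route u v) (centre u) (centre v) (al (dir u v) + (\<Sum>i<len u v. bl u v i) + al (dir v u))"
proof -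
  define mid where "mid = (\<Union>i<len u v. blk u v i)"
  have "scale_pt M (P u v 0) \<in> mid"
    using ipath_ends(1)[OF blk_path[OF uv, of 0]] len_pos[OF uv] by (auto simp: mid_def)
  then have mid: "ipath mid (scale_pt M (P u v 0)) (scale_pt M (P u v (len u v))) (\<Sum>i<len u v. bl u v i)"
    using mid_path[OF uv order_refl] by (simp add: mid_def insert_absorb)
  have a1: "ipath (arm u v) (centre u) (scale_pt M (P u v 0)) (al (dir u v))"
    using ipath_arm_at[OF E_arcs(1)[OF uv]] P_0[OF uv] by simp
  have a2: "ipath (arm v u) (scale_pt M (P u v (len u v))) (centre v) (al (dir v u))"
    using ipath_rev[OF ipath_arm_at[OF E_arcs(2)[OF uv]]] P_len[OF uv] by simp
  have "ipath (arm u v \<union> mid) (centre u) (scale_pt M (P u v (len u v))) (al (dir u v) + (\<Sum>i<len u v. bl u v i))"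
  proof (rule ipath_concat[OF a1 mid])
    fix a y assume a: "a \<in> arm u v" and y: "y \<in> mid" and cl: "close_pts a y"
    obtain p where p: "a = centre u + p" "in_arm M (dir u v) p" "dir u v < 5" using armE[OF a E_arcs(1)[OF uv]] .
    obtain k where k: "k < len u v" "y \<in> blk u v k" using y by (auto simp: mid_def)
    from arm_blk[OF uv k E_verts(1)[OF uv] p(3,2) cl[unfolded p(1)]]
    show "a = scale_pt M (P u v 0) \<or> y = scale_pt M (P u v 0)"
      using P_0[OF uv] p(1) by (auto simp: centre_def scale_add)
  qed
  then have "ipath (arm u v \<union> mid \<union> arm v u) (centre u) (centre v) (al (dir u v) + (\<Sum>i<len u v. bl u v i) + al (dir v u))"
  proof (rule ipath_concat[OF _ a2])
    fix y a assume y: "y \<in> arm u v \<union> mid" and a: "a \<in> arm v u" and cl: "close_pts y a"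
    obtain p where p: "a = centre v + p" "in_arm M (dir v u) p" "dir v u < 5" using armE[OF a E_arcs(2)[OF uv]] .
    show "y = scale_pt M (P u v (len u v)) \<or> a = scale_pt M (P u v (len u v))"
    proof (cases "y \<in> arm u v")
      case True
      obtain r where r: "y = centre u + r" "in_arm M (dir u v) r" "dir u v < 5" using armE[OF True E_arcs(1)[OF uv]] .
      then show ?thesis using arms_far[OF E_verts[OF uv] r(3) p(3) r(2) p(2)] cl p(1) by simp
    next
      case False
      then obtain k where k: "k < len u v" "y \<in> blk u v k" using y by (auto simp: mid_def)
      from arm_blk[OF uv k E_verts(2)[OF uv] p(3,2)] close_sym[OF cl] p(1)
      show ?thesis using P_len[OF uv] by (auto simp: centre_def scale_add)
    qed
  qed
  then show ?thesis by (simp add: route_def mid_def)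
qed

lemma routeE:
  assumes a: "a \<in> route u v" and uv: "(u, v) \<in> E"
  obtains w w' p where "{w, w'} = {u, v}" "(w, w') \<in> parcs G" "a = centre w + p" "in_arm M (dir w w') p" "dir w w' < 5"
    "w = u \<and> P u v 0 = q w + port_dir (dir w w') \<or> w = v \<and> P u v (len u v) = q w + port_dir (dir w w')"
  | k where "k < len u v" "a \<in> blk u v k"
proof -
  consider "a \<in> arm u v" | "a \<in> arm v u" | k where "k < len u v" "a \<in> blk u v k"
    using a unfolding route_def by blast
  then show thesis
  proof cases
    case 1
    obtain p where "a = centre u + p" "in_arm M (dir u v) p" "dir u v < 5" using armE[OF 1 E_arcs(1)[OF uv]] .
    then show thesis using that(1)[of u v p] E_arcs[OF uv] P_0[OF uv] by simp
  next
    case 2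
    obtain p where "a = centre v + p" "in_arm M (dir v u) p" "dir v u < 5" using armE[OF 2 E_arcs(2)[OF uv]] .
    then show thesis using that(1)[of v u p] E_arcs[OF uv] P_len[OF uv] by (simp add: insert_commute)
  next
    case 3
    then show thesis by (rule that(2))
  qed
qed

lemma arm_blk_other:
  assumes uv: "(u, v) \<in> E" and xy: "(x, y) \<in> E" and neq: "(u, v) \<noteq> (x, y)"
    and port: "w = u \<and> P u v 0 = q w + port_dir i \<or> w = v \<and> P u v (len u v) = q w + port_dir i"
    and p: "in_arm M i p" "i < 5" and k: "k < len x y" "b \<in> blk x y k"
  shows "\<not> close_pts (centre w + p) b"
proof
  assume cl: "close_pts (centre w + p) b"
  have w: "w \<in> pverts G" using port E_verts[OF uv] by blast
  from arm_blk[OF xy k w p(2,1) cl] obtain t where t: "t \<le> len x y" "P x y t = q w + port_dir i" by blast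
  then show False using port P_disj[OF uv xy neq, of 0 t] P_disj[OF uv xy neq, of "len u v" t] by auto
qed

text \<open>An arm close to a block would share its port with the path of another edge, contrary to
  \<open>P_disj\<close>. What remains are two arms at a common vertex, which come close only if one
  of the points is the centre.\<close>

lemma routes_apart:
  assumes uv: "(u, v) \<in> E" and xy: "(x, y) \<in> E" and neq: "(u, v) \<noteq> (x, y)"
    and a: "a \<in> route u v" and b: "b \<in> route x y" and cl: "close_pts a b"
  shows "\<exists>w\<in>{u, v} \<inter> {x, y}. a = centre w \<or> b = centre w"
  using a uv
proof (cases rule: routeE)
  case (1 w w' p)
  note A = 1
  have w: "w \<in> pverts G" using A(2) G.in_arcsD1 by blast
  from b xy show ?thesis
  proof (cases rule: routeE)
    case (1 s s' r)
    note B = 1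
    have s: "s \<in> pverts G" using B(2) G.in_arcsD1 by blast
    show ?thesis
    proof (cases "w = s")
      case False
      then show ?thesis using arms_far[OF w s False A(5) B(5) A(4) B(4)] cl A(3) B(3) by simp
    next
      case True
      have "w' \<noteq> s'"
      proof
        assume "w' = s'"
        then have "{u, v} = {x, y}" using A(1) B(1) True by simp
        then show False using neq uv xy E_asym by (auto simp: doubleton_eq_iff)
      qed
      then have "dir w w' \<noteq> dir s s'" using dir_inj A(2) B(2) True by blast
      moreover have "close_pts p r" using cl A(3) B(3) True by (simp add: close_pts_def)
      ultimately have "p = (0, 0) \<or> r = (0, 0)" using arms_apart[OF _ A(5) B(5) A(4) B(4)] by blast
      then have "a = centre w \<or> b = centre w" using A(3) B(3) True by (auto simp: zero_prod_def[symmetric])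
      moreover have "w \<in> {u, v} \<inter> {x, y}" using A(1) B(1) True by blast
      ultimately show ?thesis by blast
    qed
  next
    case (2 k)
    then show ?thesis using arm_blk_other[OF uv xy neq A(6) A(4,5) 2] cl A(3) by simp
  qed
next
  case (2 k)
  note A = 2
  from b xy show ?thesis
  proof (cases rule: routeE)
    case (1 s s' r)
    then show ?thesis using arm_blk_other[OF xy uv neq[symmetric] 1(6) 1(4,5) A] close_sym[OF cl] by simp
  next
    case (2 j)
    then show ?thesis using blk_apart[OF uv A(1) xy 2(1) _ A(2) 2(2) cl] neq by blast
  qed
qed

lemma centre_route:
  assumes w: "w \<in> pverts G" and uv: "(u, v) \<in> E" and a: "a \<in> route u v" and cl: "close_pts (centre w) a"
  shows "w \<in> {u, v}"
  using a uv
proof (cases rule: routeE)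
  case (1 s s' p)
  have "s \<in> pverts G" using 1(2) G.in_arcsD1 by blast
  moreover have "centre w = centre w + (0, 0)" by (simp add: zero_prod_def[symmetric])
  ultimately have "w = s"
    using arms_far[OF w _ _ 1(5,5) in_arm_0[OF 1(5)] 1(4)] cl 1(3) by metis
  then show ?thesis using 1(1) by blast
next
  case (2 k)
  then show ?thesis using blk_far[OF uv 2 w] cl by blast
qed

lemma fine_drawing_exists:
  assumes total: "\<And>u v. (u, v) \<in> E \<Longrightarrow> al (dir u v) + (\<Sum>i<len u v. bl u v i) + al (dir v u) = L" and L: "2 \<le> L"
  shows "\<exists>c \<Phi>. fine_drawing G c \<Phi> L"
proof -
  have "\<forall>e\<in>E. \<exists>f. f 0 = centre (fst e) \<and> f L = centre (snd e) \<and> route (fst e) (snd e) = f ` {..L} \<and> inj_on f {..L} \<and>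
     (\<forall>i<L. close_pts (f i) (f (Suc i))) \<and>
     (\<forall>i\<le>L. \<forall>j\<le>L. close_pts (f i) (f j) \<longrightarrow> i = j \<or> i = Suc j \<or> j = Suc i)"
    using route_path total unfolding ipath_def by auto
  from bchoice[OF this] obtain F where F: "\<forall>e\<in>E. F e 0 = centre (fst e) \<and> F e L = centre (snd e) \<and>
     route (fst e) (snd e) = F e ` {..L} \<and> inj_on (F e) {..L} \<and>
     (\<forall>i<L. close_pts (F e i) (F e (Suc i))) \<and>
     (\<forall>i\<le>L. \<forall>j\<le>L. close_pts (F e i) (F e j) \<longrightarrow> i = j \<or> i = Suc j \<or> j = Suc i)" by (elim exE)
  have F_ends: "F (u, v) 0 = centre u" "F (u, v) L = centre v" and F_route: "i \<le> L \<Longrightarrow> F (u, v) i \<in> route u v"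
    and F_inj: "inj_on (F (u, v)) {..L}" and F_Suc: "i < L \<Longrightarrow> close_pts (F (u, v) i) (F (u, v) (Suc i))"
    and F_close: "i \<le> L \<Longrightarrow> j \<le> L \<Longrightarrow> close_pts (F (u, v) i) (F (u, v) j) \<Longrightarrow> i = j \<or> i = Suc j \<or> j = Suc i"
    if "(u, v) \<in> E" for u v i j
    using bspec[OF F that] by simp_all
  define \<Phi> where "\<Phi> u v i = (if (u, v) \<in> E then F (u, v) i else F (v, u) (L - i))" for u v i
  have rep: "\<exists>x y. (x, y) \<in> E \<and> {x, y} = {u, v} \<and> ((x, y) = (u, v) \<and> \<Phi> u v = F (x, y) \<or> (x, y) = (v, u) \<and> \<Phi> u v = (\<lambda>i. F (x, y) (L - i)))"
    if "(u, v) \<in> parcs G" for u v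
    using E_or[OF that] E_asym by (cases "(u, v) \<in> E") (auto simp: \<Phi>_def fun_eq_iff insert_commute)
  have on_route: "\<exists>x y. (x, y) \<in> E \<and> {x, y} = {u, v} \<and> \<Phi> u v i \<in> route x y" if "(u, v) \<in> parcs G" "i \<le> L" for u v i
    using rep[OF that(1)] that(2) F_route[of _ _ i] F_route[of _ _ "L - i"] by fastforce
  have "fine_drawing G centre \<Phi> L"
  proof
    fix u v i j assume uv: "(u, v) \<in> parcs G"
    from rep[OF uv] obtain x y where xy: "(x, y) \<in> E"
      "(x, y) = (u, v) \<and> \<Phi> u v = F (x, y) \<or> (x, y) = (v, u) \<and> \<Phi> u v = (\<lambda>i. F (x, y) (L - i))" by blast
    show "\<Phi> u v 0 = centre u" using xy F_ends[OF xy(1)] by auto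
    show "\<Phi> v u i = \<Phi> u v (L - i)" if "i \<le> L"
      using xy E_asym that by (auto simp: \<Phi>_def)
    show "i = j \<or> i = Suc j \<or> j = Suc i" if "i \<le> L" "j \<le> L" "close_pts (\<Phi> u v i) (\<Phi> u v j)"
    proof -
      have "i = j \<or> i = Suc j \<or> j = Suc i \<or> L - i = L - j \<or> L - i = Suc (L - j) \<or> L - j = Suc (L - i)"
        using xy(2) F_close[OF xy(1), of i j] F_close[OF xy(1), of "L - i" "L - j"] that by auto
      then show ?thesis using that(1,2) by linarith
    qed
    show "close_pts (\<Phi> u v i) (\<Phi> u v (Suc i))" if "i < L"
      using xy(2) F_Suc[OF xy(1), of i] close_sym[OF F_Suc[OF xy(1), of "L - Suc i"]] that
      by (auto simp: Suc_diff_Suc)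
    show "inj_on (\<Phi> u v) {..L}"
      using xy(2)
    proof (elim disjE conjE)
      assume "\<Phi> u v = (\<lambda>i. F (x, y) (L - i))"
      moreover have "inj_on (\<lambda>i. F (x, y) (L - i)) {..L}"
      proof (rule inj_onI)
        fix i j assume ij: "i \<in> {..L}" "j \<in> {..L}" "F (x, y) (L - i) = F (x, y) (L - j)"
        then have "L - i = L - j" using inj_onD[OF F_inj[OF xy(1)] ij(3)] by simp
        then show "i = j" using ij by simp
      qed
      ultimately show ?thesis by simp
    qed (use F_inj[OF xy(1)] in simp)
  next
    fix u v x y i j
    assume uv: "(u, v) \<in> parcs G" and xy: "(x, y) \<in> parcs G" and neq: "{u, v} \<noteq> {x, y}" and ij: "i \<le> L" "j \<le> L"
      and cl: "close_pts (\<Phi> u v i) (\<Phi> x y j)"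
    obtain u' v' where 1: "(u', v') \<in> E" "{u', v'} = {u, v}" "\<Phi> u v i \<in> route u' v'" using on_route[OF uv ij(1)] by blast
    obtain x' y' where 2: "(x', y') \<in> E" "{x', y'} = {x, y}" "\<Phi> x y j \<in> route x' y'" using on_route[OF xy ij(2)] by blast
    have "(u', v') \<noteq> (x', y')" using neq 1(2) 2(2) by auto
    from routes_apart[OF 1(1) 2(1) this 1(3) 2(3) cl] show "\<exists>w\<in>{u, v} \<inter> {x, y}. \<Phi> u v i = centre w \<or> \<Phi> x y j = centre w"
      unfolding 1(2) 2(2) .
  next
    fix w u v i assume w: "w \<in> pverts G" and uv: "(u, v) \<in> parcs G" and i: "i \<le> L" and cl: "close_pts (centre w) (\<Phi> u v i)"
    obtain u' v' where 1: "(u', v') \<in> E" "{u', v'} = {u, v}" "\<Phi> u v i \<in> route u' v'" using on_route[OF uv i] by blast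
    from centre_route[OF w 1(1,3) cl] show "w \<in> {u, v}" unfolding 1(2) .
  next
    fix u v assume uv: "u \<in> pverts G" "v \<in> pverts G" and cl: "close_pts (centre u) (centre v)"
    show "u = v"
    proof (rule ccontr)
      assume "u \<noteq> v"
      from arms_far[OF uv this _ _ in_arm_0 in_arm_0, of 0 0] cl show False
        by (simp add: zero_prod_def[symmetric])
    qed
  qed (use L graph in auto)
  then show ?thesis by blast
qed

end

text \<open>All routes get the same length by lengthening their first blocks. Lengths are even because the
  scaling factor is even and every arm has odd length.\<close>

theorem (in coarse_drawing) fine_drawing_exists:
  "\<exists>c \<Phi> L. fine_drawing G c \<Phi> L"
proof -
  interpret G: pair_graph G by (rule graph)
  have finE: "finite E" using E_sub G.pair_finite_arcs finite_subset by blast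
  define N where "N = Max (insert 0 ((\<lambda>(u, v). len u v) ` E))"
  have N: "len u v \<le> N" if "(u, v) \<in> E" for u v
    unfolding N_def using finE that by (intro Max_ge) (auto intro: rev_image_eqI)
  \<comment> \<open>A route has at most \<open>N\<close> blocks of \<open>m\<close> steps and two
    arms of at most \<open>2 * m\<close> steps, so no detour exceeds \<open>(N + 4) * m\<close>.
    Since \<open>m0\<close> depends on \<open>N\<close> only, \<open>m\<close> can be chosen
    afterwards.\<close>
  obtain m0 where m0: "\<forall>m\<ge>m0. \<forall>j\<le>(N + 4) * m. \<exists>S. ipath S (0, 0) (10 * int m, 0) (m + 2 * j) \<and> (\<forall>p\<in>S. block_region (10 * int m) p)"
    using ipath_block[of "N + 4"] by blast
  define m where "m = 2 * (m0 + 10)"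
  have m: "m0 \<le> m" "10 \<le> m" "even m" by (simp_all add: m_def)
  have "\<forall>i\<in>{..<5}. \<exists>S n. ipath S (0, 0) (scale_pt (10 * int m) (port_dir i)) n \<and> odd n \<and> n \<le> 2 * m \<and>
      (\<forall>p\<in>S. in_arm (10 * int m) i p)"
    using ipath_arm[of m] m by simp
  from bchoice[OF this] obtain A where "\<forall>i\<in>{..<5}. \<exists>n. ipath (A i) (0, 0) (scale_pt (10 * int m) (port_dir i)) n \<and> odd n \<and> n \<le> 2 * m \<and>
      (\<forall>p\<in>A i. in_arm (10 * int m) i p)" by (elim exE)
  from bchoice[OF this] obtain al where A: "\<forall>i\<in>{..<5}. ipath (A i) (0, 0) (scale_pt (10 * int m) (port_dir i)) (al i) \<and> odd (al i) \<and> al i \<le> 2 * m \<and>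
      (\<forall>p\<in>A i. in_arm (10 * int m) i p)" by (elim exE)
  have al: "odd (al i)" "al i \<le> 2 * m" if "i < 5" for i using bspec[OF A, of i] that by simp_all
  define base where "base u v = al (dir u v) + len u v * m + al (dir v u)" for u v
  \<comment> \<open>The inserted 2 ensures \<open>2 \<le> L\<close> even for a graph without
    edges.\<close>
  define L where "L = Max (insert 2 ((\<lambda>(u, v). base u v) ` E))"
  have E_arcs: "(u, v) \<in> parcs G" "(v, u) \<in> parcs G" if "(u, v) \<in> E" for u v
    using that E_sub G.arcs_symmetric by auto
  have base: "even (base u v)" "base u v \<le> (N + 4) * m" if "(u, v) \<in> E" for u v
  proof -
    note d = dir_less[OF E_arcs(1)[OF that]] dir_less[OF E_arcs(2)[OF that]]
    show "even (base u v)" using al(1)[OF d(1)] al(1)[OF d(2)] m(3) by (simp add: base_def)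
    have "len u v * m \<le> N * m" using N[OF that] by (rule mult_le_mono1)
    then have "base u v \<le> N * m + 4 * m" using al(2)[OF d(1)] al(2)[OF d(2)] unfolding base_def by linarith
    then show "base u v \<le> (N + 4) * m" by (simp only: add_mult_distrib)
  qed
  have fin: "finite (insert 2 ((\<lambda>(u, v). base u v) ` E))" using finE by simp
  have L2: "2 \<le> L" unfolding L_def using fin by (intro Max_ge) simp_all
  have L: "base u v \<le> L" if "(u, v) \<in> E" for u v
    unfolding L_def using fin that by (intro Max_ge) (auto intro: rev_image_eqI)
  have L_in: "L \<in> insert 2 ((\<lambda>(u, v). base u v) ` E)"
    unfolding L_def using fin by (intro Max_in) auto
  have L_even: "even L" and L_le: "L \<le> (N + 4) * m"
  proof -
    have "2 \<le> (N + 4) * m" using mult_le_mono[of 1 "N + 4" 2 m] m(2) by simp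
    then show "even L" "L \<le> (N + 4) * m" using L_in base by auto
  qed
  define B where "B u v i = (SOME S. ipath S (0, 0) (10 * int m, 0) (m + 2 * (if i = 0 then (L - base u v) div 2 else 0)) \<and>
      (\<forall>p\<in>S. block_region (10 * int m) p))" for u v :: 'a and i :: nat
  have B: "ipath (B u v i) (0, 0) (10 * int m, 0) (m + 2 * (if i = 0 then (L - base u v) div 2 else 0)) \<and>
      (\<forall>p\<in>B u v i. block_region (10 * int m) p)" for u v i
    unfolding B_def
  proof (rule someI_ex)
    have "(if i = 0 then (L - base u v) div 2 else 0) \<le> (N + 4) * m" using L_le by auto
    then show "\<exists>S. ipath S (0, 0) (10 * int m, 0) (m + 2 * (if i = 0 then (L - base u v) div 2 else 0)) \<and>
      (\<forall>p\<in>S. block_region (10 * int m) p)" using m0 m(1) by blast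
  qed
  interpret refined_drawing G E q dir P len "10 * int m" A al B "\<lambda>u v i. m + 2 * (if i = 0 then (L - base u v) div 2 else 0)"
  proof
    show "100 \<le> 10 * int m" using m(2) by simp
    show "ipath (A i) (0, 0) (scale_pt (10 * int m) (port_dir i)) (al i)" if "i < 5" for i using bspec[OF A, of i] that by simp
    show "in_arm (10 * int m) i p" if "i < 5" "p \<in> A i" for i p using bspec[OF A, of i] that by simp
  qed (use B in auto)
  have "al (dir u v) + (\<Sum>i<len u v. m + 2 * (if i = 0 then (L - base u v) div 2 else 0)) + al (dir v u) = L"
    if uv: "(u, v) \<in> E" for u v
  proof -
    obtain l where l: "len u v = Suc l" using len_pos[OF uv] by (cases "len u v") auto
    have "(\<Sum>i<Suc l. m + 2 * (if i = 0 then (L - base u v) div 2 else 0)) = Suc l * m + 2 * ((L - base u v) div 2)"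
      unfolding sum.lessThan_Suc_shift by simp
    also have "2 * ((L - base u v) div 2) = L - base u v" using L_even base(1)[OF uv] by simp
    finally show ?thesis using L[OF uv] unfolding base_def l by simp
  qed
  then show ?thesis using fine_drawing_exists L2 by blast
qed

section \<open>Discretizing paths in the plane\<close>

definition rnd :: "complex \<Rightarrow> int \<times> int" where
  "rnd z = (round (Re z), round (Im z))"

text \<open>Rounding two nearby points of a path may give diagonal neighbours in the grid; this set also
  contains the corners between them.\<close>

definition lat :: "complex set \<Rightarrow> (int \<times> int) set" where
  "lat S = {(round (Re w), round (Im w')) | w w'. w \<in> S \<and> w' \<in> S \<and> cmod (w - w') \<le> 1 / 2}"

definition grid_adj :: "(int \<times> int) set \<Rightarrow> ((int \<times> int) \<times> (int \<times> int)) set" where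
  "grid_adj T = {(x, y). x \<in> T \<and> y \<in> T \<and> y - x \<in> unit_vectors}"

lemma latI: "w \<in> S \<Longrightarrow> w' \<in> S \<Longrightarrow> cmod (w - w') \<le> 1 / 2 \<Longrightarrow> (round (Re w), round (Im w')) \<in> lat S"
  unfolding lat_def by blast

lemma rnd_in_lat: "z \<in> S \<Longrightarrow> rnd z \<in> lat S"
  unfolding rnd_def by (rule latI) simp_all

lemma round_add_int: "round (x + of_int n) = round x + n" for x :: real
  unfolding round_def by (metis add.assoc add.commute floor_add_int)

lemma round_diff_le_1:
  fixes x y :: real
  assumes "\<bar>x - y\<bar> \<le> 1"
  shows "\<bar>round x - round y\<bar> \<le> 1"
proof -
  have "round x \<le> round (y + of_int 1)" "round y \<le> round (x + of_int 1)"
    using assms by (intro round_mono; simp add: abs_le_iff)+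
  then show ?thesis unfolding round_add_int by linarith
qed

lemma grid_adj_mono: "S \<subseteq> T \<Longrightarrow> grid_adj S \<subseteq> grid_adj T"
  unfolding grid_adj_def by blast

lemma grid_adj_sym: "(x, y) \<in> (grid_adj T)\<^sup>* \<Longrightarrow> (y, x) \<in> (grid_adj T)\<^sup>*"
proof -
  have "sym (grid_adj T)"
  proof (rule symI)
    fix a b assume ab: "(a, b) \<in> grid_adj T"
    have "- d \<in> unit_vectors" if "d \<in> unit_vectors" for d
      using that by (auto simp: unit_vectors_def)
    from this[of "b - a"] show "(b, a) \<in> grid_adj T" using ab unfolding grid_adj_def by simp
  qed
  then show "(x, y) \<in> (grid_adj T)\<^sup>* \<Longrightarrow> (y, x) \<in> (grid_adj T)\<^sup>*" by (meson sym_rtrancl symD)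
qed

text \<open>The corner takes its first coordinate from \<open>w'\<close> and its second from
  \<open>w\<close>; this is why \<open>lat\<close> mixes the coordinates of nearby points.\<close>

lemma grid_step:
  assumes "w \<in> S" "w' \<in> S" "cmod (w - w') \<le> 1 / 2"
  shows "(rnd w, rnd w') \<in> (grid_adj (lat S))\<^sup>*"
proof -
  define c where "c = (round (Re w'), round (Im w))"
  have c: "c \<in> lat S" unfolding c_def by (rule latI) (use assms in \<open>simp_all add: norm_minus_commute\<close>)
  have w: "rnd w \<in> lat S" "rnd w' \<in> lat S" using assms rnd_in_lat by auto
  have "\<bar>Re w - Re w'\<bar> \<le> 1" "\<bar>Im w - Im w'\<bar> \<le> 1"
    using abs_Re_le_cmod[of "w - w'"] abs_Im_le_cmod[of "w - w'"] assms(3) by auto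
  then have r: "\<bar>round (Re w) - round (Re w')\<bar> \<le> 1" "\<bar>round (Im w) - round (Im w')\<bar> \<le> 1"
    by (auto intro: round_diff_le_1)
  have "rnd w = c \<or> (rnd w, c) \<in> grid_adj (lat S)"
    using r(1) w(1) c unfolding c_def rnd_def grid_adj_def unit_vectors_def by auto
  moreover have "c = rnd w' \<or> (c, rnd w') \<in> grid_adj (lat S)"
    using r(2) w(2) c unfolding c_def rnd_def grid_adj_def unit_vectors_def by auto
  ultimately show ?thesis by (auto intro: rtrancl_trans)
qed

text \<open>By uniform continuity a fine subdivision of the unit interval gives consecutive points
  within 1 / 2 of each other.\<close>

lemma path_grid_connected:
  assumes "path g"
  shows "(rnd (pathstart g), rnd (pathfinish g)) \<in> (grid_adj (lat (path_image g)))\<^sup>*"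
proof -
  have "uniformly_continuous_on {0..1} g"
    using assms unfolding path_def by (intro compact_uniformly_continuous) auto
  then obtain d where d: "0 < d" "\<And>s t. s \<in> {0..1} \<Longrightarrow> t \<in> {0..1} \<Longrightarrow> dist t s < d \<Longrightarrow> dist (g t) (g s) < 1 / 2"
    unfolding uniformly_continuous_on_def by (metis half_gt_zero_iff zero_less_one)
  obtain n :: nat where n: "0 < n" "1 / real n < d"
    using real_arch_inverse[of d] d(1) by (auto simp: inverse_eq_divide)
  define t where "t i = real i / real n" for i
  have t01: "t i \<in> {0..1}" if "i \<le> n" for i using that n by (simp add: t_def)
  have "(rnd (g (t 0)), rnd (g (t i))) \<in> (grid_adj (lat (path_image g)))\<^sup>*" if "i \<le> n" for i
    using that
  proof (induction i)
    case (Suc i)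
    have "t (Suc i) - t i = 1 / real n" using n by (simp add: t_def diff_divide_distrib[symmetric])
    moreover have "0 < 1 / real n" using n by simp
    ultimately have "dist (t i) (t (Suc i)) < d" using n(2) unfolding dist_real_def by linarith
    then have "cmod (g (t i) - g (t (Suc i))) \<le> 1 / 2"
      using d(2)[OF t01 t01, of "Suc i" i] Suc.prems by (simp add: dist_norm)
    moreover have "g (t i) \<in> path_image g" "g (t (Suc i)) \<in> path_image g"
      using t01 Suc.prems by (auto simp: path_image_def)
    ultimately show ?case using Suc grid_step rtrancl_trans by (metis Suc_leD)
  qed simp
  from this[of n] show ?thesis using n by (simp add: t_def pathstart_def pathfinish_def)
qed

text \<open>A shortest walk repeats no vertex, since a repetition could be cut out.\<close>

lemma rtrancl_simple_path:
  assumes "(a, b) \<in> R\<^sup>*"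
  shows "\<exists>f n. f 0 = a \<and> f n = b \<and> (\<forall>i<n. (f i, f (Suc i)) \<in> R) \<and> inj_on f {..n::nat}"
proof -
  define n where "n = (LEAST n. (a, b) \<in> R ^^ n)"
  have n: "(a, b) \<in> R ^^ n" and least: "\<And>m. (a, b) \<in> R ^^ m \<Longrightarrow> n \<le> m"
    using rtrancl_imp_relpow[OF assms] by (auto simp: n_def intro: LeastI Least_le)
  obtain f where f: "f 0 = a" "f n = b" "\<forall>i<n. (f i, f (Suc i)) \<in> R"
    using n unfolding relpow_fun_conv by blast
  have seg: "(f i, f (i + k)) \<in> R ^^ k" if "i + k \<le> n" for i k
    unfolding relpow_fun_conv using f(3) that by (intro exI[of _ "\<lambda>j. f (i + j)"]) auto
  have "inj_on f {..n}"
  proof (rule linorder_inj_onI')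
    fix i j assume ij: "i \<in> {..n}" "j \<in> {..n}" "i < j"
    show "f i \<noteq> f j"
    proof
      assume eq: "f i = f j"
      have "(a, f i) \<in> R ^^ i" using seg[of 0 i] f(1) ij by simp
      moreover have "(f i, b) \<in> R ^^ (n - j)" using seg[of j "n - j"] f(2) ij eq by simp
      ultimately have "(a, b) \<in> R ^^ (i + (n - j))" by (auto simp: relpow_add)
      then show False using least ij by fastforce
    qed
  qed
  then show ?thesis using f by blast
qed

lemma lat_near:
  assumes "z \<in> lat S"
  shows "\<exists>w\<in>S. \<bar>of_int (fst z) - Re w\<bar> \<le> 1 \<and> \<bar>of_int (snd z) - Im w\<bar> \<le> 1"
proof -
  obtain w w' where w: "z = (round (Re w), round (Im w'))" "w \<in> S" "w' \<in> S" "cmod (w - w') \<le> 1 / 2"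
    using assms unfolding lat_def by blast
  have "\<bar>Im w - Im w'\<bar> \<le> 1 / 2" using abs_Im_le_cmod[of "w - w'"] w(4) by simp
  moreover have "\<bar>of_int (round (Re w)) - Re w\<bar> \<le> 1 / 2" "\<bar>of_int (round (Im w')) - Im w'\<bar> \<le> 1 / 2"
    using of_int_round_abs_le by auto
  ultimately have "\<bar>of_int (fst z) - Re w\<bar> \<le> 1 \<and> \<bar>of_int (snd z) - Im w\<bar> \<le> 1"
    unfolding w(1) fst_conv snd_conv by linarith
  then show ?thesis using w(2) by blast
qed

lemma finite_separation:
  fixes F :: "(complex set \<times> complex set) set"
  assumes "finite F" "\<And>S T. (S, T) \<in> F \<Longrightarrow> compact S \<and> compact T \<and> S \<inter> T = {}"
  shows "\<exists>\<eta>>0. \<forall>(S, T)\<in>F. \<forall>x\<in>S. \<forall>y\<in>T. \<eta> \<le> dist x y"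
  using assms
proof (induction F)
  case empty
  then show ?case using zero_less_one by blast
next
  case (insert e F)
  obtain S T where e: "e = (S, T)" by (cases e)
  obtain \<eta> where \<eta>: "\<eta> > 0" "\<forall>(S, T)\<in>F. \<forall>x\<in>S. \<forall>y\<in>T. \<eta> \<le> dist x y" using insert by blast
  have "compact S" "closed T" "S \<inter> T = {}" using insert.prems[of S T] e by (auto intro: compact_imp_closed)
  from separate_compact_closed[OF this] obtain d where d: "d > 0" "\<forall>x\<in>S. \<forall>y\<in>T. d \<le> dist x y" by blast
  have "\<forall>(S, T)\<in>insert e F. \<forall>x\<in>S. \<forall>y\<in>T. min \<eta> d \<le> dist x y"
    using \<eta>(2) d(2) unfolding e by fastforce
  then show ?case using \<eta>(1) d(1) by (intro exI[of _ "min \<eta> d"]) simp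
qed

section \<open>The part of an edge between two discs\<close>

text \<open>The path is cut at its last point in the disc around \<open>a\<close>, found as the
  first hit of the reversed path, and then at the next point in the disc around
  \<open>b\<close>.\<close>

lemma arc_between_discs:
  fixes g :: "real \<Rightarrow> complex"
  assumes g: "path g" "pathstart g = a" "pathfinish g = b" and d: "0 < \<delta>" "2 * \<delta> < dist a b"
  obtains k where "path k" "path_image k \<subseteq> path_image g" "dist a (pathstart k) = \<delta>" "dist b (pathfinish k) = \<delta>"
    "\<And>x. x \<in> path_image k \<Longrightarrow> x = pathstart k \<or> \<delta> < dist a x" "\<And>x. x \<in> path_image k \<Longrightarrow> x = pathfinish k \<or> \<delta> < dist b x"
proof -
  have int: "interior (- cball c \<delta>) = - cball c \<delta>" for c :: complex by (simp add: interior_open open_Compl)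
  have front: "frontier (- cball c \<delta>) = sphere c \<delta>" for c :: complex
    using d(1) by (simp add: frontier_complement)
  have ab: "b \<notin> cball a \<delta>" "a \<notin> cball b \<delta>" using d by (auto simp: dist_commute)
  have start: "pathstart (reversepath g) \<in> closure (- cball a \<delta>)" using g ab closure_subset by fastforce
  have "pathfinish (reversepath g) \<notin> - cball a \<delta>" using g d(1) by simp
  from exists_path_subpath_to_frontier[OF _ start this] g(1)
  obtain h where h: "path h" "pathstart h = pathstart (reversepath g)" "path_image h \<subseteq> path_image (reversepath g)"
    "path_image h - {pathfinish h} \<subseteq> interior (- cball a \<delta>)" "pathfinish h \<in> frontier (- cball a \<delta>)"
    by (metis path_reversepath)
  note h = h[unfolded int front pathstart_reversepath path_image_reversepath g(3)]
  have "pathfinish h \<notin> cball b \<delta>"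
  proof
    assume "pathfinish h \<in> cball b \<delta>"
    then have "dist a b \<le> \<delta> + \<delta>" using h(5) dist_triangle2[of a b "pathfinish h"] by (simp add: dist_commute)
    then show False using d by simp
  qed
  then have start: "pathstart (reversepath h) \<in> closure (- cball b \<delta>)" using closure_subset by fastforce
  have "pathfinish (reversepath h) \<notin> - cball b \<delta>" using h(2) d(1) by simp
  from exists_path_subpath_to_frontier[OF _ start this] h(1)
  obtain k where k: "path k" "pathstart k = pathstart (reversepath h)" "path_image k \<subseteq> path_image (reversepath h)"
    "path_image k - {pathfinish k} \<subseteq> interior (- cball b \<delta>)" "pathfinish k \<in> frontier (- cball b \<delta>)"
    by (metis path_reversepath)
  note k = k[unfolded int front pathstart_reversepath path_image_reversepath]
  show thesis
  proof (rule that[OF k(1)])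
    show "path_image k \<subseteq> path_image g" using k(3) h(3) by blast
    show "dist a (pathstart k) = \<delta>" using h(5) k(2) by simp
    show "dist b (pathfinish k) = \<delta>" using k(5) by simp
    show "x = pathstart k \<or> \<delta> < dist a x" if "x \<in> path_image k" for x
      using that k(2,3) h(4) by fastforce
    show "x = pathfinish k \<or> \<delta> < dist b x" if "x \<in> path_image k" for x
      using that k(4) by fastforce
  qed
qed

section \<open>Prescribing the directions at the vertices\<close>

text \<open>The arguments of the vectors \<open>port_dir i\<close>, which are listed
  counterclockwise.\<close>

definition port_angle :: "nat \<Rightarrow> real" where
  "port_angle i = [0, pi / 2, 3 * pi / 4, 5 * pi / 4, 3 * pi / 2] ! i"

lemma port_angle_mono: "i < j \<Longrightarrow> j < 5 \<Longrightarrow> port_angle i < port_angle j"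
  using pi_gt_zero by (elim less_5_cases) (auto simp: port_angle_def less_Suc_eq numeral_eq_Suc)

lemma port_angle_range: "i < 5 \<Longrightarrow> 0 \<le> port_angle i \<and> port_angle i < 2 * pi"
  using pi_gt_zero by (elim less_5_cases) (auto simp: port_angle_def)

text \<open>The curves \<open>k u v\<close> meet the discs of radius \<open>\<delta>\<close> around
  the vertices only in their own ends, so the inside of the discs can be redrawn freely.\<close>

locale disc_drawing =
  fixes G :: "'a pair_pre_digraph" and p :: "'a \<Rightarrow> complex" and E :: "('a \<times> 'a) set"
    and \<delta> :: real and k :: "'a \<Rightarrow> 'a \<Rightarrow> real \<Rightarrow> complex"
  assumes graph: "pair_graph G"
    and E_sub: "E \<subseteq> parcs G" and E_or: "(u, v) \<in> parcs G \<Longrightarrow> (u, v) \<in> E \<or> (v, u) \<in> E"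
    and E_asym: "(u, v) \<in> E \<Longrightarrow> (v, u) \<notin> E"
    and deg: "u \<in> pverts G \<Longrightarrow> card {v. (u, v) \<in> parcs G} \<le> 5"
    and \<delta>: "0 < \<delta>"
    and p_far: "u \<in> pverts G \<Longrightarrow> w \<in> pverts G \<Longrightarrow> u \<noteq> w \<Longrightarrow> 4 * \<delta> < dist (p u) (p w)"
    and k_path: "(u, v) \<in> E \<Longrightarrow> path (k u v)"
    and k_start: "(u, v) \<in> E \<Longrightarrow> dist (p u) (pathstart (k u v)) = \<delta>"
    and k_finish: "(u, v) \<in> E \<Longrightarrow> dist (p v) (pathfinish (k u v)) = \<delta>"
    and k_far: "(u, v) \<in> E \<Longrightarrow> w \<in> pverts G \<Longrightarrow> z \<in> path_image (k u v) \<Longrightarrow>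
      \<delta> < dist (p w) z \<or> w = u \<and> z = pathstart (k u v) \<or> w = v \<and> z = pathfinish (k u v)"
    and k_disj: "(u, v) \<in> E \<Longrightarrow> (x, y) \<in> E \<Longrightarrow> (u, v) \<noteq> (x, y) \<Longrightarrow> path_image (k u v) \<inter> path_image (k x y) = {}"
begin

sublocale G: pair_graph G by (rule graph)

lemma arcs_verts: "(u, v) \<in> parcs G \<Longrightarrow> u \<in> pverts G" "(u, v) \<in> parcs G \<Longrightarrow> v \<in> pverts G" "(u, v) \<in> parcs G \<Longrightarrow> u \<noteq> v"
  using G.in_arcsD1 G.in_arcsD2 G.pair_no_loops by fastforce+

lemma E_arcs: "(u, v) \<in> E \<Longrightarrow> (u, v) \<in> parcs G" "(u, v) \<in> E \<Longrightarrow> (v, u) \<in> parcs G"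
  using E_sub G.arcs_symmetric by auto

definition exit_point :: "'a \<Rightarrow> 'a \<Rightarrow> complex" where
  "exit_point u v = (if (u, v) \<in> E then pathstart (k u v) else pathfinish (k v u))"

definition \<theta> :: "'a \<Rightarrow> 'a \<Rightarrow> real" where
  "\<theta> u v = Arg2pi (exit_point u v - p u)"

text \<open>The rank among the actual exit angles at \<open>u\<close>. Ports are thus assigned in
  the order of these angles, and the rank is below 5 by the degree bound.\<close>

definition dir :: "'a \<Rightarrow> 'a \<Rightarrow> nat" where
  "dir u v = card {w. (u, w) \<in> parcs G \<and> \<theta> u w < \<theta> u v}"

definition polar :: "'a \<Rightarrow> real \<Rightarrow> real \<Rightarrow> complex" where
  "polar u r \<phi> = p u + of_real r * cis \<phi>"

lemma dist_polar: "0 \<le> r \<Longrightarrow> dist (p u) (polar u r \<phi>) = r"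
  by (simp add: polar_def dist_norm norm_mult)

lemma polar_eq:
  assumes "0 < r" "0 < s" "0 \<le> \<phi>" "\<phi> < 2 * pi" "0 \<le> \<psi>" "\<psi> < 2 * pi" "polar u r \<phi> = polar u s \<psi>"
  shows "r = s \<and> \<phi> = \<psi>"
proof -
  have "Arg2pi (of_real r * cis \<phi>) = \<phi>"
    by (rule Arg2pi_unique[of r]) (use assms in \<open>simp_all add: cis_conv_exp\<close>)
  moreover have "Arg2pi (of_real s * cis \<psi>) = \<psi>"
    by (rule Arg2pi_unique[of s]) (use assms in \<open>simp_all add: cis_conv_exp\<close>)
  moreover have "of_real r * cis \<phi> = of_real s * cis \<psi>" using assms(7) by (simp add: polar_def)
  moreover have "r = s" using assms(1,2,7) dist_polar[of r u \<phi>] dist_polar[of s u \<psi>] by simp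
  ultimately show ?thesis by metis
qed

lemma exit_cases:
  assumes "(u, v) \<in> parcs G"
  obtains "(u, v) \<in> E" "exit_point u v = pathstart (k u v)" | "(v, u) \<in> E" "exit_point u v = pathfinish (k v u)"
  using E_or[OF assms] E_asym unfolding exit_point_def by (cases "(u, v) \<in> E") auto

lemma exit_dist: "(u, v) \<in> parcs G \<Longrightarrow> dist (p u) (exit_point u v) = \<delta>"
  by (erule exit_cases) (simp_all add: k_start k_finish)

lemma exit_neq:
  assumes "(u, v) \<in> parcs G" "(u, w) \<in> parcs G" "v \<noteq> w"
  shows "exit_point u v \<noteq> exit_point u w"
proof -
  have "\<exists>x y. (x, y) \<in> E \<and> {x, y} = {u, v} \<and> exit_point u v \<in> path_image (k x y)" if "(u, v) \<in> parcs G" for u v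
    by (rule exit_cases[OF that]) (metis pathstart_in_path_image, metis pathfinish_in_path_image insert_commute)
  from this[OF assms(1)] this[OF assms(2)]
  obtain x y x' y' where xy: "(x, y) \<in> E" "{x, y} = {u, v}" "exit_point u v \<in> path_image (k x y)"
    and xy': "(x', y') \<in> E" "{x', y'} = {u, w}" "exit_point u w \<in> path_image (k x' y')" by (elim exE conjE)
  have "(x, y) \<noteq> (x', y')" using xy(2) xy'(2) assms(3) by (auto simp: doubleton_eq_iff)
  then show ?thesis using k_disj[OF xy(1) xy'(1)] xy(3) xy'(3) by (metis disjoint_iff)
qed

lemma \<theta>_range: "0 \<le> \<theta> u v" "\<theta> u v < 2 * pi"
  by (simp_all add: \<theta>_def Arg2pi_ge_0 Arg2pi_lt_2pi)

lemma exit_polar: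
  assumes "(u, v) \<in> parcs G"
  shows "exit_point u v = polar u \<delta> (\<theta> u v)"
proof -
  have "cmod (exit_point u v - p u) = \<delta>" using exit_dist[OF assms] by (simp add: dist_norm norm_minus_commute)
  moreover have "exit_point u v - p u = of_real (cmod (exit_point u v - p u)) * exp (\<i> * of_real (\<theta> u v))"
    unfolding \<theta>_def by (rule Arg2pi_eq)
  ultimately show ?thesis by (simp add: polar_def cis_conv_exp algebra_simps)
qed

lemma \<theta>_neq: "(u, v) \<in> parcs G \<Longrightarrow> (u, w) \<in> parcs G \<Longrightarrow> v \<noteq> w \<Longrightarrow> \<theta> u v \<noteq> \<theta> u w"
  using exit_neq exit_polar by metis

lemma finite_nbrs: "finite {v. (u, v) \<in> parcs G}"
proof -
  have "{v. (u, v) \<in> parcs G} \<subseteq> snd ` parcs G" by force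
  then show ?thesis using G.pair_finite_arcs finite_surj by blast
qed

lemma dir_less:
  assumes "(u, v) \<in> parcs G"
  shows "dir u v < 5"
proof -
  have "dir u v < card {w. (u, w) \<in> parcs G}"
    unfolding dir_def using assms by (intro psubset_card_mono finite_nbrs) auto
  then show ?thesis using deg[OF arcs_verts(1)[OF assms]] by simp
qed

lemma dir_mono:
  assumes "(u, v) \<in> parcs G" "\<theta> u v < \<theta> u w"
  shows "dir u v < dir u w"
proof -
  have "finite {x. (u, x) \<in> parcs G \<and> \<theta> u x < \<theta> u w}" using finite_nbrs[of u] by (rule rev_finite_subset) auto
  then show ?thesis
    unfolding dir_def by (rule psubset_card_mono) (use assms in auto)
qed

lemma dir_inj: "(u, v) \<in> parcs G \<Longrightarrow> (u, w) \<in> parcs G \<Longrightarrow> dir u v = dir u w \<Longrightarrow> v = w"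
  using dir_mono[of u v w] dir_mono[of u w v] \<theta>_neq[of u v w] by (metis less_irrefl linorder_neqE_linordered_idom)

text \<open>Turning from the prescribed direction to the actual one keeps the order of the angles.\<close>

definition angle :: "'a \<Rightarrow> 'a \<Rightarrow> real \<Rightarrow> real" where
  "angle u v t = (1 - t) * port_angle (dir u v) + t * \<theta> u v"

definition spiral :: "'a \<Rightarrow> 'a \<Rightarrow> real \<Rightarrow> complex" where
  "spiral u v t = polar u (\<delta> * (1 + t) / 2) (angle u v t)"

definition ray :: "'a \<Rightarrow> 'a \<Rightarrow> complex set" where
  "ray u v = closed_segment (p u) (polar u (\<delta> / 2) (port_angle (dir u v)))"

lemma angle_range:
  assumes "(u, v) \<in> parcs G" "t \<in> {0..1}"
  shows "0 \<le> angle u v t" "angle u v t < 2 * pi"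
proof -
  note r = port_angle_range[OF dir_less[OF assms(1)]] \<theta>_range[of u v]
  show "0 \<le> angle u v t" using r assms(2) by (simp add: angle_def)
  have "angle u v t \<le> max (port_angle (dir u v)) (\<theta> u v)"
    unfolding angle_def using assms(2) by (intro convex_bound_le) auto
  then show "angle u v t < 2 * pi" using r by auto
qed

lemma angle_neq:
  assumes "(u, v) \<in> parcs G" "(u, w) \<in> parcs G" "v \<noteq> w" "t \<in> {0..1}"
  shows "angle u v t \<noteq> angle u w t"
proof -
  have less: "angle u v t < angle u w t"
    if "(u, v) \<in> parcs G" "(u, w) \<in> parcs G" "\<theta> u v < \<theta> u w" for v w
  proof -
    have "port_angle (dir u v) < port_angle (dir u w)"
      using port_angle_mono dir_mono[OF that(1,3)] dir_less[OF that(2)] by blast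
    then have "(1 - t) * port_angle (dir u v) \<le> (1 - t) * port_angle (dir u w)" "t = 0 \<or> t * \<theta> u v < t * \<theta> u w"
      using that(3) assms(4) by (auto intro!: mult_left_mono mult_strict_left_mono)
    then show ?thesis
      using \<open>port_angle (dir u v) < port_angle (dir u w)\<close> unfolding angle_def by (cases "t = 0") simp_all
  qed
  show ?thesis using \<theta>_neq[OF assms(1-3)] less[OF assms(1,2)] less[OF assms(2,1)] by (cases "\<theta> u v < \<theta> u w") simp_all
qed

section \<open>Spirals and rays inside the discs\<close>

lemma spiral_path: "path (spiral u v)"
  unfolding path_def spiral_def polar_def angle_def by (intro continuous_intros) simp

lemma spiral_ends:
  assumes "(u, v) \<in> parcs G"
  shows "pathstart (spiral u v) = polar u (\<delta> / 2) (port_angle (dir u v))" "pathfinish (spiral u v) = exit_point u v"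
  using exit_polar[OF assms] by (simp_all add: pathstart_def pathfinish_def spiral_def angle_def)

lemma spiral_pt:
  assumes "x \<in> path_image (spiral u v)"
  obtains t where "t \<in> {0..1}" "x = spiral u v t" "dist (p u) x = \<delta> * (1 + t) / 2"
proof -
  obtain t where t: "t \<in> {0..1}" "x = spiral u v t" using assms by (auto simp: path_image_def)
  have "dist (p u) x = \<delta> * (1 + t) / 2" unfolding t(2) spiral_def using t(1) \<delta> by (intro dist_polar) simp
  with t show thesis by (rule that)
qed

lemma spiral_dist:
  assumes "x \<in> path_image (spiral u v)"
  shows "\<delta> / 2 \<le> dist (p u) x" "dist (p u) x \<le> \<delta>"
proof -
  obtain t where t: "t \<in> {0..1}" "dist (p u) x = \<delta> * (1 + t) / 2" using assms by (rule spiral_pt)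
  have "\<delta> * t \<le> \<delta> * 1" "0 \<le> \<delta> * t" using t(1) \<delta> by (auto intro!: mult_left_mono)
  then show "\<delta> / 2 \<le> dist (p u) x" "dist (p u) x \<le> \<delta>" using t(2) by (simp_all add: algebra_simps)
qed

lemma ray_pt:
  assumes "x \<in> ray u v"
  obtains s where "s \<in> {0..1}" "x = polar u (s * \<delta> / 2) (port_angle (dir u v))" "dist (p u) x = s * \<delta> / 2"
proof -
  obtain s where s: "s \<in> {0..1}" "x = (1 - s) *\<^sub>R p u + s *\<^sub>R polar u (\<delta> / 2) (port_angle (dir u v))"
    using assms by (auto simp: ray_def closed_segment_def)
  then have "x = polar u (s * \<delta> / 2) (port_angle (dir u v))" by (simp add: polar_def scaleR_conv_of_real algebra_simps)
  moreover then have "dist (p u) x = s * \<delta> / 2" using dist_polar[of "s * \<delta> / 2" u] s(1) \<delta> by simp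
  ultimately show thesis using s(1) that by blast
qed

lemma ray_dist: "x \<in> ray u v \<Longrightarrow> dist (p u) x \<le> \<delta> / 2"
  using \<delta> by (auto elim!: ray_pt)

text \<open>The radius determines the parameter, so a common point would mean equal angles at the
  same time, which \<open>angle_neq\<close> excludes.\<close>

lemma spirals_disjoint:
  assumes "(u, v) \<in> parcs G" "(u, w) \<in> parcs G" "v \<noteq> w"
  shows "path_image (spiral u v) \<inter> path_image (spiral u w) = {}"
proof -
  have False if x: "x \<in> path_image (spiral u v)" "x \<in> path_image (spiral u w)" for x
  proof -
    obtain t where t: "t \<in> {0..1}" "x = spiral u v t" "dist (p u) x = \<delta> * (1 + t) / 2" using x(1) by (rule spiral_pt)
    obtain s where s: "s \<in> {0..1}" "x = spiral u w s" "dist (p u) x = \<delta> * (1 + s) / 2" using x(2) by (rule spiral_pt)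
    have "s = t" using t(3) s(3) \<delta> by simp
    have "0 < \<delta> * (1 + t) / 2" using t(1) \<delta> by simp
    then show False
      using polar_eq[OF _ _ angle_range[OF assms(1) t(1)] angle_range[OF assms(2) t(1)]] t(2) s(2) \<open>s = t\<close>
        angle_neq[OF assms t(1)] unfolding spiral_def by metis
  qed
  then show ?thesis by blast
qed

text \<open>Only the radius \<open>\<delta> / 2\<close> occurs on both, and there the spiral is
  still at its own port angle.\<close>

lemma spiral_ray_disjoint:
  assumes "(u, v) \<in> parcs G" "(u, w) \<in> parcs G" "v \<noteq> w"
  shows "path_image (spiral u v) \<inter> ray u w = {}"
proof -
  have False if x: "x \<in> path_image (spiral u v)" "x \<in> ray u w" for x
  proof -
    obtain t where t: "t \<in> {0..1}" "x = spiral u v t" "dist (p u) x = \<delta> * (1 + t) / 2" using x(1) by (rule spiral_pt)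
    obtain s where s: "s \<in> {0..1}" "x = polar u (s * \<delta> / 2) (port_angle (dir u w))" "dist (p u) x = s * \<delta> / 2" using x(2) by (rule ray_pt)
    have "1 + t = s" using t(3) s(3) \<delta> by simp
    then have "s = 1" "t = 0" using t(1) s(1) by simp_all
    then have eq: "polar u (\<delta> / 2) (angle u v 0) = polar u (\<delta> / 2) (angle u w 0)"
      using t(2) s(2) by (simp add: spiral_def angle_def)
    have z: "(0::real) \<in> {0..1}" by simp
    show False
      using polar_eq[OF _ _ angle_range[OF assms(1) z] angle_range[OF assms(2) z] eq] \<delta> angle_neq[OF assms z] by simp
  qed
  then show ?thesis by blast
qed

text \<open>On the closed disc around \<open>u\<close> a curve \<open>k x y\<close> has at most the
  exit point of its own edge, and the spiral reaches the boundary only in the exit point of its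
  edge.\<close>

lemma spiral_k_disjoint:
  assumes uv: "(u, v) \<in> parcs G" and xy: "(x, y) \<in> E" and neq: "{u, v} \<noteq> {x, y}"
  shows "path_image (spiral u v) \<inter> path_image (k x y) = {}"
proof -
  have False if z: "z \<in> path_image (spiral u v)" "z \<in> path_image (k x y)" for z
  proof -
    obtain t where t: "t \<in> {0..1}" "z = spiral u v t" "dist (p u) z = \<delta> * (1 + t) / 2" using z(1) by (rule spiral_pt)
    have le: "\<not> \<delta> < dist (p u) z" using spiral_dist[OF z(1)] by simp
    then have c: "u = x \<and> z = pathstart (k x y) \<or> u = y \<and> z = pathfinish (k x y)"
      using k_far[OF xy arcs_verts(1)[OF uv] z(2)] by simp
    then have "dist (p u) z = \<delta>" using k_start[OF xy] k_finish[OF xy] by auto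
    then have "t = 1" using t(3) \<delta> by simp
    then have zx: "z = exit_point u v" using t(2) spiral_ends(2)[OF uv] by (simp add: pathfinish_def)
    from c show False
    proof (elim disjE)
      assume "u = x \<and> z = pathstart (k x y)"
      then have "z = exit_point u y" "(u, y) \<in> parcs G" "y \<noteq> v" using xy E_arcs neq by (auto simp: exit_point_def)
      then show False using exit_neq[OF uv, of y] zx by simp
    next
      assume "u = y \<and> z = pathfinish (k x y)"
      then have "z = exit_point u x" "(u, x) \<in> parcs G" "x \<noteq> v" using xy E_arcs E_asym neq by (auto simp: exit_point_def)
      then show False using exit_neq[OF uv, of x] zx by simp
    qed
  qed
  then show ?thesis by blast
qed

lemma ray_k_disjoint:
  assumes "(u, v) \<in> parcs G" "(x, y) \<in> E"
  shows "ray u v \<inter> path_image (k x y) = {}"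
proof -
  have False if z: "z \<in> ray u v" "z \<in> path_image (k x y)" for z
    using k_far[OF assms(2) arcs_verts(1)[OF assms(1)] z(2)] ray_dist[OF z(1)] k_start[OF assms(2)] k_finish[OF assms(2)] \<delta> by auto
  then show ?thesis by blast
qed

lemma discs_disjoint:
  assumes "u \<in> pverts G" "w \<in> pverts G" "u \<noteq> w" "dist (p u) x \<le> \<delta>" "dist (p w) x \<le> \<delta>"
  shows False
  using p_far[OF assms(1-3)] dist_triangle2[of "p u" "p w" x] assms(4,5) \<delta> by linarith

definition outer :: "'a \<Rightarrow> 'a \<Rightarrow> real \<Rightarrow> complex" where
  "outer u v = spiral u v +++ (k u v +++ reversepath (spiral v u))"

lemma outer_props:
  assumes uv: "(u, v) \<in> E"
  shows "path (outer u v)" "pathstart (outer u v) = polar u (\<delta> / 2) (port_angle (dir u v))"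
    "pathfinish (outer u v) = polar v (\<delta> / 2) (port_angle (dir v u))"
    "path_image (outer u v) = path_image (spiral u v) \<union> path_image (k u v) \<union> path_image (spiral v u)"
proof -
  note a = E_arcs[OF uv]
  have ex: "exit_point u v = pathstart (k u v)" "exit_point v u = pathfinish (k u v)"
    using uv E_asym[OF uv] by (auto simp: exit_point_def)
  note e = spiral_ends[OF a(1)] spiral_ends[OF a(2)]
  show "path (outer u v)"
    unfolding outer_def using spiral_path k_path[OF uv] e ex by simp
  show "pathstart (outer u v) = polar u (\<delta> / 2) (port_angle (dir u v))"
    "pathfinish (outer u v) = polar v (\<delta> / 2) (port_angle (dir v u))" unfolding outer_def using e by simp_all
  show "path_image (outer u v) = path_image (spiral u v) \<union> path_image (k u v) \<union> path_image (spiral v u)"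
    unfolding outer_def using e ex by (simp add: path_image_join Un_assoc)
qed

lemma spirals_disjoint':
  assumes "(u, v) \<in> parcs G" "(x, y) \<in> parcs G" "(u, v) \<noteq> (x, y)"
  shows "path_image (spiral u v) \<inter> path_image (spiral x y) = {}"
proof (cases "u = x")
  case True
  then show ?thesis using spirals_disjoint[of u v y] assms by simp
next
  case False
  show ?thesis
    using discs_disjoint[OF arcs_verts(1)[OF assms(1)] arcs_verts(1)[OF assms(2)] False, OF spiral_dist(2) spiral_dist(2)]
    by (metis disjoint_iff)
qed

lemma Un3_disjoint:
  "A \<inter> X = {} \<Longrightarrow> A \<inter> Y = {} \<Longrightarrow> A \<inter> Z = {} \<Longrightarrow> X \<inter> B = {} \<Longrightarrow> B \<inter> Y = {} \<Longrightarrow> Z \<inter> B = {} \<Longrightarrow>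
    C \<inter> X = {} \<Longrightarrow> C \<inter> Y = {} \<Longrightarrow> C \<inter> Z = {} \<Longrightarrow> (A \<union> B \<union> C) \<inter> (X \<union> Y \<union> Z) = {}"
  by blast

lemma outer_disjoint:
  assumes uv: "(u, v) \<in> E" and xy: "(x, y) \<in> E" and neq: "(u, v) \<noteq> (x, y)"
  shows "path_image (outer u v) \<inter> path_image (outer x y) = {}"
proof -
  have n: "{u, v} \<noteq> {x, y}" "(u, v) \<noteq> (y, x)" "(v, u) \<noteq> (x, y)" "(v, u) \<noteq> (y, x)"
    using neq uv xy E_asym by (auto simp: doubleton_eq_iff)
  have n': "{v, u} \<noteq> {x, y}" "{y, x} \<noteq> {u, v}" "{x, y} \<noteq> {u, v}" using n(1) by (auto simp: insert_commute)
  show ?thesis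
    unfolding outer_props(4)[OF uv] outer_props(4)[OF xy]
    by (rule Un3_disjoint[OF spirals_disjoint'[OF E_arcs(1)[OF uv] E_arcs(1)[OF xy] neq] spiral_k_disjoint[OF E_arcs(1)[OF uv] xy n(1)]
      spirals_disjoint'[OF E_arcs(1)[OF uv] E_arcs(2)[OF xy] n(2)] spiral_k_disjoint[OF E_arcs(1)[OF xy] uv n'(3)]
      k_disj[OF uv xy neq] spiral_k_disjoint[OF E_arcs(2)[OF xy] uv n'(2)]
      spirals_disjoint'[OF E_arcs(2)[OF uv] E_arcs(1)[OF xy] n(3)] spiral_k_disjoint[OF E_arcs(2)[OF uv] xy n'(1)]
      spirals_disjoint'[OF E_arcs(2)[OF uv] E_arcs(2)[OF xy] n(4)]])
qed

lemma spiral_ray_disjoint':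
  assumes "(u, v) \<in> parcs G" "(x, y) \<in> parcs G" "(u, v) \<noteq> (x, y)"
  shows "path_image (spiral u v) \<inter> ray x y = {}"
proof (cases "u = x")
  case True
  then show ?thesis using spiral_ray_disjoint[of u v y] assms by simp
next
  case False
  have "z \<in> ray x y \<Longrightarrow> dist (p x) z \<le> \<delta>" for z using ray_dist[of z x y] \<delta> by simp
  then show ?thesis
    using discs_disjoint[OF arcs_verts(1)[OF assms(1)] arcs_verts(1)[OF assms(2)] False, OF spiral_dist(2)]
    by (metis disjoint_iff)
qed

lemma outer_ray_disjoint:
  assumes uv: "(u, v) \<in> E" and xy: "(x, y) \<in> parcs G" and neq: "{u, v} \<noteq> {x, y}"
  shows "path_image (outer u v) \<inter> ray x y = {}"
proof -
  have "(u, v) \<noteq> (x, y)" "(v, u) \<noteq> (x, y)" using neq by auto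
  then show ?thesis
    unfolding outer_props(4)[OF uv]
    using spiral_ray_disjoint'[OF E_arcs(1)[OF uv] xy] spiral_ray_disjoint'[OF E_arcs(2)[OF uv] xy] ray_k_disjoint[OF xy uv] by blast
qed

lemma outer_vertex:
  assumes uv: "(u, v) \<in> E" and w: "w \<in> pverts G"
  shows "p w \<notin> path_image (outer u v)"
proof -
  have sp: "p w \<notin> path_image (spiral x y)" if "(x, y) \<in> parcs G" for x y
  proof
    assume *: "p w \<in> path_image (spiral x y)"
    then have "w \<noteq> x" using spiral_dist(1)[OF *] \<delta> by auto
    then show False using discs_disjoint[OF w arcs_verts(1)[OF that], of "p w"] spiral_dist(2)[OF *] \<delta> by simp
  qed
  have "p w \<notin> path_image (k u v)"
  proof
    assume "p w \<in> path_image (k u v)"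
    from k_far[OF uv w this] show False using \<delta> k_start[OF uv] k_finish[OF uv] by auto
  qed
  then show ?thesis unfolding outer_props(4)[OF uv] using sp[OF E_arcs(1)[OF uv]] sp[OF E_arcs(2)[OF uv]] by blast
qed

lemma rays_disjoint:
  assumes "(u, v) \<in> parcs G" "x \<in> pverts G" "u \<noteq> x"
  shows "ray u v \<inter> ray x y = {}" "p x \<notin> ray u v"
proof -
  have 1: "z \<in> ray x y \<Longrightarrow> dist (p x) z \<le> \<delta>" for x y z using ray_dist[of z x y] \<delta> by simp
  show "ray u v \<inter> ray x y = {}" using discs_disjoint[OF arcs_verts(1)[OF assms(1)] assms(2,3), OF 1 1] by (metis disjoint_iff)
  show "p x \<notin> ray u v" using discs_disjoint[OF arcs_verts(1)[OF assms(1)] assms(2,3) 1, of "p x"] \<delta> by auto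
qed

end

section \<open>From a plane drawing to a square grid\<close>

definition vec :: "int \<times> int \<Rightarrow> complex" where
  "vec a = Complex (of_int (fst a)) (of_int (snd a))"

lemma rnd_add_vec: "rnd (z + vec a) = rnd z + a"
  by (simp add: rnd_def vec_def round_add_int prod_eq_iff)

text \<open>The factor is 1 for the axis directions and \<open>sqrt 2\<close> for the
  diagonals.\<close>

lemma vec_port_dir:
  assumes "i < 5"
  shows "\<exists>n. 0 < n \<and> n \<le> 2 \<and> vec (port_dir i) = of_real n * cis (port_angle i)"
  using assms
proof (cases rule: less_5_cases)
  case 1
  then show ?thesis by (intro exI[of _ 1]) (simp add: vec_def port_dir_def port_angle_def complex_eq_iff)
next
  case 2
  then show ?thesis by (intro exI[of _ 1]) (simp add: vec_def port_dir_def port_angle_def complex_eq_iff)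
next
  case 3
  have t: "cos (3 * pi / 4) = - (sqrt 2 / 2)" "sin (3 * pi / 4) = sqrt 2 / 2"
    using cos_pi_minus[of "pi / 4"] sin_pi_minus[of "pi / 4"] by (simp_all add: cos_45 sin_45 field_simps)
  have "sqrt 2 * cos (3 * pi / 4) = -1" "sqrt 2 * sin (3 * pi / 4) = 1" unfolding t by simp_all
  moreover have "sqrt 2 \<le> 2" by (rule real_le_lsqrt) simp_all
  ultimately show ?thesis using 3
    by (intro exI[of _ "sqrt 2"]) (simp add: vec_def port_dir_def port_angle_def complex_eq_iff)
next
  case 4
  have t: "cos (5 * pi / 4) = - (sqrt 2 / 2)" "sin (5 * pi / 4) = - (sqrt 2 / 2)"
    using cos_periodic_pi2[of "pi / 4"] sin_periodic_pi2[of "pi / 4"] by (simp_all add: cos_45 sin_45 field_simps)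
  have "sqrt 2 * cos (5 * pi / 4) = -1" "sqrt 2 * sin (5 * pi / 4) = -1" unfolding t by simp_all
  moreover have "sqrt 2 \<le> 2" by (rule real_le_lsqrt) simp_all
  ultimately show ?thesis using 4
    by (intro exI[of _ "sqrt 2"]) (simp add: vec_def port_dir_def port_angle_def complex_eq_iff)
next
  case 5
  have "3 * pi / 2 = pi + pi / 2" by simp
  then have "cos (3 * pi / 2) = 0" "sin (3 * pi / 2) = -1" by (metis cos_periodic_pi2 cos_pi_half minus_zero, metis sin_periodic_pi2 sin_pi_half)
  then show ?thesis using 5 by (intro exI[of _ 1]) (simp add: vec_def port_dir_def port_angle_def complex_eq_iff)
qed

text \<open>Rounding is monotone and commutes with integer shifts: a coordinate moved by at least 1
  moves by at least 1 after rounding, and an unmoved one is rounded as before. So the signs of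
  \<open>a\<close> survive rounding.\<close>

lemma lat_half_line:
  assumes S: "\<And>w. w \<in> S \<Longrightarrow> \<exists>c\<ge>1. w = z + of_real c * vec a" and y: "y \<in> lat S"
    and a: "\<bar>fst a\<bar> \<le> 1" "\<bar>snd a\<bar> \<le> 1"
  shows "fst a \<le> 0 \<or> 1 \<le> fst (y - rnd z)" "0 \<le> fst a \<or> fst (y - rnd z) \<le> -1" "fst a \<noteq> 0 \<or> fst (y - rnd z) = 0"
    "snd a \<le> 0 \<or> 1 \<le> snd (y - rnd z)" "0 \<le> snd a \<or> snd (y - rnd z) \<le> -1" "snd a \<noteq> 0 \<or> snd (y - rnd z) = 0"
proof -
  obtain w w' where w: "y = (round (Re w), round (Im w'))" "w \<in> S" "w' \<in> S" using y unfolding lat_def by blast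
  obtain c where c: "1 \<le> c" "w = z + of_real c * vec a" using S[OF w(2)] by blast
  obtain d where d: "1 \<le> d" "w' = z + of_real d * vec a" using S[OF w(3)] by blast
  have R: "Re w = Re z + c * of_int (fst a)" using c(2) by (simp add: vec_def)
  have I: "Im w' = Im z + d * of_int (snd a)" using d(2) by (simp add: vec_def)
  have y1: "fst (y - rnd z) = round (Re w) - round (Re z)" "snd (y - rnd z) = round (Im w') - round (Im z)"
    using w(1) by (simp_all add: rnd_def)
  have up: "1 \<le> round (x + e) - round x" if "1 \<le> e" for x e :: real
    using round_mono[of "x + of_int 1" "x + e"] that unfolding round_add_int by simp
  have down: "round (x - e) - round x \<le> -1" if "1 \<le> e" for x e :: real
    using round_mono[of "x - e" "x + of_int (-1)"] that unfolding round_add_int by simp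
  show "fst a \<le> 0 \<or> 1 \<le> fst (y - rnd z)"
  proof (cases "fst a \<le> 0")
    case False
    then have "fst a = 1" using a by simp
    then show ?thesis using up[OF c(1), of "Re z"] unfolding y1 R by simp
  qed simp
  show "0 \<le> fst a \<or> fst (y - rnd z) \<le> -1"
  proof (cases "0 \<le> fst a")
    case False
    then have "fst a = -1" using a by simp
    then show ?thesis using down[OF c(1), of "Re z"] unfolding y1 R by simp
  qed simp
  show "fst a \<noteq> 0 \<or> fst (y - rnd z) = 0" unfolding y1 R by simp
  show "snd a \<le> 0 \<or> 1 \<le> snd (y - rnd z)"
  proof (cases "snd a \<le> 0")
    case False
    then have "snd a = 1" using a by simp
    then show ?thesis using up[OF d(1), of "Im z"] unfolding y1 I by simp
  qed simp
  show "0 \<le> snd a \<or> snd (y - rnd z) \<le> -1"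
  proof (cases "0 \<le> snd a")
    case False
    then have "snd a = -1" using a by simp
    then show ?thesis using down[OF d(1), of "Im z"] unfolding y1 I by simp
  qed simp
  show "snd a \<noteq> 0 \<or> snd (y - rnd z) = 0" unfolding y1 I by simp
qed

text \<open>Errors of 1 and 2 per coordinate allow a distance of at most 6, whereas scaling has
  moved separated points at least 10 apart.\<close>

lemma lat_far:
  assumes z: "z \<in> lat ((\<lambda>x. of_real N * x) ` S)" and y: "\<bar>of_int (fst z) - Re (of_real N * x)\<bar> \<le> 2" "\<bar>of_int (snd z) - Im (of_real N * x)\<bar> \<le> 2"
    and sep: "\<And>w. w \<in> S \<Longrightarrow> \<eta> \<le> dist w x" and N: "0 < N" "10 \<le> N * \<eta>"
  shows False
proof -
  obtain w where w: "w \<in> S" "\<bar>of_int (fst z) - Re (of_real N * w)\<bar> \<le> 1" "\<bar>of_int (snd z) - Im (of_real N * w)\<bar> \<le> 1"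
    using lat_near[OF z] by blast
  have "\<bar>Re (of_real N * w - of_real N * x)\<bar> \<le> 3" "\<bar>Im (of_real N * w - of_real N * x)\<bar> \<le> 3"
    using w(2,3) y by simp_all
  then have "cmod (of_real N * w - of_real N * x) \<le> 6"
    using cmod_le[of "of_real N * w - of_real N * x"] by linarith
  moreover have "cmod (of_real N * w - of_real N * x) = N * dist w x"
    using N(1) by (simp add: dist_norm norm_mult flip: right_diff_distrib)
  moreover have "N * \<eta> \<le> N * dist w x" using sep[OF w(1)] N(1) by (intro mult_left_mono) simp_all
  ultimately show False using N(2) by linarith
qed

section \<open>Scaling and rounding a disc drawing\<close>

context disc_drawing begin

text \<open>Curves, rays and vertices form a finite family of compact sets, so its disjoint pairs
  have a common positive distance. Two rays at one vertex meet and are not covered; they will be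
  told apart by the signs of their directions.\<close>

lemma separation:
  obtains \<eta> where "0 < \<eta>"
    "\<And>u v x y a b. (u, v) \<in> E \<Longrightarrow> (x, y) \<in> E \<Longrightarrow> (u, v) \<noteq> (x, y) \<Longrightarrow> a \<in> path_image (outer u v) \<Longrightarrow> b \<in> path_image (outer x y) \<Longrightarrow> \<eta> \<le> dist a b"
    "\<And>u v x y a b. (u, v) \<in> E \<Longrightarrow> (x, y) \<in> parcs G \<Longrightarrow> {u, v} \<noteq> {x, y} \<Longrightarrow> a \<in> path_image (outer u v) \<Longrightarrow> b \<in> ray x y \<Longrightarrow> \<eta> \<le> dist a b"
    "\<And>u v w a. (u, v) \<in> E \<Longrightarrow> w \<in> pverts G \<Longrightarrow> a \<in> path_image (outer u v) \<Longrightarrow> \<eta> \<le> dist a (p w)"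
    "\<And>u v x y a b. (u, v) \<in> parcs G \<Longrightarrow> (x, y) \<in> parcs G \<Longrightarrow> u \<noteq> x \<Longrightarrow> a \<in> ray u v \<Longrightarrow> b \<in> ray x y \<Longrightarrow> \<eta> \<le> dist a b"
    "\<And>u v w a. (u, v) \<in> parcs G \<Longrightarrow> w \<in> pverts G \<Longrightarrow> u \<noteq> w \<Longrightarrow> a \<in> ray u v \<Longrightarrow> \<eta> \<le> dist a (p w)"
    "\<And>u w. u \<in> pverts G \<Longrightarrow> w \<in> pverts G \<Longrightarrow> u \<noteq> w \<Longrightarrow> \<eta> \<le> dist (p u) (p w)"
proof -
  have cray: "compact (ray u v)" for u v by (simp add: ray_def)
  have co: "compact (path_image (outer u v))" if "(u, v) \<in> E" for u v
    using outer_props(1)[OF that] by (rule compact_path_image)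
  define O1 where "O1 = (\<lambda>(u, v). path_image (outer u v)) ` E"
  define O2 where "O2 = (\<lambda>(u, v). ray u v) ` parcs G"
  define O3 where "O3 = (\<lambda>w. {p w}) ` pverts G"
  define F where "F = {(S, T). S \<in> O1 \<union> O2 \<union> O3 \<and> T \<in> O1 \<union> O2 \<union> O3 \<and> S \<inter> T = {}}"
  have "finite E" using E_sub G.pair_finite_arcs by (rule finite_subset)
  then have "finite (O1 \<union> O2 \<union> O3)"
    using G.pair_finite_arcs G.pair_finite_verts by (simp add: O1_def O2_def O3_def)
  moreover have "F \<subseteq> (O1 \<union> O2 \<union> O3) \<times> (O1 \<union> O2 \<union> O3)" by (auto simp: F_def)
  ultimately have "finite F" using finite_subset by blast
  moreover have "compact S" if "S \<in> O1 \<union> O2 \<union> O3" for S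
    using that co cray by (auto simp: O1_def O2_def O3_def)
  ultimately have "\<exists>\<eta>>0. \<forall>(S, T)\<in>F. \<forall>x\<in>S. \<forall>y\<in>T. \<eta> \<le> dist x y"
    by (intro finite_separation) (auto simp: F_def)
  then obtain \<eta> where \<eta>: "0 < \<eta>" "\<forall>(S, T)\<in>F. \<forall>x\<in>S. \<forall>y\<in>T. \<eta> \<le> dist x y" by blast
  have sep: "\<eta> \<le> dist a b" if "S \<in> O1 \<union> O2 \<union> O3" "T \<in> O1 \<union> O2 \<union> O3" "S \<inter> T = {}" "a \<in> S" "b \<in> T" for S T a b
    using \<eta>(2) that unfolding F_def by blast
  have m1: "path_image (outer u v) \<in> O1 \<union> O2 \<union> O3" if "(u, v) \<in> E" for u v using that by (force simp: O1_def)
  have m2: "ray u v \<in> O1 \<union> O2 \<union> O3" if "(u, v) \<in> parcs G" for u v using that by (force simp: O2_def)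
  have m3: "{p w} \<in> O1 \<union> O2 \<union> O3" if "w \<in> pverts G" for w using that by (simp add: O3_def)
  show thesis
  proof (rule that[OF \<eta>(1)])
    show "\<eta> \<le> dist a b" if "(u, v) \<in> E" "(x, y) \<in> E" "(u, v) \<noteq> (x, y)" "a \<in> path_image (outer u v)" "b \<in> path_image (outer x y)" for u v x y a b
      by (rule sep[OF m1 m1 outer_disjoint]) (use that in auto)
    show "\<eta> \<le> dist a b" if "(u, v) \<in> E" "(x, y) \<in> parcs G" "{u, v} \<noteq> {x, y}" "a \<in> path_image (outer u v)" "b \<in> ray x y" for u v x y a b
      by (rule sep[OF m1 m2 outer_ray_disjoint]) (use that in auto)
    show "\<eta> \<le> dist a (p w)" if "(u, v) \<in> E" "w \<in> pverts G" "a \<in> path_image (outer u v)" for u v w a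
      by (rule sep[OF m1[OF that(1)] m3[OF that(2)]]) (use that outer_vertex in auto)
    show "\<eta> \<le> dist a b" if "(u, v) \<in> parcs G" "(x, y) \<in> parcs G" "u \<noteq> x" "a \<in> ray u v" "b \<in> ray x y" for u v x y a b
      by (rule sep[OF m2[OF that(1)] m2[OF that(2)] rays_disjoint(1)[OF that(1) arcs_verts(1)[OF that(2)] that(3)] that(4,5)])
    show "\<eta> \<le> dist a (p w)" if "(u, v) \<in> parcs G" "w \<in> pverts G" "u \<noteq> w" "a \<in> ray u v" for u v w a
      by (rule sep[OF m2[OF that(1)] m3[OF that(2)]]) (use that rays_disjoint(2) in auto)
    show "\<eta> \<le> dist (p u) (p w)" if "u \<in> pverts G" "w \<in> pverts G" "u \<noteq> w" for u w
      by (rule sep[OF m3[OF that(1)] m3[OF that(2)]]) (use p_far[OF that] \<delta> in auto)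
  qed
qed

theorem coarse_drawing_exists:
  "\<exists>q P len. coarse_drawing G E q dir P len"
proof (rule separation)
  fix \<eta> assume \<eta>: "0 < \<eta>"
    and sep1: "\<And>u v x y a b. (u, v) \<in> E \<Longrightarrow> (x, y) \<in> E \<Longrightarrow> (u, v) \<noteq> (x, y) \<Longrightarrow> a \<in> path_image (outer u v) \<Longrightarrow> b \<in> path_image (outer x y) \<Longrightarrow> \<eta> \<le> dist a b"
    and sep2: "\<And>u v x y a b. (u, v) \<in> E \<Longrightarrow> (x, y) \<in> parcs G \<Longrightarrow> {u, v} \<noteq> {x, y} \<Longrightarrow> a \<in> path_image (outer u v) \<Longrightarrow> b \<in> ray x y \<Longrightarrow> \<eta> \<le> dist a b"
    and sep3: "\<And>u v w a. (u, v) \<in> E \<Longrightarrow> w \<in> pverts G \<Longrightarrow> a \<in> path_image (outer u v) \<Longrightarrow> \<eta> \<le> dist a (p w)"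
    and sep4: "\<And>u v x y a b. (u, v) \<in> parcs G \<Longrightarrow> (x, y) \<in> parcs G \<Longrightarrow> u \<noteq> x \<Longrightarrow> a \<in> ray u v \<Longrightarrow> b \<in> ray x y \<Longrightarrow> \<eta> \<le> dist a b"
    and sep5: "\<And>u v w a. (u, v) \<in> parcs G \<Longrightarrow> w \<in> pverts G \<Longrightarrow> u \<noteq> w \<Longrightarrow> a \<in> ray u v \<Longrightarrow> \<eta> \<le> dist a (p w)"
    and sep6: "\<And>u w. u \<in> pverts G \<Longrightarrow> w \<in> pverts G \<Longrightarrow> u \<noteq> w \<Longrightarrow> \<eta> \<le> dist (p u) (p w)"
  \<comment> \<open>\<open>N * \<eta> \<ge> 10\<close> outweighs the rounding errors.
    \<open>N * \<delta> \<ge> 4\<close> puts the port, which is at most 2 away from the scaled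
    vertex, on the scaled ray of length \<open>N * \<delta> / 2\<close>.\<close>
  define N where "N = 10 / \<eta> + 4 / \<delta>"
  have N: "0 < N" "10 \<le> N * \<eta>" "4 \<le> N * \<delta>" using \<eta> \<delta> by (simp_all add: N_def field_simps add_pos_pos)
  define sc where "sc z = of_real N * z" for z :: complex
  define q where "q u = rnd (sc (p u))" for u
  \<comment> \<open>The scaled ray without the piece between the vertex and its port, so that
    \<open>lat_half_line\<close> applies.\<close>
  define R where "R u v = closed_segment (sc (p u) + vec (port_dir (dir u v))) (sc (polar u (\<delta> / 2) (port_angle (dir u v))))" for u v
  have port1: "\<bar>fst (port_dir i)\<bar> \<le> 1" "\<bar>snd (port_dir i)\<bar> \<le> 1" "port_dir i \<noteq> 0" if "i < 5" for i
    using that by (auto elim!: less_5_cases simp: port_dir_def zero_prod_def)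
  have R_pt: "\<exists>c\<ge>1. w = sc (p u) + of_real c * vec (port_dir (dir u v))" and R_ray: "w \<in> sc ` ray u v"
    if uv: "(u, v) \<in> parcs G" and w: "w \<in> R u v" for u v w
  proof -
    obtain n where n: "0 < n" "n \<le> 2" "vec (port_dir (dir u v)) = of_real n * cis (port_angle (dir u v))"
      using vec_port_dir[OF dir_less[OF uv]] by blast
    define C where "C = N * \<delta> / (2 * n)"
    have C1: "1 \<le> C" using n N(3) by (simp add: C_def field_simps)
    have e: "sc (polar u (\<delta> / 2) (port_angle (dir u v))) = sc (p u) + of_real C * vec (port_dir (dir u v))"
      using n(1) unfolding n(3) C_def sc_def polar_def by (simp add: algebra_simps)
    obtain s where s: "0 \<le> s" "s \<le> 1" "w = (1 - s) *\<^sub>R (sc (p u) + vec (port_dir (dir u v))) + s *\<^sub>R (sc (polar u (\<delta> / 2) (port_angle (dir u v))))"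
      using w unfolding R_def closed_segment_def by blast
    define c where "c = (1 - s) + s * C"
    have wc: "w = sc (p u) + of_real c * vec (port_dir (dir u v))"
      unfolding s(3) e c_def by (simp add: scaleR_conv_of_real algebra_simps)
    have "s * 1 \<le> s * C" using s C1 by (intro mult_left_mono) auto
    then have c1: "1 \<le> c" by (simp add: c_def)
    then show "\<exists>c\<ge>1. w = sc (p u) + of_real c * vec (port_dir (dir u v))" using wc by blast
    have "s * C \<le> 1 * C - (1 - s)" using s C1 mult_mono[of 0 "1 - s" 1 C] mult_left_mono[of 1 C "1 - s"] by (simp add: algebra_simps)
    then have cC: "c \<le> C" by (simp add: c_def)
    have "p u + of_real (c * n / N) * cis (port_angle (dir u v)) \<in> ray u v"
    proof -
      define t where "t = c / C"
      have t: "0 \<le> t" "t \<le> 1" using c1 cC C1 by (simp_all add: t_def)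
      have e: "c * n / N = t * \<delta> / 2" using n(1) N(1) C1 \<delta> unfolding t_def C_def by (simp add: field_simps)
      have "p u + of_real (c * n / N) * cis (port_angle (dir u v)) = (1 - t) *\<^sub>R p u + t *\<^sub>R polar u (\<delta> / 2) (port_angle (dir u v))"
        unfolding e by (simp add: polar_def scaleR_conv_of_real algebra_simps)
      then show ?thesis unfolding ray_def closed_segment_def using t by blast
    qed
    moreover have "w = sc (p u + of_real (c * n / N) * cis (port_angle (dir u v)))"
      using N(1) unfolding wc n(3) sc_def by (simp add: algebra_simps)
    ultimately show "w \<in> sc ` ray u v" by blast
  qed
  \<comment> \<open>The grid points available to one edge. These sets are disjoint for different
    edges, so the paths can be chosen independently.\<close>
  define T where "T u v = lat (R u v) \<union> lat (sc ` path_image (outer u v)) \<union> lat (R v u)" for u v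
  have lat_mono: "lat S \<subseteq> lat S'" if "S \<subseteq> S'" for S S' using that unfolding lat_def by blast
  have R_lat: "lat (R u v) \<subseteq> lat (sc ` ray u v)" if "(u, v) \<in> parcs G" for u v using lat_mono R_ray[OF that] by blast
  have near: "\<exists>x\<in>S. \<bar>of_int (fst z) - Re (of_real N * x)\<bar> \<le> 2 \<and> \<bar>of_int (snd z) - Im (of_real N * x)\<bar> \<le> 2"
    if z: "z \<in> lat (sc ` S)" for z S
  proof -
    obtain x where "x \<in> S" "\<bar>of_int (fst z) - Re (sc x)\<bar> \<le> 1" "\<bar>of_int (snd z) - Im (sc x)\<bar> \<le> 1"
      using lat_near[OF z] by blast
    then show ?thesis by (intro bexI[of _ x]) (simp_all add: sc_def)
  qed
  have lat_disj: "lat (sc ` S) \<inter> lat (sc ` S') = {}" if "\<And>a b. a \<in> S \<Longrightarrow> b \<in> S' \<Longrightarrow> \<eta> \<le> dist a b" for S S'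
  proof -
    have False if z: "z \<in> lat (sc ` S)" "z \<in> lat (sc ` S')" for z
    proof -
      obtain x where x: "x \<in> S'" "\<bar>of_int (fst z) - Re (of_real N * x)\<bar> \<le> 2" "\<bar>of_int (snd z) - Im (of_real N * x)\<bar> \<le> 2"
        using near[OF z(2)] by blast
      from lat_far[OF _ x(2,3), of S \<eta>] z(1) show False
        using \<open>\<And>a b. a \<in> S \<Longrightarrow> b \<in> S' \<Longrightarrow> \<eta> \<le> dist a b\<close> x(1) N(1,2) unfolding sc_def by blast
    qed
    then show ?thesis by blast
  qed
  have quad: "z \<in> lat (R u v) \<Longrightarrow>
      (fst (port_dir (dir u v)) \<le> 0 \<or> 1 \<le> fst (z - q u)) \<and> (0 \<le> fst (port_dir (dir u v)) \<or> fst (z - q u) \<le> -1) \<and>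
      (fst (port_dir (dir u v)) \<noteq> 0 \<or> fst (z - q u) = 0) \<and>
      (snd (port_dir (dir u v)) \<le> 0 \<or> 1 \<le> snd (z - q u)) \<and> (0 \<le> snd (port_dir (dir u v)) \<or> snd (z - q u) \<le> -1) \<and>
      (snd (port_dir (dir u v)) \<noteq> 0 \<or> snd (z - q u) = 0)" if uv: "(u, v) \<in> parcs G" for u v z
    using lat_half_line[where S = "R u v" and z = "sc (p u)" and y = z, OF R_pt[OF uv] _ port1(1,2)[OF dir_less[OF uv]]] unfolding q_def by blast
  have R_disj: "lat (R u v) \<inter> lat (R x y) = {}" if "(u, v) \<in> parcs G" "(x, y) \<in> parcs G" "(u, v) \<noteq> (x, y)" for u v x y
  proof (cases "u = x")
    case True
    have ne: "dir u v \<noteq> dir u y" using that True dir_inj by blast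
    \<comment> \<open>The five port directions have different pairs of signs.\<close>
    have False if z: "z \<in> lat (R u v)" "z \<in> lat (R u y)" for z
      using quad[OF \<open>(u, v) \<in> parcs G\<close> z(1)] quad[OF \<open>(x, y) \<in> parcs G\<close>[folded True] z(2)] ne
        dir_less[OF \<open>(u, v) \<in> parcs G\<close>] dir_less[OF \<open>(x, y) \<in> parcs G\<close>[folded True]]
      by (elim less_5_cases) (simp_all add: port_dir_def)
    then show ?thesis using True by blast
  next
    case False
    have "lat (sc ` ray u v) \<inter> lat (sc ` ray x y) = {}" by (rule lat_disj) (rule sep4[OF that(1,2) False])
    then show ?thesis using R_lat[OF that(1)] R_lat[OF that(2)] by blast
  qed
  have OR_disj: "lat (sc ` path_image (outer u v)) \<inter> lat (R x y) = {}" if "(u, v) \<in> E" "(x, y) \<in> parcs G" "{u, v} \<noteq> {x, y}" for u v x y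
  proof -
    have "lat (sc ` path_image (outer u v)) \<inter> lat (sc ` ray x y) = {}" by (rule lat_disj) (rule sep2[OF that])
    then show ?thesis using R_lat[OF that(2)] by blast
  qed
  have T_disj: "T u v \<inter> T x y = {}" if uv: "(u, v) \<in> E" and xy: "(x, y) \<in> E" and neq: "(u, v) \<noteq> (x, y)" for u v x y
  proof -
    have n: "{u, v} \<noteq> {x, y}" "(u, v) \<noteq> (y, x)" "(v, u) \<noteq> (x, y)" "(v, u) \<noteq> (y, x)"
      using neq uv xy E_asym by (auto simp: doubleton_eq_iff)
    have n': "{u, v} \<noteq> {y, x}" "{x, y} \<noteq> {u, v}" "{x, y} \<noteq> {v, u}" using n(1) by (auto simp: insert_commute)
    have "lat (sc ` path_image (outer u v)) \<inter> lat (sc ` path_image (outer x y)) = {}"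
      by (rule lat_disj) (rule sep1[OF uv xy neq])
    then show ?thesis
      unfolding T_def
      using R_disj[OF E_arcs(1)[OF uv] E_arcs(1)[OF xy] neq] R_disj[OF E_arcs(1)[OF uv] E_arcs(2)[OF xy] n(2)]
        R_disj[OF E_arcs(2)[OF uv] E_arcs(1)[OF xy] n(3)] R_disj[OF E_arcs(2)[OF uv] E_arcs(2)[OF xy] n(4)]
        OR_disj[OF uv E_arcs(1)[OF xy] n(1)] OR_disj[OF uv E_arcs(2)[OF xy] n'(1)]
        OR_disj[OF xy E_arcs(1)[OF uv] n'(2)] OR_disj[OF xy E_arcs(2)[OF uv] n'(3)] by blast
  qed
  have q_near: "\<bar>of_int (fst (q w)) - Re (of_real N * p w)\<bar> \<le> 1 / 2" "\<bar>of_int (snd (q w)) - Im (of_real N * p w)\<bar> \<le> 1 / 2" for w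
    using of_int_round_abs_le unfolding q_def rnd_def sc_def by simp_all
  have box_far: False if "z \<in> lat (sc ` S)" "\<And>a. a \<in> S \<Longrightarrow> \<eta> \<le> dist a (p w)" "\<bar>fst (z - q w)\<bar> \<le> 1" "\<bar>snd (z - q w)\<bar> \<le> 1" for z S w
  proof -
    have "\<bar>real_of_int (fst z) - of_int (fst (q w))\<bar> \<le> 1" "\<bar>real_of_int (snd z) - of_int (snd (q w))\<bar> \<le> 1"
      using that(3,4) by (simp_all flip: of_int_diff of_int_abs)
    then have "\<bar>of_int (fst z) - Re (of_real N * p w)\<bar> \<le> 2" "\<bar>of_int (snd z) - Im (of_real N * p w)\<bar> \<le> 2"
      using q_near[of w] by linarith+
    from lat_far[OF that(1)[unfolded sc_def] this that(2) N(1,2)] show False .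
  qed
  have R_box: "w = u \<and> z = q u + port_dir (dir u v)"
    if uv: "(u, v) \<in> parcs G" and w: "w \<in> pverts G" and z: "z \<in> lat (R u v)" "\<bar>fst (z - q w)\<bar> \<le> 1" "\<bar>snd (z - q w)\<bar> \<le> 1" for u v w z
  proof (cases "w = u")
    case True
    \<comment> \<open>Inside the box each coordinate is -1, 0 or 1, so the signs determine the
      point.\<close>
    have "fst (z - q u) = fst (port_dir (dir u v)) \<and> snd (z - q u) = snd (port_dir (dir u v))"
      using quad[OF uv z(1)] z(2,3) port1(1,2)[OF dir_less[OF uv]] unfolding True by linarith
    then have "z - q u = port_dir (dir u v)" by (simp add: prod_eq_iff)
    then show ?thesis using True by (simp add: algebra_simps)
  next
    case False
    have "z \<in> lat (sc ` ray u v)" using R_lat[OF uv] z(1) by blast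
    from box_far[OF this sep5[OF uv w] z(2,3)] False show ?thesis by blast
  qed
  have T_box: "w = u \<and> z = q u + port_dir (dir u v) \<or> w = v \<and> z = q v + port_dir (dir v u)"
    if uv: "(u, v) \<in> E" and w: "w \<in> pverts G" and z: "z \<in> T u v" "\<bar>fst (z - q w)\<bar> \<le> 1" "\<bar>snd (z - q w)\<bar> \<le> 1" for u v w z
    using z(1) R_box[OF E_arcs(1)[OF uv] w _ z(2,3)] R_box[OF E_arcs(2)[OF uv] w _ z(2,3)]
      box_far[OF _ sep3[OF uv w] z(2,3)] unfolding T_def by blast
  have conn: "(q u + port_dir (dir u v), q v + port_dir (dir v u)) \<in> (grid_adj (T u v))\<^sup>*" if uv: "(u, v) \<in> E" for u v
  proof -
    have R_conn: "(q u + port_dir (dir u v), rnd (sc (polar u (\<delta> / 2) (port_angle (dir u v))))) \<in> (grid_adj (lat (R u v)))\<^sup>*" for u v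
      using path_grid_connected[of "linepath (sc (p u) + vec (port_dir (dir u v))) (sc (polar u (\<delta> / 2) (port_angle (dir u v))))"]
      by (simp add: R_def q_def rnd_add_vec)
    have "path (\<lambda>t. sc (outer u v t))"
      using outer_props(1)[OF uv] unfolding path_def sc_def by (intro continuous_intros)
    from path_grid_connected[OF this]
    have "(rnd (sc (polar u (\<delta> / 2) (port_angle (dir u v)))), rnd (sc (polar v (\<delta> / 2) (port_angle (dir v u))))) \<in> (grid_adj (lat (sc ` path_image (outer u v))))\<^sup>*"
      using outer_props(2,3)[OF uv] by (simp add: pathstart_def pathfinish_def path_image_def image_image)
    moreover have "lat (R u v) \<subseteq> T u v" "lat (sc ` path_image (outer u v)) \<subseteq> T u v" "lat (R v u) \<subseteq> T u v" by (auto simp: T_def)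
    ultimately show ?thesis
      using R_conn[of u v] grid_adj_sym[OF R_conn[of v u]] rtrancl_mono[OF grid_adj_mono] rtrancl_trans by (meson subsetD)
  qed
  have "\<forall>e\<in>E. \<exists>f. \<exists>n::nat. f 0 = q (fst e) + port_dir (dir (fst e) (snd e)) \<and> f n = q (snd e) + port_dir (dir (snd e) (fst e)) \<and>
      (\<forall>i<n. (f i, f (Suc i)) \<in> grid_adj (T (fst e) (snd e))) \<and> inj_on f {..n}"
    using rtrancl_simple_path[OF conn] by simp
  from bchoice[OF this] obtain P where "\<forall>e\<in>E. \<exists>n::nat. P e 0 = q (fst e) + port_dir (dir (fst e) (snd e)) \<and> P e n = q (snd e) + port_dir (dir (snd e) (fst e)) \<and>
      (\<forall>i<n. (P e i, P e (Suc i)) \<in> grid_adj (T (fst e) (snd e))) \<and> inj_on (P e) {..n}" by (elim exE)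
  from bchoice[OF this] obtain len where P: "\<forall>e\<in>E. P e 0 = q (fst e) + port_dir (dir (fst e) (snd e)) \<and> P e (len e) = q (snd e) + port_dir (dir (snd e) (fst e)) \<and>
      (\<forall>i<len e. (P e i, P e (Suc i)) \<in> grid_adj (T (fst e) (snd e))) \<and> inj_on (P e) {..len e :: nat}" by (elim exE)
  have P0: "P (u, v) 0 = q u + port_dir (dir u v)" and Pn: "P (u, v) (len (u, v)) = q v + port_dir (dir v u)"
    and Pstep: "i < len (u, v) \<Longrightarrow> (P (u, v) i, P (u, v) (Suc i)) \<in> grid_adj (T u v)" and Pinj: "inj_on (P (u, v)) {..len (u, v)}"
    if "(u, v) \<in> E" for u v i
    using bspec[OF P that] by simp_all
  have PT: "P (u, v) i \<in> T u v" if uv: "(u, v) \<in> E" and i: "i \<le> len (u, v)" for u v i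
  proof (cases "i < len (u, v)")
    case True
    then show ?thesis using Pstep[OF uv True] by (simp add: grid_adj_def)
  next
    case False
    then have "P (u, v) i = rnd (sc (p v) + vec (port_dir (dir v u)))" using i Pn[OF uv] by (simp add: rnd_add_vec q_def)
    moreover have "sc (p v) + vec (port_dir (dir v u)) \<in> R v u" by (simp add: R_def)
    ultimately show ?thesis using rnd_in_lat by (simp add: T_def)
  qed
  have "coarse_drawing G E q dir (\<lambda>u v. P (u, v)) (\<lambda>u v. len (u, v))"
  proof (rule coarse_drawing.intro)
    show "pair_graph G" by (rule graph)
    show "E \<subseteq> parcs G" by (rule E_sub)
    show "(u, v) \<in> parcs G \<Longrightarrow> (u, v) \<in> E \<or> (v, u) \<in> E" for u v by (rule E_or)
    show "(u, v) \<in> E \<Longrightarrow> (v, u) \<notin> E" for u v by (rule E_asym)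
    show "(u, v) \<in> parcs G \<Longrightarrow> dir u v < 5" for u v by (rule dir_less)
    show "(u, v) \<in> parcs G \<Longrightarrow> (u, w) \<in> parcs G \<Longrightarrow> dir u v = dir u w \<Longrightarrow> v = w" for u v w by (rule dir_inj)
    show "(u, v) \<in> E \<Longrightarrow> P (u, v) 0 = q u + port_dir (dir u v)" for u v by (rule P0)
    show "(u, v) \<in> E \<Longrightarrow> P (u, v) (len (u, v)) = q v + port_dir (dir v u)" for u v by (rule Pn)
    show "(u, v) \<in> E \<Longrightarrow> i < len (u, v) \<Longrightarrow> P (u, v) (Suc i) - P (u, v) i \<in> unit_vectors" for u v i
      using Pstep by (simp add: grid_adj_def)
    show "(u, v) \<in> E \<Longrightarrow> inj_on (P (u, v)) {..len (u, v)}" for u v by (rule Pinj)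
    show "P (u, v) i \<noteq> P (x, y) j" if "(u, v) \<in> E" "(x, y) \<in> E" "(u, v) \<noteq> (x, y)" "i \<le> len (u, v)" "j \<le> len (x, y)" for u v x y i j
      using T_disj[OF that(1-3)] PT[OF that(1,4)] PT[OF that(2,5)] by (metis disjoint_iff)
    show "w = u \<and> i = 0 \<or> w = v \<and> i = len (u, v)"
      if uv: "(u, v) \<in> E" "w \<in> pverts G" "i \<le> len (u, v)" "\<bar>fst (P (u, v) i - q w)\<bar> \<le> 1" "\<bar>snd (P (u, v) i - q w)\<bar> \<le> 1" for u v w i
    proof -
      from T_box[OF uv(1,2) PT[OF uv(1,3)] uv(4,5)]
      have "w = u \<and> P (u, v) i = P (u, v) 0 \<or> w = v \<and> P (u, v) i = P (u, v) (len (u, v))" using P0[OF uv(1)] Pn[OF uv(1)] by simp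
      then show ?thesis using inj_onD[OF Pinj[OF uv(1)], of i 0] inj_onD[OF Pinj[OF uv(1)], of i "len (u, v)"] uv(3) by auto
    qed
    show "4 \<le> \<bar>fst (q u - q w)\<bar> \<or> 4 \<le> \<bar>snd (q u - q w)\<bar>" if uw: "u \<in> pverts G" "w \<in> pverts G" "u \<noteq> w" for u w
    proof (rule ccontr)
      assume "\<not> ?thesis"
      \<comment> \<open>A difference of at most 3 after rounding was at most 4 before, which gives a
        distance of at most 8, less than the 10 guaranteed by \<open>N * \<eta>\<close>.\<close>
      then have "\<bar>fst (q u - q w)\<bar> \<le> 3" "\<bar>snd (q u - q w)\<bar> \<le> 3" by auto
      then have "\<bar>real_of_int (fst (q u)) - of_int (fst (q w))\<bar> \<le> 3" "\<bar>real_of_int (snd (q u)) - of_int (snd (q w))\<bar> \<le> 3"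
        by (simp_all flip: of_int_diff of_int_abs)
      then have "\<bar>Re (of_real N * p u - of_real N * p w)\<bar> \<le> 4" "\<bar>Im (of_real N * p u - of_real N * p w)\<bar> \<le> 4"
        using q_near[of u] q_near[of w] unfolding minus_complex.simps by linarith+
      then have "cmod (of_real N * p u - of_real N * p w) \<le> 8"
        using cmod_le[of "of_real N * p u - of_real N * p w"] by linarith
      moreover have "cmod (of_real N * p u - of_real N * p w) = N * dist (p u) (p w)"
        using N(1) by (simp add: dist_norm norm_mult flip: right_diff_distrib)
      moreover have "N * \<eta> \<le> N * dist (p u) (p w)" using sep6[OF uw] N(1) by (intro mult_left_mono) simp_all
      ultimately show False using N(2) by linarith
    qed
  qed
  then show ?thesis by blast
qed

end

section \<open>Existence of a disc drawing\<close>

lemma degree_le_max_degree: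
  assumes "pair_graph G" "u \<in> pverts G"
  shows "card {v. (u, v) \<in> parcs G} \<le> max_degree G"
proof -
  interpret pair_graph G by fact
  have "out_arcs (with_proj G) u = Pair u ` {v. (u, v) \<in> parcs G}" by (force simp: out_arcs_def)
  then have "card {v. (u, v) \<in> parcs G} = out_degree (with_proj G) u"
    unfolding out_degree_def by (simp add: card_image inj_on_def)
  also have "\<dots> \<le> max_degree G"
    unfolding max_degree_def using assms(2) pair_finite_verts by (intro cSUP_upper) simp_all
  finally show ?thesis .
qed

text \<open>\<open>\<eta>\<close> separates the vertices from each other and from the edges not
  incident with them, so discs of radius \<open>\<eta> / 5\<close> meet incident edges only.
  Different edges meet in vertices at most, and the trimmed curves contain none.\<close>

lemma disc_drawing_exists:
  assumes G: "pair_graph G" and drawing: "plane_drawing G p \<gamma>" and deg: "max_degree G \<le> 5"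
  shows "\<exists>E \<delta> k. disc_drawing G p E \<delta> k"
proof -
  interpret G: pair_graph G by fact
  have inj: "inj_on p (pverts G)"
    and \<gamma>: "(u, v) \<in> parcs G \<Longrightarrow> path (\<gamma> (u, v)) \<and> pathstart (\<gamma> (u, v)) = p u \<and> pathfinish (\<gamma> (u, v)) = p v"
    and \<gamma>_vert: "(u, v) \<in> parcs G \<Longrightarrow> w \<in> pverts G \<Longrightarrow> p w \<in> path_image (\<gamma> (u, v)) \<Longrightarrow> w = u \<or> w = v"
    and \<gamma>_meet: "(u, v) \<in> parcs G \<Longrightarrow> (x, y) \<in> parcs G \<Longrightarrow> {u, v} \<noteq> {x, y} \<Longrightarrow>
      path_image (\<gamma> (u, v)) \<inter> path_image (\<gamma> (x, y)) \<subseteq> p ` {u, v}" for u v w x y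
    using drawing arc_imp_path unfolding plane_drawing_def by fast+
  have wf: "u \<in> pverts G" "v \<in> pverts G" "u \<noteq> v" if "(u, v) \<in> parcs G" for u v
    using that G.in_arcsD1 G.in_arcsD2 G.pair_no_loops by fastforce+
  obtain h :: "'a \<Rightarrow> nat" where h: "inj_on h (pverts G)"
    using finite_imp_inj_to_nat_seg[OF G.pair_finite_verts] by blast
  define E where "E = {(u, v) \<in> parcs G. h u < h v}"
  have E: "(u, v) \<in> parcs G" if "(u, v) \<in> E" for u v using that by (simp add: E_def)
  define F where "F = (\<lambda>(u, w). ({p u}, {p w})) ` {(u, w) \<in> pverts G \<times> pverts G. u \<noteq> w} \<union>
    (\<lambda>(w, e). ({p w}, path_image (\<gamma> e))) ` {(w, e) \<in> pverts G \<times> parcs G. w \<noteq> fst e \<and> w \<noteq> snd e}"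
  have "finite {(u, w) \<in> pverts G \<times> pverts G. u \<noteq> w}"
    by (rule finite_subset[of _ "pverts G \<times> pverts G"]) auto
  moreover have "finite {(w, e) \<in> pverts G \<times> parcs G. w \<noteq> fst e \<and> w \<noteq> snd e}"
    by (rule finite_subset[of _ "pverts G \<times> parcs G"]) auto
  ultimately have "finite F" by (simp add: F_def)
  moreover have "compact S \<and> compact T \<and> S \<inter> T = {}" if "(S, T) \<in> F" for S T
  proof -
    from that consider u w where "u \<in> pverts G" "w \<in> pverts G" "u \<noteq> w" "S = {p u}" "T = {p w}"
      | w u v where "w \<in> pverts G" "(u, v) \<in> parcs G" "w \<noteq> u" "w \<noteq> v" "S = {p w}" "T = path_image (\<gamma> (u, v))"
      unfolding F_def by auto
    then show ?thesis
    proof cases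
      case 1
      then show ?thesis using inj_onD[OF inj, of u w] by auto
    next
      case 2
      then show ?thesis using \<gamma>[OF 2(2)] \<gamma>_vert[OF 2(2,1)] by (auto intro: compact_path_image)
    qed
  qed
  ultimately obtain \<eta> where \<eta>: "0 < \<eta>" "\<forall>(S, T)\<in>F. \<forall>x\<in>S. \<forall>y\<in>T. \<eta> \<le> dist x y"
    using finite_separation[of F] by blast
  have sep_v: "\<eta> \<le> dist (p u) (p w)" if "u \<in> pverts G" "w \<in> pverts G" "u \<noteq> w" for u w
  proof -
    have "({p u}, {p w}) \<in> F" using that by (force simp: F_def)
    with \<eta>(2) show ?thesis by blast
  qed
  have sep_e: "\<eta> \<le> dist (p w) x" if "w \<in> pverts G" "(u, v) \<in> parcs G" "w \<noteq> u" "w \<noteq> v" "x \<in> path_image (\<gamma> (u, v))" for u v w x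
  proof -
    have "({p w}, path_image (\<gamma> (u, v))) \<in> F" using that(1-4) by (force simp: F_def)
    with \<eta>(2) that(5) show ?thesis by blast
  qed
  define \<delta> where "\<delta> = \<eta> / 5"
  have \<delta>: "0 < \<delta>" "4 * \<delta> < \<eta>" "\<delta> < \<eta>" using \<eta>(1) by (simp_all add: \<delta>_def)
  have "\<exists>k. path k \<and> path_image k \<subseteq> path_image (\<gamma> e) \<and> dist (p (fst e)) (pathstart k) = \<delta> \<and> dist (p (snd e)) (pathfinish k) = \<delta> \<and>
      (\<forall>x\<in>path_image k. (x = pathstart k \<or> \<delta> < dist (p (fst e)) x) \<and> (x = pathfinish k \<or> \<delta> < dist (p (snd e)) x))"
    if e: "e \<in> parcs G" for e
  proof -
    obtain u v where uv: "e = (u, v)" by (cases e)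
    note e = e[unfolded uv]
    have d2: "2 * \<delta> < dist (p u) (p v)" using sep_v[OF wf[OF e]] \<delta> by linarith
    from \<gamma>[OF e] have g: "path (\<gamma> (u, v))" "pathstart (\<gamma> (u, v)) = p u" "pathfinish (\<gamma> (u, v)) = p v" by simp_all
    from arc_between_discs[OF g \<delta>(1) d2]
    obtain k where "path k" "path_image k \<subseteq> path_image (\<gamma> (u, v))" "dist (p u) (pathstart k) = \<delta>" "dist (p v) (pathfinish k) = \<delta>"
      "\<And>x. x \<in> path_image k \<Longrightarrow> x = pathstart k \<or> \<delta> < dist (p u) x" "\<And>x. x \<in> path_image k \<Longrightarrow> x = pathfinish k \<or> \<delta> < dist (p v) x"
      by metis
    then show ?thesis unfolding uv by (intro exI[of _ k]) simp
  qed
  then obtain k where k: "\<And>e. e \<in> parcs G \<Longrightarrow> path (k e) \<and> path_image (k e) \<subseteq> path_image (\<gamma> e) \<and>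
      dist (p (fst e)) (pathstart (k e)) = \<delta> \<and> dist (p (snd e)) (pathfinish (k e)) = \<delta> \<and>
      (\<forall>x\<in>path_image (k e). (x = pathstart (k e) \<or> \<delta> < dist (p (fst e)) x) \<and> (x = pathfinish (k e) \<or> \<delta> < dist (p (snd e)) x))"
    by metis
  have far: "\<delta> < dist (p w) z \<or> w = u \<and> z = pathstart (k (u, v)) \<or> w = v \<and> z = pathfinish (k (u, v))"
    if uv: "(u, v) \<in> parcs G" and w: "w \<in> pverts G" and z: "z \<in> path_image (k (u, v))" for u v w z
  proof (cases "w = u \<or> w = v")
    case True
    then show ?thesis using k[OF uv] z by auto
  next
    case False
    have "z \<in> path_image (\<gamma> (u, v))" using k[OF uv] z by blast
    then have "\<eta> \<le> dist (p w) z" using sep_e[OF w uv] False by blast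
    then show ?thesis using \<delta>(3) by simp
  qed
  have off: "p w \<notin> path_image (k (u, v))" if uv: "(u, v) \<in> parcs G" and w: "w \<in> pverts G" for u v w
    using far[OF uv w, of "p w"] k[OF uv] \<delta>(1) by auto
  have "disc_drawing G p E \<delta> (\<lambda>u v. k (u, v))"
  proof (rule disc_drawing.intro)
    show "E \<subseteq> parcs G" using E by auto
    show "(u, v) \<in> E \<or> (v, u) \<in> E" if "(u, v) \<in> parcs G" for u v
      using that G.arcs_symmetric[OF that] inj_onD[OF h, of u v] wf[OF that] by (cases "h u" "h v" rule: linorder_cases) (auto simp: E_def)
    show "(v, u) \<notin> E" if "(u, v) \<in> E" for u v using that by (simp add: E_def)
    show "card {v. (u, v) \<in> parcs G} \<le> 5" if "u \<in> pverts G" for u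
      using degree_le_max_degree[OF G that] deg by simp
    show "0 < \<delta>" by (rule \<delta>(1))
    show "4 * \<delta> < dist (p u) (p w)" if "u \<in> pverts G" "w \<in> pverts G" "u \<noteq> w" for u w
      using sep_v[OF that] \<delta>(2) by simp
    show "path (k (u, v))" "dist (p u) (pathstart (k (u, v))) = \<delta>" "dist (p v) (pathfinish (k (u, v))) = \<delta>"
      if "(u, v) \<in> E" for u v using k[OF E[OF that]] by simp_all
    show "\<delta> < dist (p w) z \<or> w = u \<and> z = pathstart (k (u, v)) \<or> w = v \<and> z = pathfinish (k (u, v))"
      if "(u, v) \<in> E" "w \<in> pverts G" "z \<in> path_image (k (u, v))" for u v w z
      using far[OF E[OF that(1)] that(2,3)] .
    show "path_image (k (u, v)) \<inter> path_image (k (x, y)) = {}" if uv: "(u, v) \<in> E" and xy: "(x, y) \<in> E" and neq: "(u, v) \<noteq> (x, y)" for u v x y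
    proof -
      have "{u, v} \<noteq> {x, y}" using uv xy neq by (auto simp: E_def doubleton_eq_iff)
      from \<gamma>_meet[OF E[OF uv] E[OF xy] this]
      have "path_image (k (u, v)) \<inter> path_image (k (x, y)) \<subseteq> p ` {u, v}" using k[OF E[OF uv]] k[OF E[OF xy]] by blast
      then show ?thesis using off[OF E[OF uv]] wf[OF E[OF uv]] by blast
    qed
  qed (fact G)
  then show ?thesis by blast
qed

lemma fine_drawing_exists:
  assumes "pair_graph G" "planar G" "max_degree G \<le> 5"
  shows "\<exists>c \<Phi> L. fine_drawing G c \<Phi> L"
proof -
  obtain p \<gamma> where "plane_drawing G p \<gamma>" using assms(2) by (auto simp: planar_def)
  then obtain E \<delta> k where "disc_drawing G p E \<delta> k" using disc_drawing_exists assms(1,3) by blast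
  then obtain E q d P len where "coarse_drawing G E q d P len" using disc_drawing.coarse_drawing_exists by blast
  then show ?thesis by (rule coarse_drawing.fine_drawing_exists)
qed

theorem theoremA:
  fixes G :: "'a pair_pre_digraph"
  assumes "pair_graph G"
    and "planar G"
    and "max_degree G \<le> 5"
  shows "\<exists>r>0. \<exists>G0 G' :: complex pair_pre_digraph.
    digraph_iso (with_proj G) (with_proj G0) \<and>
    subdivision_pair G0 G' \<and>
    planar_geometric_graph r G' \<and>
    (Digraph_Component.connected (with_proj G) \<longrightarrow>
       cop_number (with_proj G') \<in> {cop_number (with_proj G), cop_number (with_proj G) + 1}) \<and>
    (\<forall>H \<in> pre_digraph.sccs (with_proj G0). \<forall>H' \<in> pre_digraph.sccs (with_proj G').
       verts H \<subseteq> verts H' \<longrightarrow> cop_number H' \<in> {cop_number H, cop_number H + 1})"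
proof -
  obtain c \<Phi> L where "fine_drawing G c \<Phi> L" using fine_drawing_exists[OF assms] by blast
  then show ?thesis by (rule fine_drawing.fine_drawing_subdivision)
qed

end
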